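(* Suppose $k$ is an irreducible, complete Nevanlinna-Pick kernel on a set $X$, with reproducing kernel Hilbert space $H$. Then any dual subalgebra $\mathfrak{A}$ of multipliers of $H$ admits a Nevanlinna-Pick family of kernels, i.e. $\{k^L:L\in\operatorname{CycLat}(\mathfrak{A})\}$ is a Nevanlinna-Pick family of kernels for $\mathfrak{A}$. More specifically, if $E=\{\lambda_1,\dots,\lambda_n\}$ is a finite subset of $X$ which is separated by $\mathfrak{A}$ and $w_1,\dots,w_n$ are scalars, then there is a multiplier $f$ in the (closed) unit ball of $\mathfrak{A}$ with $f(\lambda_i)=w_i$ for $1\le i\le n$ if and only if \[ \Big[(1-w_i\overline{w_j})\,\langle P_Lk_{\lambda_j},k_{\lambda_i}\rangle\Big]_{i,j=1}^n\ \geq\ 0 \] for all cyclic invariant subspaces $L=\mathfrak{A}[h]$ of $\mathfrak{A}$; and it suffices to require this for those $L=\mathfrak{A}[h]$ with $h\in H$ not vanishing at any point of $E$.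
   Context: $H$ is a Hilbert space of complex-valued functions on $X$ with reproducing kernels $k_\lambda\neq0$, $h(\lambda)=\langle h,k_\lambda\rangle$, $k(\lambda,\mu)=\langle k_\mu,k_\lambda\rangle$. $\mathfrak{M}(H)=\{f:X\to\mathbb{C}:fh\in H\ \forall h\in H\}$, identified with the algebra of multiplication operators $M_f$ in $\mathcal{B}(H)$; $\mathcal{M}_r(\mathfrak{M}(H))$ is normed as operators on $H\otimes\mathbb{C}^r$. The kernel $k$ is a complete Nevanlinna-Pick kernel if for all $r,n\ge1$, all distinct $\lambda_1,\dots,\lambda_n\in X$ and all $r\times r$ matrices $W_1,\dots,W_n$, positive semidefiniteness of $[(I_r-W_iW_j^* )k(\lambda_i,\lambda_j)]_{i,j}$ is (necessary and) sufficient for the existence of $F\in\mathcal{M}_r(\mathfrak{M}(H))$ with $\|F\|\le1$ and $F(\lambda_i)=W_i$. It is irreducible if for any distinct $\lambda,\mu\in X$, $k_\lambda,k_\mu$ are linearly independent and $\langle k_\lambda,k_\mu\rangle\ne0$. A dual subalgebra $\mathfrak{A}$ of multipliers is a subalgebra of $\mathfrak{M}(H)$ containing $I$ and closed in the weak-$*$ topology of $\mathcal{B}(H)$. $\mathfrak{A}$ separates $E$ if for distinct $\lambda,\mu\in E$ some $f\in\mathfrak{A}$ has $f(\lambda)\ne f(\mu)$. For finite $E\subset X$, $\mathfrak{J}_E=\{f\in\mathfrak{A}:f|_E=0\}$, $\mathfrak{J}_\lambda=\mathfrak{J}_{\{\lambda\}}$, $\operatorname{dist}(f,\mathfrak{J}_E)=\inf_{g\in\mathfrak{J}_E}\|M_f-M_g\|$.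 $\operatorname{CycLat}(\mathfrak{A})$ is the set of cyclic invariant subspaces $\mathfrak{A}[h]=\overline{\mathfrak{A}h}$, $h\in H$; $\mathfrak{J}_\lambda[h]=\overline{\mathfrak{J}_\lambda h}$. $L\ominus\mathfrak{J}_EL$ is the set of vectors in $L$ orthogonal to all $gx$, $g\in\mathfrak{J}_E$, $x\in L$; $P_N$ is the orthogonal projection onto $N$. For $L=\mathfrak{A}[h]$: $k^L_\lambda=P_Lk_\lambda$ if this is nonzero; if $P_Lk_\lambda=0$ but $\mathfrak{J}_\lambda[h]\ne\mathfrak{A}[h]$, $k^L_\lambda$ is a chosen unit vector in the one-dimensional space $\mathfrak{A}[h]\ominus\mathfrak{J}_\lambda[h]$; otherwise $k^L_\lambda=0$. The collection $\{k^L:L\in\operatorname{CycLat}(\mathfrak{A})\}$ is a Nevanlinna-Pick family of kernels for $\mathfrak{A}$ if for every finite $E\subset X$ and every $f\in\mathfrak{A}$, $\operatorname{dist}(f,\mathfrak{J}_E)=\sup_{L\in\operatorname{CycLat}(\mathfrak{A})}\|P_{N_L}M_f^*|_{N_L}\|$, where $N_L=L\ominus\mathfrak{J}_EL$. $\ge0$ means positive semidefinite. *)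

theory Defs
  imports "HOL-Analysis.Analysis"
begin

section \<open>Complex Hilbert spaces\<close>

text \<open>
  The norm and the topology are those of the underlying real inner product, which is the real
  part of the complex one.  The complex inner product is linear in its first argument.
\<close>

class chilbert_space = real_inner + complete_space +
  fixes scaleC :: "complex \<Rightarrow> 'a \<Rightarrow> 'a"  (infixr "*\<^sub>C" 75)
    and cinner :: "'a \<Rightarrow> 'a \<Rightarrow> complex"
  assumes scaleC_add_right: "c *\<^sub>C (x + y) = c *\<^sub>C x + c *\<^sub>C y"
    and scaleC_add_left: "(c + d) *\<^sub>C x = c *\<^sub>C x + d *\<^sub>C x"
    and scaleC_scaleC: "c *\<^sub>C (d *\<^sub>C x) = (c * d) *\<^sub>C x"
    and scaleC_of_real: "complex_of_real r *\<^sub>C x = r *\<^sub>R x"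
    and cinner_add_left: "cinner (x + y) z = cinner x z + cinner y z"
    and cinner_scaleC_left: "cinner (c *\<^sub>C x) y = c * cinner x y"
    and cinner_commute: "cinner x y = cnj (cinner y x)"
    and inner_eq_Re_cinner: "inner x y = Re (cinner x y)"

definition bounded_clinear_ops :: "('h::chilbert_space \<Rightarrow> 'h) set" where
  "bounded_clinear_ops = {T. bounded_linear T \<and> (\<forall>c x. T (c *\<^sub>C x) = c *\<^sub>C T x)}"

definition cadjoint :: "('h::chilbert_space \<Rightarrow> 'h) \<Rightarrow> 'h \<Rightarrow> 'h" where
  "cadjoint T = (THE S. \<forall>x y. cinner (T x) y = cinner x (S y))"

text \<open>Meaningful for closed subspaces \<^term>\<open>N\<close>.\<close>

definition orth_proj :: "'h::chilbert_space set \<Rightarrow> 'h \<Rightarrow> 'h" where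
  "orth_proj N x = (THE y. y \<in> N \<and> (\<forall>z\<in>N. cinner (x - y) z = 0))"

definition orth_diff :: "'h::chilbert_space set \<Rightarrow> 'h set \<Rightarrow> 'h set" where
  "orth_diff L S = {x \<in> L. \<forall>y\<in>S. cinner x y = 0}"

text \<open>The norm of the restriction of an operator to a subspace \<^term>\<open>N\<close>.\<close>

definition norm_on :: "'h::chilbert_space set \<Rightarrow> ('h \<Rightarrow> 'h) \<Rightarrow> real" where
  "norm_on N T = (SUP x\<in>{x \<in> N. norm x \<le> 1}. norm (T x))"

text \<open>
  The predual of the bounded operators is the trace class under the pairing
  \<open>(T, K) \<mapsto> tr (T K)\<close>.  The trace class operators are exactly the sums
  \<open>K = (\<Sum>n. \<langle>\<cdot>, y n\<rangle> x n)\<close> with \<open>x\<close> and \<open>y\<close> square summable, for which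
  \<open>tr (T K) = (\<Sum>n. \<langle>T (x n), y n\<rangle>)\<close>.
\<close>

definition weak_star_topology :: "('h::chilbert_space \<Rightarrow> 'h) topology" where
  "weak_star_topology = topology_generated_by
     {{T \<in> bounded_clinear_ops. (\<Sum>n. cinner (T (x n)) (y n)) \<in> U} | x y U.
        summable (\<lambda>n::nat. (norm (x n))\<^sup>2) \<and> summable (\<lambda>n. (norm (y n))\<^sup>2) \<and> open U}"

definition psd_on :: "'i set \<Rightarrow> ('i \<Rightarrow> 'i \<Rightarrow> complex) \<Rightarrow> bool" where
  "psd_on I A \<longleftrightarrow> (\<forall>c. (\<Sum>i\<in>I. \<Sum>j\<in>I. cnj (c i) * A i j * c j) \<in> \<real>\<^sub>\<ge>\<^sub>0)"


section \<open>Reproducing kernel Hilbert spaces and their multipliers\<close>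

text \<open>
  The set \<open>X\<close> is the type \<open>'x\<close>.  The space \<open>H\<close> is a complex Hilbert space \<open>'h\<close> whose elements
  are regarded as functions on \<open>'x\<close> through \<open>h(\<lambda>) = \<langle>h, k\<^sub>\<lambda>\<rangle>\<close>; injectivity of this map says
  that elements of \<open>H\<close> are determined by their values.
\<close>

definition fun_of :: "('x \<Rightarrow> 'h::chilbert_space) \<Rightarrow> 'h \<Rightarrow> 'x \<Rightarrow> complex" where
  "fun_of k h = (\<lambda>x. cinner h (k x))"

definition reproducing_kernels :: "('x \<Rightarrow> 'h::chilbert_space) \<Rightarrow> bool" where
  "reproducing_kernels k \<longleftrightarrow> inj (fun_of k) \<and> (\<forall>x. k x \<noteq> 0)"

definition kernel_fun :: "('x \<Rightarrow> 'h::chilbert_space) \<Rightarrow> 'x \<Rightarrow> 'x \<Rightarrow> complex" where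
  "kernel_fun k x y = cinner (k y) (k x)"

definition multipliers :: "('x \<Rightarrow> 'h::chilbert_space) \<Rightarrow> ('x \<Rightarrow> complex) set" where
  "multipliers k = {f. \<forall>h. \<exists>g. fun_of k g = (\<lambda>x. f x * fun_of k h x)}"

definition mult_op :: "('x \<Rightarrow> 'h::chilbert_space) \<Rightarrow> ('x \<Rightarrow> complex) \<Rightarrow> 'h \<Rightarrow> 'h" where
  "mult_op k f h = (THE g. fun_of k g = (\<lambda>x. f x * fun_of k h x))"

text \<open>
  An \<open>r \<times> r\<close> matrix is a function of two indices, of which only the values below \<open>r\<close> matter;
  likewise \<open>h :: nat \<Rightarrow> 'h\<close> stands for the element \<open>(h 0, \<dots>, h (r - 1))\<close> of
  \<open>H \<otimes> \<complex>\<^sup>r\<close>, whose norm is \<^term>\<open>L2_set (\<lambda>i. norm (h i)) {..<r}\<close>.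
\<close>

definition matrix_mult_norm ::
    "('x \<Rightarrow> 'h::chilbert_space) \<Rightarrow> nat \<Rightarrow> (nat \<Rightarrow> nat \<Rightarrow> 'x \<Rightarrow> complex) \<Rightarrow> real" where
  "matrix_mult_norm k r F =
     (SUP h\<in>{h. L2_set (\<lambda>j. norm (h j)) {..<r} \<le> 1}.
        L2_set (\<lambda>i. norm (\<Sum>j<r. mult_op k (F i j) (h j))) {..<r})"

definition complete_nevanlinna_pick :: "('x \<Rightarrow> 'h::chilbert_space) \<Rightarrow> bool" where
  "complete_nevanlinna_pick k \<longleftrightarrow>
     (\<forall>(r::nat) (n::nat) (z :: nat \<Rightarrow> 'x) (W :: nat \<Rightarrow> nat \<Rightarrow> nat \<Rightarrow> complex).
        r \<ge> 1 \<longrightarrow> n \<ge> 1 \<longrightarrow> inj_on z {..<n} \<longrightarrow>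
        psd_on ({..<n} \<times> {..<r})
          (\<lambda>(i, a) (j, b).
             ((if a = b then 1 else 0) - (\<Sum>c<r. W i a c * cnj (W j b c)))
               * kernel_fun k (z i) (z j)) \<longrightarrow>
        (\<exists>F. (\<forall>a<r. \<forall>b<r. F a b \<in> multipliers k) \<and> matrix_mult_norm k r F \<le> 1 \<and>
             (\<forall>i<n. \<forall>a<r. \<forall>b<r. F a b (z i) = W i a b)))"

definition irreducible_kernel :: "('x \<Rightarrow> 'h::chilbert_space) \<Rightarrow> bool" where
  "irreducible_kernel k \<longleftrightarrow>
     (\<forall>x y. x \<noteq> y \<longrightarrow>
        (\<forall>a b. a *\<^sub>C k x + b *\<^sub>C k y = 0 \<longrightarrow> a = 0 \<and> b = 0) \<and> cinner (k x) (k y) \<noteq> 0)"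


section \<open>Dual subalgebras and Nevanlinna-Pick families\<close>

definition dual_subalgebra ::
    "('x \<Rightarrow> 'h::chilbert_space) \<Rightarrow> ('x \<Rightarrow> complex) set \<Rightarrow> bool" where
  "dual_subalgebra k A \<longleftrightarrow>
     A \<subseteq> multipliers k \<and> (\<lambda>x. 1) \<in> A \<and>
     (\<forall>f\<in>A. \<forall>g\<in>A. (\<lambda>x. f x + g x) \<in> A \<and> (\<lambda>x. f x * g x) \<in> A) \<and>
     (\<forall>c. \<forall>f\<in>A. (\<lambda>x. c * f x) \<in> A) \<and>
     closedin weak_star_topology (mult_op k ` A)"

definition separates :: "('x \<Rightarrow> complex) set \<Rightarrow> 'x set \<Rightarrow> bool" where
  "separates A E \<longleftrightarrow> (\<forall>x\<in>E. \<forall>y\<in>E. x \<noteq> y \<longrightarrow> (\<exists>f\<in>A. f x \<noteq> f y))"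

definition vanishing_ideal :: "('x \<Rightarrow> complex) set \<Rightarrow> 'x set \<Rightarrow> ('x \<Rightarrow> complex) set" where
  "vanishing_ideal A E = {f \<in> A. \<forall>x\<in>E. f x = 0}"

definition mult_dist ::
    "('x \<Rightarrow> 'h::chilbert_space) \<Rightarrow> ('x \<Rightarrow> complex) \<Rightarrow> ('x \<Rightarrow> complex) set \<Rightarrow> real" where
  "mult_dist k f J = (INF g\<in>J. onorm (\<lambda>h. mult_op k f h - mult_op k g h))"

definition cyclic_subspace ::
    "('x \<Rightarrow> 'h::chilbert_space) \<Rightarrow> ('x \<Rightarrow> complex) set \<Rightarrow> 'h \<Rightarrow> 'h set" where
  "cyclic_subspace k A h = closure ((\<lambda>f. mult_op k f h) ` A)"

definition CycLat :: "('x \<Rightarrow> 'h::chilbert_space) \<Rightarrow> ('x \<Rightarrow> complex) set \<Rightarrow> 'h set set" where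
  "CycLat k A = range (cyclic_subspace k A)"

text \<open>The space \<open>N\<^sub>L = L \<ominus> J\<^sub>E L\<close>.\<close>

definition quotient_space ::
    "('x \<Rightarrow> 'h::chilbert_space) \<Rightarrow> ('x \<Rightarrow> complex) set \<Rightarrow> 'x set \<Rightarrow> 'h set \<Rightarrow> 'h set" where
  "quotient_space k A E L = orth_diff L {mult_op k g x | g x. g \<in> vanishing_ideal A E \<and> x \<in> L}"

text \<open>
  \<^term>\<open>K L x\<close> is the vector \<open>k\<^sup>L\<^sub>x\<close>.  Since it involves a choice of unit vectors, being the
  collection \<open>{k\<^sup>L}\<close> is a predicate on \<^term>\<open>K\<close>; only the values on \<open>CycLat\<close> are constrained.
\<close>

definition cyclic_kernels ::
    "('x \<Rightarrow> 'h::chilbert_space) \<Rightarrow> ('x \<Rightarrow> complex) set \<Rightarrow> ('h set \<Rightarrow> 'x \<Rightarrow> 'h) \<Rightarrow> bool" where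
  "cyclic_kernels k A K \<longleftrightarrow>
     (\<forall>h x. let L = cyclic_subspace k A h; M = cyclic_subspace k (vanishing_ideal A {x}) h in
        if orth_proj L (k x) \<noteq> 0 then K L x = orth_proj L (k x)
        else if M \<noteq> L then K L x \<in> orth_diff L M \<and> norm (K L x) = 1
        else K L x = 0)"

definition nevanlinna_pick_family ::
    "('x \<Rightarrow> 'h::chilbert_space) \<Rightarrow> ('x \<Rightarrow> complex) set \<Rightarrow> ('h set \<Rightarrow> 'x \<Rightarrow> 'h) \<Rightarrow> bool" where
  "nevanlinna_pick_family k A K \<longleftrightarrow>
     cyclic_kernels k A K \<and>
     (\<forall>E f. finite E \<longrightarrow> f \<in> A \<longrightarrow>
        mult_dist k f (vanishing_ideal A E) =
          (SUP L\<in>CycLat k A. let N = quotient_space k A E L in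
             norm_on N (\<lambda>x. orth_proj N (cadjoint (mult_op k f) x))))"

end

theory Submission
  imports Defs
begin

text \<open>
  Everything rests on one property of complete Nevanlinna--Pick spaces (\<open>factorization\<close>): a square
  summable sequence of vectors \<open>x n\<close> can be written as \<open>x n = \<phi> n \<cdot> h\<close> with a single vector \<open>h\<close>,
  \<open>\<parallel>h\<parallel>\<^sup>2 \<le> \<Sum> \<parallel>x n\<parallel>\<^sup>2\<close>, and functions \<open>\<phi> n\<close> that form a contractive column of multipliers.  Since
  multiplication operators commute with the column, \<open>\<Sum> \<parallel>f x n\<parallel>\<^sup>2 \<le> \<parallel>f h\<parallel>\<^sup>2\<close> for every multiplier \<open>f\<close>
  (\<open>domination\<close>).  Weak-star conditions, which involve infinitely many vectors, can therefore be
  tested at one vector at a time, that is, on cyclic subspaces.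

  This is used twice.  A weak-star closed algebra contains every multiplication operator that maps
  each \<open>h\<close> into the cyclic subspace of \<open>h\<close> (\<open>dual_subalgebra_reflexive\<close>).  And if, for every single
  \<open>h\<close>, some \<open>g\<close> in the algebra that agrees with \<open>f\<close> on \<open>E\<close> satisfies \<open>\<parallel>g h\<parallel> \<le> c \<parallel>h\<parallel>\<close> up to a small
  error, then one \<open>g\<close> does so for all \<open>h\<close> (\<open>interpolant_exists\<close>): weighted sums of \<open>\<parallel>g v\<parallel>\<^sup>2\<close> over
  finitely many \<open>v\<close> are bounded by domination, a minimax argument makes the bounds simultaneous, and
  weak compactness produces the limit.  It is enough to know the hypothesis for those \<open>h\<close> without
  zeros on \<open>E\<close>, because small multiples of kernel functions can be added to the sequence that \<open>h\<close>
  is made to dominate.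

  For a single \<open>h\<close> the best value of \<open>\<parallel>g h\<parallel>\<close> is the distance from \<open>f h\<close> to the closure of the orbit of
  \<open>h\<close> under the ideal of \<open>E\<close>.  A computation in the cyclic subspace \<open>L\<close> of \<open>h\<close> bounds this distance by
  the norm of the compression of the adjoint of \<open>f\<close> to \<open>N\<^sub>L\<close> (\<open>residual_le\<close>), which gives the distance
  formula.  If \<open>h\<close> has no zeros on \<open>E\<close> and the algebra separates \<open>E\<close>, the space \<open>N\<^sub>L\<close> is spanned by
  the projections of the kernel functions, and the Pick matrix of \<open>L\<close> controls the distance
  (\<open>interpolation_sufficient\<close>).

  The factorization comes from an extremal problem.  Among all factorizations \<open>x = \<Phi> y\<close>, where \<open>y\<close>
  takes values in an auxiliary space, is not larger in norm than \<open>x\<close>, and \<open>\<Phi>\<close> is contractive,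
  maximise \<open>\<parallel>y z0\<parallel>\<close>.  The component of \<open>y\<close> orthogonal to the direction of \<open>y z0\<close> vanishes at \<open>z0\<close>.
  By the theorem of McCullough and Quiggin it can be divided, without changing its norm, by a row
  \<open>b\<close> of functions with \<open>\<parallel>b z\<parallel> < 1\<close>; this gives another factorization.  By maximality the quotient
  vanishes at \<open>z0\<close> again, so that the division can be repeated, and in the limit the component
  disappears: \<open>y\<close> is scalar.  On a finite set of points only Gram matrices of a fixed size matter
  (\<open>rank_one_member\<close>, \<open>finite_factorization\<close>), which provides the maximiser, and Tychonoff's theorem
  passes to all points.
\<close>

section \<open>Complex Hilbert spaces\<close>

lemma cinner_add_right: "cinner x (y + z) = cinner x y + cinner x z"
  by (metis cinner_commute cinner_add_left complex_cnj_add)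

lemma cinner_scaleC_right: "cinner x (c *\<^sub>C y) = cnj c * cinner x y"
  by (metis cinner_commute cinner_scaleC_left complex_cnj_mult)

lemma cinner_zero_left [simp]: "cinner 0 x = 0"
  using cinner_add_left[of 0 0 x] by simp

lemma cinner_zero_right [simp]: "cinner x 0 = 0"
  using cinner_add_right[of x 0 0] by simp

lemma scaleC_minus1: "(- 1) *\<^sub>C x = - (x :: 'h::chilbert_space)"
  using scaleC_of_real[of "- 1" x] by simp

lemma scaleC_one [simp]: "1 *\<^sub>C x = (x :: 'h::chilbert_space)"
  using scaleC_of_real[of 1 x] by simp

lemma scaleC_zero_left [simp]: "0 *\<^sub>C x = (0 :: 'h::chilbert_space)"
  using scaleC_of_real[of 0 x] by simp

lemma cinner_minus_left: "cinner (- x) y = - cinner x y"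
  using cinner_scaleC_left[of "- 1" x y] by (simp add: scaleC_minus1)

lemma cinner_minus_right: "cinner x (- y) = - cinner x y"
  using cinner_scaleC_right[of x "- 1" y] by (simp add: scaleC_minus1)

lemma cinner_diff_left: "cinner (x - y) z = cinner x z - cinner y z"
  using cinner_add_left[of x "- y" z] by (simp add: cinner_minus_left)

lemma cinner_diff_right: "cinner x (y - z) = cinner x y - cinner x z"
  using cinner_add_right[of x y "- z"] by (simp add: cinner_minus_right)

lemma cinner_sum_left: "cinner (\<Sum>i\<in>I. f i) y = (\<Sum>i\<in>I. cinner (f i) y)"
  by (induction I rule: infinite_finite_induct) (auto simp: cinner_add_left)

lemma cinner_sum_right: "cinner y (\<Sum>i\<in>I. f i) = (\<Sum>i\<in>I. cinner y (f i))"
  by (induction I rule: infinite_finite_induct) (auto simp: cinner_add_right)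

lemma cinner_scaleR_left: "cinner (r *\<^sub>R x) y = of_real r * cinner x y"
  by (metis cinner_scaleC_left scaleC_of_real)

lemma cinner_scaleR_right: "cinner x (r *\<^sub>R y) = of_real r * cinner x y"
  by (metis cinner_scaleC_right scaleC_of_real complex_cnj_complex_of_real)

lemma cinner_self: "cinner x x = of_real ((norm x)\<^sup>2)"
proof -
  have "Im (cinner x x) = 0"
    using cinner_commute[of x x] by (metis complex_cnj_cancel_iff complex_eq_iff cnj.simps(2) neg_equal_zero)
  moreover have "Re (cinner x x) = (norm x)\<^sup>2"
    by (simp add: power2_norm_eq_inner inner_eq_Re_cinner)
  ultimately show ?thesis by (simp add: complex_eq_iff)
qed

lemma cmod_cinner_self: "cmod (cinner x x) = (norm x)\<^sup>2"
  unfolding cinner_self norm_of_real by simp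

lemma norm_scaleC: "norm (c *\<^sub>C x) = cmod c * norm (x :: 'h::chilbert_space)"
proof -
  have "complex_of_real ((norm (c *\<^sub>C x))\<^sup>2) = of_real ((cmod c * norm x)\<^sup>2)"
    unfolding cinner_self[symmetric] power_mult_distrib of_real_mult complex_norm_square[of c]
    by (simp add: cinner_scaleC_left cinner_scaleC_right)
  then have "(norm (c *\<^sub>C x))\<^sup>2 = (cmod c * norm x)\<^sup>2"
    using of_real_eq_iff by blast
  then show ?thesis by (simp add: power2_eq_iff_nonneg)
qed

lemma cmod_cinner_le: "cmod (cinner x y) \<le> norm x * norm y"
proof (cases "cinner x y = 0")
  case False
  define s where "s = cnj (sgn (cinner x y))"
  have s: "cmod s = 1" using False by (simp add: s_def norm_sgn)
  have "of_real (cmod z) = cnj (sgn z) * z" for z :: complex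
    by (cases "z = 0") (auto simp: sgn_eq complex_norm_square[symmetric] power2_eq_square mult.commute[of "cnj z"])
  then have "of_real (cmod (cinner x y)) = cinner (s *\<^sub>C x) y"
    by (simp add: cinner_scaleC_left s_def)
  then have "cmod (cinner x y) = inner (s *\<^sub>C x) y"
    unfolding inner_eq_Re_cinner by (metis Re_complex_of_real)
  also have "\<dots> \<le> norm (s *\<^sub>C x) * norm y" by (rule norm_cauchy_schwarz)
  finally show ?thesis by (simp add: norm_scaleC s)
qed simp

lemma le_of_square_le:
  assumes "a\<^sup>2 \<le> C * a" "0 \<le> (C :: real)"
  shows "a \<le> C"
  using assms mult_right_le_imp_le[of a a C] by (cases "a > 0") (auto simp: power2_eq_square)

lemma bounded_linear_cinner_left: "bounded_linear (\<lambda>x. cinner x y)"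
  by (rule bounded_linear_intro[where K = "norm y"])
     (auto simp: cinner_add_left cinner_scaleR_left scaleR_conv_of_real cmod_cinner_le)

lemma bounded_linear_cinner_right: "bounded_linear (\<lambda>x. cinner y x)"
  by (rule bounded_linear_intro[where K = "norm y"])
     (auto simp: cinner_add_right cinner_scaleR_right scaleR_conv_of_real
      cmod_cinner_le[of y, unfolded mult.commute[of "norm y"]])

lemmas tendsto_cinner_left [tendsto_intros] = bounded_linear.tendsto[OF bounded_linear_cinner_left]
lemmas tendsto_cinner_right [tendsto_intros] = bounded_linear.tendsto[OF bounded_linear_cinner_right]
lemmas continuous_on_cinner_left [continuous_intros] =
  bounded_linear.continuous_on[OF bounded_linear_cinner_left]
lemmas continuous_on_cinner_right [continuous_intros] =
  bounded_linear.continuous_on[OF bounded_linear_cinner_right]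

lemma bounded_linear_scaleC: "bounded_linear (\<lambda>x :: 'h::chilbert_space. c *\<^sub>C x)"
proof (rule bounded_linear_intro[where K = "cmod c"])
  show "c *\<^sub>C (r *\<^sub>R x) = r *\<^sub>R (c *\<^sub>C x)" for r and x :: 'h
    by (simp add: scaleC_scaleC mult.commute flip: scaleC_of_real)
qed (auto simp: scaleC_add_right norm_scaleC mult.commute)

lemma scaleC_sum_right: "c *\<^sub>C (\<Sum>i\<in>I. f i) = (\<Sum>i\<in>I. c *\<^sub>C (f i :: 'h::chilbert_space))"
  by (rule linear_sum[OF bounded_linear.linear[OF bounded_linear_scaleC]])

lemma cinner_ext:
  assumes "\<And>z. cinner x z = cinner y z"
  shows "x = y"
proof -
  have "cinner (x - y) (x - y) = 0" by (simp add: cinner_diff_left assms)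
  then show ?thesis by (simp add: cinner_self)
qed

lemma norm_add_scaleC_sq:
  "(norm (x + of_real t *\<^sub>C y))\<^sup>2 = (norm x)\<^sup>2 + 2 * t * Re (cinner x y) + t\<^sup>2 * (norm y)\<^sup>2"
  unfolding scaleC_of_real power2_norm_eq_inner
  by (simp add: inner_add_left inner_add_right inner_eq_Re_cinner[symmetric] inner_commute[of y x]
      power2_eq_square algebra_simps)

definition complex_subspace :: "'h::chilbert_space set \<Rightarrow> bool" where
  "complex_subspace S \<longleftrightarrow>
     0 \<in> S \<and> (\<forall>x\<in>S. \<forall>y\<in>S. x + y \<in> S) \<and> (\<forall>c. \<forall>x\<in>S. c *\<^sub>C x \<in> S)"

lemma complex_subspace_diff:
  assumes "complex_subspace S" "x \<in> S" "y \<in> S"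
  shows "x - y \<in> S"
  using assms unfolding complex_subspace_def
  by (metis add.commute diff_conv_add_uminus scaleC_minus1)

lemma complex_subspace_closure:
  assumes "complex_subspace S"
  shows "complex_subspace (closure S)"
  unfolding complex_subspace_def
proof (intro conjI ballI allI)
  show "0 \<in> closure S" using assms closure_subset unfolding complex_subspace_def by blast
next
  fix x y assume "x \<in> closure S" "y \<in> closure S"
  then obtain f g where f: "\<forall>n. f n \<in> S" "f \<longlonglongrightarrow> x" and g: "\<forall>n. g n \<in> S" "g \<longlonglongrightarrow> y"
    unfolding closure_sequential by blast
  then have "\<forall>n. f n + g n \<in> S" "(\<lambda>n. f n + g n) \<longlonglongrightarrow> x + y"
    using assms tendsto_add unfolding complex_subspace_def by blast+
  then show "x + y \<in> closure S"
    unfolding closure_sequential by (intro exI[of _ "\<lambda>n. f n + g n"]) simp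
next
  fix c x assume "x \<in> closure S"
  then obtain f where f: "\<forall>n. f n \<in> S" "f \<longlonglongrightarrow> x"
    unfolding closure_sequential by blast
  then have "\<forall>n. c *\<^sub>C f n \<in> S" "(\<lambda>n. c *\<^sub>C f n) \<longlonglongrightarrow> c *\<^sub>C x"
    using assms bounded_linear.tendsto[OF bounded_linear_scaleC]
    unfolding complex_subspace_def by blast+
  then show "c *\<^sub>C x \<in> closure S"
    unfolding closure_sequential by (intro exI[of _ "\<lambda>n. c *\<^sub>C f n"]) simp
qed

text \<open>
  The Riesz representation theorem for a functional that is only defined on a subspace, given by
  its graph.  The representing vector minimises \<open>\<parallel>x\<parallel>\<^sup>2 - 2 Re l\<close> over the graph: by the
  parallelogram law a minimising sequence is Cauchy, and the first variation at its limit is the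
  representation.
\<close>

lemma riesz_on_graph:
  fixes S :: "('h::chilbert_space \<times> complex) set"
  assumes zero: "(0, 0) \<in> S"
    and add: "\<And>x l y m. (x, l) \<in> S \<Longrightarrow> (y, m) \<in> S \<Longrightarrow> (x + y, l + m) \<in> S"
    and scale: "\<And>c x l. (x, l) \<in> S \<Longrightarrow> (c *\<^sub>C x, c * l) \<in> S"
    and bound: "\<And>x l. (x, l) \<in> S \<Longrightarrow> cmod l \<le> C * norm x"
    and C: "C \<ge> 0"
  shows "\<exists>u \<in> closure (fst ` S). norm u \<le> C \<and> (\<forall>(x, l)\<in>S. cinner x u = l)"
proof -
  define J where "J p = (norm (fst p))\<^sup>2 - 2 * Re (snd p)" for p :: "'h \<times> complex"
  define m where "m = Inf (J ` S)"
  have J_lower: "- (C\<^sup>2) \<le> J p" if "p \<in> S" for p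
  proof -
    have "Re (snd p) \<le> C * norm (fst p)"
      using bound[of "fst p" "snd p"] that complex_Re_le_cmod[of "snd p"] by auto
    moreover have "0 \<le> (norm (fst p) - C)\<^sup>2" by simp
    ultimately show ?thesis by (simp add: J_def power2_eq_square algebra_simps)
  qed
  have bdd: "bdd_below (J ` S)" using J_lower by (metis bdd_belowI2)
  have ne: "J ` S \<noteq> {}" using zero by auto
  have m_le: "m \<le> J p" if "p \<in> S" for p
    unfolding m_def using bdd that by (simp add: cInf_lower)
  define \<delta> where "\<delta> n = inverse (real (Suc n))" for n
  have \<delta>_pos: "0 < \<delta> n" and \<delta>_mono: "i \<le> j \<Longrightarrow> \<delta> j \<le> \<delta> i" for n i j
    by (simp_all add: \<delta>_def)
  have \<delta>_lim: "\<delta> \<longlonglongrightarrow> 0"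
    using LIMSEQ_inverse_real_of_nat by (simp add: \<delta>_def[abs_def])
  have "\<exists>p\<in>S. J p < m + \<delta> n" for n
    using cInf_lessD[OF ne, of "m + \<delta> n"] \<delta>_pos[of n] by (auto simp: m_def)
  then obtain p where pS: "\<And>n. p n \<in> S" and pJ: "\<And>n. J (p n) < m + \<delta> n"
    by metis
  define x where "x n = fst (p n)" for n
  define l where "l n = snd (p n)" for n
  have xl: "(x n, l n) \<in> S" for n using pS by (simp add: x_def l_def)
  have Jxl: "J (p n) = (norm (x n))\<^sup>2 - 2 * Re (l n)" for n by (simp add: J_def x_def l_def)
  have par: "(norm (x i - x j))\<^sup>2 \<le> 2 * (\<delta> i + \<delta> j)" for i j
  proof -
    have mid: "((1/2) *\<^sub>C (x i + x j), (1/2) * (l i + l j)) \<in> S"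
      using add[OF xl xl] scale by blast
    have "norm ((1/2 :: complex) *\<^sub>C (x i + x j)) = norm (x i + x j) / 2"
      unfolding norm_scaleC by simp
    then have "m \<le> (norm (x i + x j) / 2)\<^sup>2 - 2 * Re ((1/2) * (l i + l j))"
      using m_le[OF mid] unfolding J_def fst_conv snd_conv by metis
    then have "m \<le> (norm (x i + x j))\<^sup>2 / 4 - Re (l i + l j)"
      by (simp add: power_divide add_divide_distrib)
    moreover have "(norm (x i + x j))\<^sup>2 + (norm (x i - x j))\<^sup>2 = 2 * (norm (x i))\<^sup>2 + 2 * (norm (x j))\<^sup>2"
      by (simp add: power2_norm_eq_inner inner_add_left inner_add_right inner_diff_left
          inner_diff_right)
    ultimately show ?thesis using pJ[of i] pJ[of j] by (simp add: Jxl)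
  qed
  have "Cauchy x"
  proof (rule metric_CauchyI)
    fix e :: real assume e: "0 < e"
    obtain N where N: "\<delta> N < e\<^sup>2 / 4"
      using reals_Archimedean[of "e\<^sup>2 / 4"] e by (auto simp: \<delta>_def)
    have "dist (x i) (x j) < e" if "i \<ge> N" "j \<ge> N" for i j
    proof -
      have "\<delta> i \<le> \<delta> N" "\<delta> j \<le> \<delta> N" using that \<delta>_mono by auto
      then have "2 * (\<delta> i + \<delta> j) \<le> 4 * \<delta> N" by simp
      also have "\<dots> < e\<^sup>2" using N by simp
      finally have "(norm (x i - x j))\<^sup>2 < e\<^sup>2" using par[of i j] by (rule order.strict_trans1[rotated])
      then show ?thesis using e by (simp add: dist_norm power_less_imp_less_base)
    qed
    then show "\<exists>M. \<forall>m\<ge>M. \<forall>n\<ge>M. dist (x m) (x n) < e" by blast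
  qed
  then obtain u where u: "x \<longlonglongrightarrow> u" using Cauchy_convergent convergent_def by blast
  have Re_eq: "Re (cinner y u) = Re q" if yq: "(y, q) \<in> S" for y q
  proof -
    define d where "d = Re (cinner u y) - Re q"
    have var: "0 \<le> 2 * t * d + t\<^sup>2 * (norm y)\<^sup>2" for t
    proof -
      have "m \<le> (norm (x n + of_real t *\<^sub>C y))\<^sup>2 - 2 * Re (l n + of_real t * q)" for n
        using m_le[OF add[OF xl scale[OF yq, of "of_real t"]]] by (simp add: J_def)
      then have le: "- \<delta> n \<le> 2 * t * (Re (cinner (x n) y) - Re q) + t\<^sup>2 * (norm y)\<^sup>2" for n
        using pJ[of n] unfolding norm_add_scaleC_sq Jxl
        by (simp add: algebra_simps) (smt (verit))
      have "(\<lambda>n. - \<delta> n) \<longlonglongrightarrow> 0"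
        using tendsto_minus[OF \<delta>_lim] by simp
      moreover have "(\<lambda>n. 2 * t * (Re (cinner (x n) y) - Re q) + t\<^sup>2 * (norm y)\<^sup>2)
          \<longlonglongrightarrow> 2 * t * d + t\<^sup>2 * (norm y)\<^sup>2"
        unfolding d_def by (intro tendsto_intros u)
      ultimately show ?thesis using le by (blast intro: LIMSEQ_le)
    qed
    have "d = 0"
    proof (rule ccontr)
      assume "d \<noteq> 0"
      define s where "s = 1 / (1 + (norm y)\<^sup>2)"
      have s: "s > 0" "s * (norm y)\<^sup>2 = 1 - s"
        by (simp_all add: s_def add_pos_nonneg field_simps add_nonneg_eq_0_iff)
      have "2 * (- d * s) * d + (- d * s)\<^sup>2 * (norm y)\<^sup>2 = d\<^sup>2 * s * (s * (norm y)\<^sup>2 - 2)"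
        by (simp add: power2_eq_square algebra_simps)
      also have "\<dots> = d\<^sup>2 * s * (- 1 - s)" using s by simp
      also have "\<dots> < 0" using s \<open>d \<noteq> 0\<close> by (intro mult_pos_neg) auto
      finally show False using var[of "- d * s"] by linarith
    qed
    then show ?thesis using cinner_commute[of u y] by (simp add: d_def)
  qed
  have rep: "cinner y u = q" if yq: "(y, q) \<in> S" for y q
  proof -
    have "Re (cinner (- \<i> *\<^sub>C y) u) = Re (- \<i> * q)" by (rule Re_eq[OF scale[OF yq]])
    then have "Im (cinner y u) = Im q" by (simp add: cinner_scaleC_left)
    then show ?thesis using Re_eq[OF yq] by (simp add: complex_eq_iff)
  qed
  have "u \<in> closure (fst ` S)"
    unfolding closure_sequential using u pS x_def by (metis imageI)
  moreover have "norm u \<le> C"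
  proof -
    have "cmod (cinner (x n) u) \<le> C * norm (x n)" for n using rep[OF xl] bound[OF xl] by simp
    moreover have "(\<lambda>n. cmod (cinner (x n) u)) \<longlonglongrightarrow> cmod (cinner u u)"
      by (intro tendsto_intros u)
    moreover have "(\<lambda>n. C * norm (x n)) \<longlonglongrightarrow> C * norm u" by (intro tendsto_intros u)
    ultimately have "cmod (cinner u u) \<le> C * norm u" using LIMSEQ_le by blast
    then show ?thesis unfolding cmod_cinner_self using C by (rule le_of_square_le)
  qed
  ultimately show ?thesis using rep by blast
qed

lemma orth_proj_exists1:
  fixes N :: "'h::chilbert_space set"
  assumes "complex_subspace N" "closed N"
  shows "\<exists>!y. y \<in> N \<and> (\<forall>z\<in>N. cinner (x - y) z = 0)"
proof -
  define S where "S = (\<lambda>z. (z, cinner z x)) ` N"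
  have "\<exists>u \<in> closure (fst ` S). norm u \<le> norm x \<and> (\<forall>(z, l)\<in>S. cinner z u = l)"
  proof (rule riesz_on_graph)
    show "(0, 0) \<in> S" using assms by (force simp: S_def complex_subspace_def)
    show "(z + y, l + m) \<in> S" if "(z, l) \<in> S" "(y, m) \<in> S" for z l y m
      using that assms by (auto simp: S_def complex_subspace_def image_iff cinner_add_left)
    show "(c *\<^sub>C z, c * l) \<in> S" if "(z, l) \<in> S" for c z l
      using that assms by (auto simp: S_def complex_subspace_def image_iff cinner_scaleC_left)
    show "cmod l \<le> norm x * norm z" if "(z, l) \<in> S" for z l
      using that cmod_cinner_le[of z x] by (auto simp: S_def mult.commute)
  qed auto
  moreover have "fst ` S = N" by (force simp: S_def)
  ultimately obtain u where u: "u \<in> N" and uz: "\<forall>z\<in>N. cinner z u = cinner z x"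
    using assms(2) by (auto simp: S_def)
  have "\<forall>z\<in>N. cinner (x - u) z = 0"
    using uz by (metis cinner_commute cinner_diff_left diff_self)
  moreover have "y = u" if "y \<in> N" "\<forall>z\<in>N. cinner (x - y) z = 0" for y
  proof -
    have "y - u \<in> N" using complex_subspace_diff assms(1) that(1) u by blast
    then have "cinner (x - u) (y - u) = 0" "cinner (x - y) (y - u) = 0"
      using that calculation by blast+
    then have "cinner (y - u) (y - u) = 0" by (simp add: cinner_diff_left)
    then show ?thesis by (simp add: cinner_self)
  qed
  ultimately show ?thesis using u by blast
qed

lemma
  fixes N :: "'h::chilbert_space set"
  assumes "complex_subspace N" "closed N"
  shows orth_proj_in: "orth_proj N x \<in> N"
    and orth_proj_orth: "z \<in> N \<Longrightarrow> cinner (x - orth_proj N x) z = 0"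
  using theI'[OF orth_proj_exists1[OF assms, of x]] by (auto simp: orth_proj_def)

lemma orth_proj_unique:
  assumes "complex_subspace N" "closed N" "y \<in> N" "\<And>z. z \<in> N \<Longrightarrow> cinner (x - y) z = 0"
  shows "orth_proj N x = y"
  using orth_proj_exists1[OF assms(1,2), of x] orth_proj_in[OF assms(1,2), of x]
    orth_proj_orth[OF assms(1,2), of _ x] assms(3,4) by blast

lemma cinner_orth_proj:
  assumes "complex_subspace N" "closed N" "z \<in> N"
  shows "cinner (orth_proj N x) z = cinner x z" "cinner z (orth_proj N x) = cinner z x"
proof -
  show *: "cinner (orth_proj N x) z = cinner x z"
    using orth_proj_orth[OF assms(1,2,3), of x] by (simp add: cinner_diff_left)
  show "cinner z (orth_proj N x) = cinner z x"
    using * cinner_commute by metis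
qed

lemma in_closed_subspaceI:
  assumes "complex_subspace N" "closed N" "\<And>y. (\<forall>z\<in>N. cinner z y = 0) \<Longrightarrow> cinner x y = 0"
  shows "x \<in> N"
proof -
  have "\<forall>z\<in>N. cinner z (x - orth_proj N x) = 0"
    using orth_proj_orth[OF assms(1,2), of _ x] by (metis cinner_commute complex_cnj_zero)
  then have "cinner x (x - orth_proj N x) = 0" "cinner (orth_proj N x) (x - orth_proj N x) = 0"
    using assms(3) orth_proj_in[OF assms(1,2)] by auto
  then have "cinner (x - orth_proj N x) (x - orth_proj N x) = 0" by (simp add: cinner_diff_left)
  then have "x = orth_proj N x" by (simp add: cinner_self)
  then show ?thesis using orth_proj_in[OF assms(1,2)] by metis
qed

lemma cinner_cadjoint:
  assumes "T \<in> bounded_clinear_ops"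
  shows "cinner (T x) y = cinner x (cadjoint T y)"
proof -
  have T: "bounded_linear T" and Tc: "T (c *\<^sub>C x) = c *\<^sub>C T x" for c x
    using assms by (auto simp: bounded_clinear_ops_def)
  have "\<exists>s. \<forall>x. cinner (T x) y = cinner x s" for y
  proof -
    define S where "S = range (\<lambda>x. (x, cinner (T x) y))"
    have "\<exists>u \<in> closure (fst ` S). norm u \<le> onorm T * norm y \<and> (\<forall>(x, l)\<in>S. cinner x u = l)"
    proof (rule riesz_on_graph)
      show "(0, 0) \<in> S" using linear_0[OF bounded_linear.linear[OF T]]
        by (auto simp: S_def intro!: image_eqI[of _ _ 0])
      show "(z + y, l + m) \<in> S" if "(z, l) \<in> S" "(y, m) \<in> S" for z l y m
        using that by (auto simp: S_def image_iff cinner_add_left linear_add[OF bounded_linear.linear[OF T]])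
      show "(c *\<^sub>C z, c * l) \<in> S" if "(z, l) \<in> S" for c z l
        using that by (auto simp: S_def image_iff cinner_scaleC_left Tc)
      show "cmod l \<le> onorm T * norm y * norm z" if zl: "(z, l) \<in> S" for z l
      proof -
        have "cmod l \<le> norm (T z) * norm y" using zl cmod_cinner_le by (auto simp: S_def)
        also have "\<dots> \<le> onorm T * norm z * norm y" using onorm[OF T, of z] by (simp add: mult_right_mono)
        finally show ?thesis by (simp add: mult_ac)
      qed
    qed (use onorm_pos_le[OF T] in auto)
    then obtain u where "\<forall>(x, l)\<in>S. cinner x u = l" by blast
    then have "\<forall>x. cinner (T x) y = cinner x u" by (simp add: S_def)
    then show ?thesis by blast
  qed
  then obtain S where S: "\<forall>x y. cinner (T x) y = cinner x (S y)" by metis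
  have "\<exists>!S. \<forall>x y. cinner (T x) y = cinner x (S y)"
  proof (rule ex1I[of _ S])
    fix S' assume "\<forall>x y. cinner (T x) y = cinner x (S' y)"
    then have "cinner (S' y) z = cinner (S y) z" for y z using S by (metis cinner_commute)
    then show "S' = S" using cinner_ext by blast
  qed (use S in blast)
  from theI'[OF this] show ?thesis unfolding cadjoint_def by blast
qed

section \<open>Positive semidefinite matrices\<close>

definition herm_form :: "'i set \<Rightarrow> ('i \<Rightarrow> 'i \<Rightarrow> complex) \<Rightarrow> ('i \<Rightarrow> complex) \<Rightarrow> ('i \<Rightarrow> complex) \<Rightarrow> complex"
  where "herm_form I A c d = (\<Sum>i\<in>I. \<Sum>j\<in>I. cnj (c i) * A i j * d j)"

lemma psd_on_iff: "psd_on I A \<longleftrightarrow> (\<forall>c. herm_form I A c c \<in> \<real>\<^sub>\<ge>\<^sub>0)"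
  by (simp add: psd_on_def herm_form_def)

lemma psd_on_cong:
  assumes "\<And>i j. i \<in> I \<Longrightarrow> j \<in> I \<Longrightarrow> A i j = B i j"
  shows "psd_on I A \<longleftrightarrow> psd_on I B"
  unfolding psd_on_def by (simp add: assms cong: sum.cong)

lemma psd_onI:
  assumes "\<And>c. herm_form I A c c = of_real (r c)" "\<And>c. r c \<ge> 0"
  shows "psd_on I A"
  unfolding psd_on_iff using assms by simp

lemma herm_form_add_matrix:
  "herm_form I (\<lambda>i j. A i j + B i j) c d = herm_form I A c d + herm_form I B c d"
  by (simp add: herm_form_def sum.distrib algebra_simps)

lemma herm_form_diff_matrix:
  "herm_form I (\<lambda>i j. A i j - B i j) c d = herm_form I A c d - herm_form I B c d"
  by (simp add: herm_form_def sum_subtractf algebra_simps)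

lemma psd_on_add: "psd_on I A \<Longrightarrow> psd_on I B \<Longrightarrow> psd_on I (\<lambda>i j. A i j + B i j)"
  unfolding psd_on_iff herm_form_add_matrix by (blast intro: nonneg_Reals_add_I)

lemma herm_form_right_sum: "herm_form I A c d = (\<Sum>i\<in>I. cnj (c i) * (\<Sum>j\<in>I. A i j * d j))"
  by (simp add: herm_form_def sum_distrib_left mult_ac)

lemma herm_form_cong:
  assumes "\<And>i j. i \<in> I \<Longrightarrow> j \<in> I \<Longrightarrow> A i j = B i j"
  shows "herm_form I A c d = herm_form I B c d"
  unfolding herm_form_def using assms by (intro sum.cong refl) simp

lemma herm_form_add_scale_left:
  "herm_form I A (\<lambda>i. c i + t * c' i) d = herm_form I A c d + cnj t * herm_form I A c' d"
  by (simp add: herm_form_def sum.distrib sum_distrib_left algebra_simps)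

lemma herm_form_add_scale_right:
  "herm_form I A c (\<lambda>i. d i + t * d' i) = herm_form I A c d + t * herm_form I A c d'"
  by (simp add: herm_form_def sum.distrib sum_distrib_left algebra_simps)

lemma herm_form_rank_one:
  "herm_form I (\<lambda>i j. p i * cnj (q j)) c d = (\<Sum>i\<in>I. cnj (c i) * p i) * cnj (\<Sum>j\<in>I. cnj (d j) * q j)"
  by (simp add: herm_form_def sum_product mult.assoc mult.left_commute mult.commute[of "d _"])

lemma mult_cnj_self: "z * cnj z = of_real ((cmod z)\<^sup>2)"
  by (rule complex_norm_square[symmetric])

lemma psd_on_rank_one: "psd_on I (\<lambda>i j. p i * cnj (p j))"
  by (rule psd_onI[where r = "\<lambda>c. (cmod (\<Sum>i\<in>I. cnj (c i) * p i))\<^sup>2"])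
     (simp_all only: herm_form_rank_one mult_cnj_self zero_le_power2)

lemma nonneg_Reals_iff: "z \<in> \<real>\<^sub>\<ge>\<^sub>0 \<longleftrightarrow> z = complex_of_real (Re z) \<and> 0 \<le> Re z"
  by (auto simp: complex_nonneg_Reals_iff complex_eq_iff)

text \<open>
  The Cauchy--Schwarz inequality, extracted from positivity of the quadratic polynomial in
  \<open>t\<close> that arises from \<open>c + t d\<close>.
\<close>

lemma quadratic_nonneg_imp:
  fixes a e b b' :: complex
  assumes pos: "\<And>t. a + t * b + cnj t * b' + t * cnj t * e \<in> \<real>\<^sub>\<ge>\<^sub>0" and e: "e \<in> \<real>\<^sub>\<ge>\<^sub>0"
  shows "b' = cnj b" "(cmod b)\<^sup>2 \<le> Re a * Re e"
proof -
  have a: "Im a = 0" "Re a \<ge> 0" using pos[of 0] by (auto simp: complex_nonneg_Reals_iff)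
  have e': "Im e = 0" "Re e \<ge> 0" using e by (auto simp: complex_nonneg_Reals_iff)
  have "Im b + Im b' = 0" using pos[of 1] a e' by (auto simp: complex_nonneg_Reals_iff)
  moreover have "Re b - Re b' = 0" using pos[of \<i>] a e' by (auto simp: complex_nonneg_Reals_iff)
  ultimately show b': "b' = cnj b" by (simp add: complex_eq_iff)
  have q: "Re a - 2 * s * (cmod b)\<^sup>2 + s\<^sup>2 * (cmod b)\<^sup>2 * Re e \<ge> 0" for s :: real
  proof -
    have "b * cnj b = of_real ((cmod b)\<^sup>2)" by (rule mult_cnj_self)
    moreover have "a + (- (of_real s * cnj b)) * b + cnj (- (of_real s * cnj b)) * b'
        + (- (of_real s * cnj b)) * cnj (- (of_real s * cnj b)) * e
        = a - 2 * of_real s * (b * cnj b) + (of_real s)\<^sup>2 * (b * cnj b) * e"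
      by (simp add: b' power2_eq_square algebra_simps)
    ultimately have "a + (- (of_real s * cnj b)) * b + cnj (- (of_real s * cnj b)) * b'
        + (- (of_real s * cnj b)) * cnj (- (of_real s * cnj b)) * e
        = a - of_real (2 * s * (cmod b)\<^sup>2) + of_real (s\<^sup>2 * (cmod b)\<^sup>2) * e"
      by simp
    then have "Re (a - of_real (2 * s * (cmod b)\<^sup>2) + of_real (s\<^sup>2 * (cmod b)\<^sup>2) * e) \<ge> 0"
      using pos[of "- (of_real s * cnj b)"] unfolding complex_nonneg_Reals_iff by metis
    then show ?thesis by simp
  qed
  show "(cmod b)\<^sup>2 \<le> Re a * Re e"
  proof (cases "Re e = 0")
    case True
    have "(cmod b)\<^sup>2 = 0"
    proof (rule ccontr)
      assume "(cmod b)\<^sup>2 \<noteq> 0"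
      then have "(cmod b)\<^sup>2 > 0" by simp
      then show False using q[of "(Re a + 1) / (cmod b)\<^sup>2"] a True by simp
    qed
    then show ?thesis using a True by simp
  next
    case False
    then have "Re e > 0" using e' by simp
    have "Re a - 2 * (1 / Re e) * (cmod b)\<^sup>2 + (1 / Re e)\<^sup>2 * (cmod b)\<^sup>2 * Re e
        = Re a - (cmod b)\<^sup>2 / Re e"
      using False by (simp add: field_simps power2_eq_square)
    then have "(cmod b)\<^sup>2 / Re e \<le> Re a" using q[of "1 / Re e"] by linarith
    then show ?thesis using \<open>Re e > 0\<close> by (simp add: field_simps)
  qed
qed

context
  fixes I :: "'i set" and A
  assumes psd: "psd_on I A"
begin

lemma psd_form_real: "herm_form I A c c = of_real (Re (herm_form I A c c))" "Re (herm_form I A c c) \<ge> 0"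
  using psd unfolding psd_on_iff nonneg_Reals_iff by blast+

lemma psd_form_hermitian: "herm_form I A d c = cnj (herm_form I A c d)"
  and psd_form_cauchy_schwarz:
    "(cmod (herm_form I A c d))\<^sup>2 \<le> Re (herm_form I A c c) * Re (herm_form I A d d)"
proof -
  have "herm_form I A c c + t * herm_form I A c d + cnj t * herm_form I A d c
      + t * cnj t * herm_form I A d d \<in> \<real>\<^sub>\<ge>\<^sub>0" for t
  proof -
    have "herm_form I A (\<lambda>i. c i + t * d i) (\<lambda>i. c i + t * d i) \<in> \<real>\<^sub>\<ge>\<^sub>0"
      using psd psd_on_iff by blast
    then show ?thesis
      unfolding herm_form_add_scale_left herm_form_add_scale_right by (simp add: algebra_simps)
  qed
  moreover have "herm_form I A d d \<in> \<real>\<^sub>\<ge>\<^sub>0" using psd psd_on_iff by blast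
  ultimately show "herm_form I A d c = cnj (herm_form I A c d)"
    "(cmod (herm_form I A c d))\<^sup>2 \<le> Re (herm_form I A c c) * Re (herm_form I A d d)"
    using quadratic_nonneg_imp by blast+
qed

end

lemma herm_form_unit_left:
  assumes "finite I" "i \<in> I"
  shows "herm_form I A (\<lambda>l. if l = i then 1 else 0) d = (\<Sum>j\<in>I. A i j * d j)"
proof -
  have "herm_form I A (\<lambda>l. if l = i then 1 else 0) d
      = (\<Sum>l\<in>I. if l = i then (\<Sum>j\<in>I. A i j * d j) else 0)"
    unfolding herm_form_def by (rule sum.cong) auto
  then show ?thesis using assms by (simp add: sum.delta)
qed

lemma herm_form_unit:
  assumes "finite I" "i \<in> I" "j \<in> I"
  shows "herm_form I A (\<lambda>l. if l = i then 1 else 0) (\<lambda>l. if l = j then 1 else 0) = A i j"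
proof -
  have "(\<Sum>l\<in>I. A i l * (if l = j then 1 else 0)) = (\<Sum>l\<in>I. if l = j then A i j else 0)"
    by (rule sum.cong) auto
  then show ?thesis using assms by (simp add: herm_form_unit_left sum.delta)
qed

lemma psd_on_hermitian:
  assumes "psd_on I A" "finite I" "i \<in> I" "j \<in> I"
  shows "A j i = cnj (A i j)"
  using psd_form_hermitian[OF assms(1)] herm_form_unit assms by metis

lemma psd_on_diag:
  assumes "psd_on I A" "finite I" "i \<in> I"
  shows "A i i = of_real (Re (A i i))" "Re (A i i) \<ge> 0"
  using psd_form_real[OF assms(1)] herm_form_unit[OF assms(2,3,3)] by metis+

lemma psd_on_entry_le:
  assumes "psd_on I A" "finite I" "i \<in> I" "j \<in> I"
  shows "(cmod (A i j))\<^sup>2 \<le> Re (A i i) * Re (A j j)"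
  using psd_form_cauchy_schwarz[OF assms(1)] herm_form_unit assms by metis

lemma psd_on_null:
  assumes "psd_on I A" "finite I" "i \<in> I" "Re (herm_form I A v v) = 0"
  shows "(\<Sum>j\<in>I. A i j * v j) = 0"
proof -
  have "(cmod (herm_form I A (\<lambda>l. if l = i then 1 else 0) v))\<^sup>2 \<le> 0"
    using psd_form_cauchy_schwarz[OF assms(1), of "\<lambda>l. if l = i then 1 else 0" v] assms(4) by simp
  then show ?thesis using herm_form_unit_left[OF assms(2,3)] by simp
qed

lemma herm_form_schur:
  "herm_form I (\<lambda>i j. A i j * (\<Sum>l<d. p l i * cnj (p l j))) c c'
    = (\<Sum>l<d. herm_form I A (\<lambda>i. cnj (p l i) * c i) (\<lambda>j. cnj (p l j) * c' j))"
proof -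
  have "herm_form I (\<lambda>i j. A i j * (\<Sum>l<d. p l i * cnj (p l j))) c c'
      = (\<Sum>i\<in>I. \<Sum>j\<in>I. \<Sum>l<d. cnj (c i) * (A i j * (p l i * cnj (p l j))) * c' j)"
    by (simp add: herm_form_def sum_distrib_left sum_distrib_right mult_ac)
  also have "\<dots> = (\<Sum>l<d. \<Sum>i\<in>I. \<Sum>j\<in>I. cnj (c i) * (A i j * (p l i * cnj (p l j))) * c' j)"
    by (subst sum.swap[of _ I "{..<d}"], rule sum.cong[OF refl], rule sum.swap)
  finally show ?thesis by (simp add: herm_form_def mult_ac)
qed

lemma nonneg_Reals_sum:
  "(\<And>i. i \<in> I \<Longrightarrow> f i \<in> \<real>\<^sub>\<ge>\<^sub>0) \<Longrightarrow> (\<Sum>i\<in>I. f i) \<in> (\<real>\<^sub>\<ge>\<^sub>0 :: complex set)"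
  by (induction I rule: infinite_finite_induct) auto

text \<open>The Schur product theorem, for a factor that is given as a Gram matrix.\<close>

lemma psd_on_schur:
  assumes "psd_on I A"
  shows "psd_on I (\<lambda>i j. A i j * (\<Sum>l<d. p l i * cnj (p l j)))"
  unfolding psd_on_iff herm_form_schur
  using assms unfolding psd_on_iff by (auto intro!: nonneg_Reals_sum)

lemma herm_form_block_diagonal:
  assumes "finite R"
  shows "herm_form (Z \<times> R) (\<lambda>(z, p) (w, q). if p = q then A p z w else 0) c c'
    = (\<Sum>p\<in>R. herm_form Z (A p) (\<lambda>z. c (z, p)) (\<lambda>z. c' (z, p)))"
proof -
  have "herm_form (Z \<times> R) (\<lambda>(z, p) (w, q). if p = q then A p z w else 0) c c'
      = (\<Sum>z\<in>Z. \<Sum>p\<in>R. \<Sum>w\<in>Z. \<Sum>q\<in>R. if p = q then cnj (c (z, p)) * A p z w * c' (w, p) else 0)"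
    unfolding herm_form_def sum.cartesian_product' by (intro sum.cong) auto
  also have "\<dots> = (\<Sum>z\<in>Z. \<Sum>p\<in>R. \<Sum>w\<in>Z. cnj (c (z, p)) * A p z w * c' (w, p))"
    using assms by (simp add: sum.delta)
  also have "\<dots> = (\<Sum>p\<in>R. \<Sum>z\<in>Z. \<Sum>w\<in>Z. cnj (c (z, p)) * A p z w * c' (w, p))"
    by (rule sum.swap)
  finally show ?thesis by (simp add: herm_form_def)
qed

lemma psd_on_block_diagonal:
  assumes "finite R" "\<And>p. p \<in> R \<Longrightarrow> psd_on Z (A p)"
  shows "psd_on (Z \<times> R) (\<lambda>(z, p) (w, q). if p = q then A p z w else 0)"
  unfolding psd_on_iff herm_form_block_diagonal[OF assms(1)]
  using assms(2) unfolding psd_on_iff by (auto intro!: nonneg_Reals_sum)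

lemma herm_form_gram:
  "herm_form I (\<lambda>i j. cinner (u j) (v i)) c d = cinner (\<Sum>j\<in>I. d j *\<^sub>C u j) (\<Sum>i\<in>I. c i *\<^sub>C v i)"
  by (simp add: herm_form_def cinner_sum_left cinner_sum_right cinner_scaleC_left
      cinner_scaleC_right sum_distrib_left mult_ac)

lemma psd_on_gram: "psd_on I (\<lambda>i j. cinner (v j) (v i))"
  by (rule psd_onI[where r = "\<lambda>c. (norm (\<Sum>i\<in>I. c i *\<^sub>C v i))\<^sup>2"]) (simp_all add: herm_form_gram cinner_self)

lemma psd_on_reindex:
  assumes "psd_on I A" "finite I" "inj_on f J" "f ` J \<subseteq> I"
  shows "psd_on J (\<lambda>i j. A (f i) (f j))"
  unfolding psd_on_iff
proof
  fix c :: "_ \<Rightarrow> complex"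
  define c' where "c' i = (if i \<in> f ` J then c (the_inv_into J f i) else 0)" for i
  have c': "c' (f i) = c i" if "i \<in> J" for i
    using the_inv_into_f_f[OF assms(3) that] that by (simp add: c'_def)
  have "herm_form I A c' c' = (\<Sum>i\<in>f ` J. \<Sum>j\<in>f ` J. cnj (c' i) * A i j * c' j)"
  proof -
    have "herm_form I A c' c' = (\<Sum>i\<in>I. \<Sum>j\<in>f ` J. cnj (c' i) * A i j * c' j)"
      unfolding herm_form_def using assms(2,4)
      by (intro sum.cong refl sum.mono_neutral_right) (auto simp: c'_def)
    also have "\<dots> = (\<Sum>i\<in>f ` J. \<Sum>j\<in>f ` J. cnj (c' i) * A i j * c' j)"
      using assms(2,4) by (intro sum.mono_neutral_right) (auto simp: c'_def)
    finally show ?thesis .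
  qed
  also have "\<dots> = herm_form J (\<lambda>i j. A (f i) (f j)) c c"
    unfolding herm_form_def sum.reindex[OF assms(3)] by (intro sum.cong refl) (simp add: c')
  finally show "herm_form J (\<lambda>i j. A (f i) (f j)) c c \<in> \<real>\<^sub>\<ge>\<^sub>0"
    using assms(1) unfolding psd_on_iff by (metis (no_types))
qed

lemma psd_on_subset: "psd_on I A \<Longrightarrow> finite I \<Longrightarrow> J \<subseteq> I \<Longrightarrow> psd_on J A"
  using psd_on_reindex[of I A "\<lambda>i. i" J] by simp

lemma psd_on_transpose:
  assumes "psd_on I A"
  shows "psd_on I (\<lambda>i j. A j i)"
  unfolding psd_on_iff
proof
  fix c
  have "herm_form I (\<lambda>i j. A j i) c c = herm_form I A (\<lambda>i. cnj (c i)) (\<lambda>i. cnj (c i))"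
    unfolding herm_form_def by (subst sum.swap) (simp add: mult_ac)
  then show "herm_form I (\<lambda>i j. A j i) c c \<in> \<real>\<^sub>\<ge>\<^sub>0" using assms unfolding psd_on_iff by simp
qed

lemma psd_on_scale:
  assumes "psd_on I A"
  shows "psd_on I (\<lambda>i j. s i * A i j * cnj (s j))"
  unfolding psd_on_iff
proof
  fix c
  have "herm_form I (\<lambda>i j. s i * A i j * cnj (s j)) c c
      = herm_form I A (\<lambda>i. cnj (s i) * c i) (\<lambda>i. cnj (s i) * c i)"
    unfolding herm_form_def by (simp add: mult_ac)
  then show "herm_form I (\<lambda>i j. s i * A i j * cnj (s j)) c c \<in> \<real>\<^sub>\<ge>\<^sub>0"
    using assms unfolding psd_on_iff by simp
qed

lemma psd_on_gram_sum: "psd_on I (\<lambda>i j. \<Sum>l<(d::nat). p l i * cnj (p l j))"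
  using psd_on_schur[OF psd_on_rank_one[of I "\<lambda>_. 1"], where d = d and p = p] by simp

section \<open>Compactness in spaces of functions\<close>

lemma compact_box: "compact {f :: 'i \<Rightarrow> complex. \<forall>i. cmod (f i) \<le> b i}"
proof -
  have "compactin (product_topology (\<lambda>i. euclidean) UNIV) (PiE UNIV (\<lambda>i. cball (0 :: complex) (b i)))"
    unfolding compactin_PiE by simp
  moreover have "PiE UNIV (\<lambda>i. cball (0 :: complex) (b i)) = {f. \<forall>i. cmod (f i) \<le> b i}"
    by (auto simp: PiE_def Pi_def)
  ultimately show ?thesis by (simp add: euclidean_product_topology)
qed

lemma tendsto_pointwise:
  fixes f :: "'a \<Rightarrow> 'i \<Rightarrow> 'b::topological_space"
  assumes "\<And>i. ((\<lambda>n. f n i) \<longlongrightarrow> g i) F"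
  shows "(f \<longlongrightarrow> g) F"
proof -
  have "limitin (product_topology (\<lambda>i. euclidean) UNIV) f g F"
    unfolding limitin_componentwise using assms by simp
  then show ?thesis by (simp add: euclidean_product_topology)
qed

text \<open>
  Tychonoff's theorem, for closed conditions on bounded functions that are finitely satisfiable.
\<close>

lemma box_fip:
  fixes \<F> :: "('i \<Rightarrow> complex) set set"
  assumes "\<And>T. T \<in> \<F> \<Longrightarrow> closed T"
    and "\<And>\<G>. finite \<G> \<Longrightarrow> \<G> \<subseteq> \<F> \<Longrightarrow> \<exists>f. (\<forall>i. cmod (f i) \<le> b i) \<and> (\<forall>T\<in>\<G>. f \<in> T)"
  shows "\<exists>f. (\<forall>i. cmod (f i) \<le> b i) \<and> (\<forall>T\<in>\<F>. f \<in> T)"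
proof -
  have "{f. \<forall>i. cmod (f i) \<le> b i} \<inter> \<Inter>\<F> \<noteq> {}"
  proof (rule compact_imp_fip[OF compact_box])
    fix \<G> assume "finite \<G>" "\<G> \<subseteq> \<F>"
    then show "{f. \<forall>i. cmod (f i) \<le> b i} \<inter> \<Inter>\<G> \<noteq> {}"
      using assms(2)[of \<G>] by blast
  qed (use assms(1) in auto)
  then show ?thesis by blast
qed

lemma closed_Collect_Ball:
  assumes "\<And>i. i \<in> I \<Longrightarrow> closed {x. P i x}"
  shows "closed {x. \<forall>i\<in>I. P i x}"
proof -
  have "{x. \<forall>i\<in>I. P i x} = (\<Inter>i\<in>I. {x. P i x})" by auto
  then show ?thesis using assms by (simp add: closed_INT)
qed

lemma closed_psd:
  assumes "\<And>i j. i \<in> I \<Longrightarrow> j \<in> I \<Longrightarrow> continuous_on UNIV (\<lambda>x. A x i j)"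
  shows "closed {x. psd_on I (A x)}"
proof -
  have "{x. psd_on I (A x)} = (\<Inter>c. {x. herm_form I (A x) c c \<in> \<real>\<^sub>\<ge>\<^sub>0})"
    by (auto simp: psd_on_iff)
  moreover have "closed {x. herm_form I (A x) c c \<in> \<real>\<^sub>\<ge>\<^sub>0}" for c
  proof -
    have "continuous_on UNIV (\<lambda>x. herm_form I (A x) c c)"
      unfolding herm_form_def by (intro continuous_intros assms)
    from closed_vimage[OF closed_nonneg_Reals_complex this] show ?thesis by (simp add: vimage_def)
  qed
  ultimately show ?thesis by (simp add: closed_INT)
qed

section \<open>An extremal problem for positive semidefinite matrices\<close>

text \<open>
  If \<open>\<Gamma>\<close> is the Gram matrix of vectors \<open>g i\<close>, this is the Gram matrix of their projections to the
  line spanned by \<open>u = \<Sum> cnj (v m) g m\<close>.  For \<open>u = 0\<close> the division by zero gives \<open>0\<close>, as it should.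
\<close>

definition compress_at :: "'i set \<Rightarrow> ('i \<Rightarrow> complex) \<Rightarrow> ('i \<times> 'i \<Rightarrow> complex) \<Rightarrow> 'i \<Rightarrow> 'i \<Rightarrow> complex" where
  "compress_at I v \<Gamma> i j = (\<Sum>m\<in>I. \<Gamma> (i, m) * v m) * cnj (\<Sum>m\<in>I. \<Gamma> (j, m) * v m)
     / herm_form I (curry \<Gamma>) v v"

context
  fixes I :: "'i set" and v :: "'i \<Rightarrow> complex" and \<Gamma> :: "'i \<times> 'i \<Rightarrow> complex"
  assumes fin: "finite I" and psd: "psd_on I (curry \<Gamma>)"
begin

lemma compress_at_apply: "i \<in> I \<Longrightarrow> (\<Sum>j\<in>I. compress_at I v \<Gamma> i j * v j) = (\<Sum>m\<in>I. \<Gamma> (i, m) * v m)"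
proof (cases "herm_form I (curry \<Gamma>) v v = 0")
  case True
  assume "i \<in> I"
  then show ?thesis using psd_on_null[OF psd fin, of i v] True by (simp add: compress_at_def)
next
  case False
  define w where "w i = (\<Sum>m\<in>I. \<Gamma> (i, m) * v m)" for i
  have "(\<Sum>j\<in>I. cnj (w j) * v j) = cnj (herm_form I (curry \<Gamma>) v v)"
    by (simp add: herm_form_right_sum w_def mult.commute)
  also have "\<dots> = herm_form I (curry \<Gamma>) v v"
    using psd_form_hermitian[OF psd, of v v] by simp
  finally have "(\<Sum>j\<in>I. cnj (w j) * v j) = herm_form I (curry \<Gamma>) v v" .
  moreover have "(\<Sum>j\<in>I. compress_at I v \<Gamma> i j * v j)
      = w i * (\<Sum>j\<in>I. cnj (w j) * v j) / herm_form I (curry \<Gamma>) v v"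
    by (simp add: compress_at_def w_def sum_distrib_left sum_divide_distrib mult_ac)
  ultimately show ?thesis using False by (simp add: w_def)
qed

lemma psd_on_compress_at: "psd_on I (compress_at I v \<Gamma>)"
proof -
  define a where "a = Re (herm_form I (curry \<Gamma>) v v)"
  have a: "herm_form I (curry \<Gamma>) v v = of_real a" "a \<ge> 0"
    unfolding a_def using psd_form_real[OF psd] by auto
  define g where "g i = (\<Sum>m\<in>I. \<Gamma> (i, m) * v m) / of_real (sqrt a)" for i
  have "compress_at I v \<Gamma> = (\<lambda>i j. g i * cnj (g j))"
    using a(2) by (simp add: compress_at_def a g_def fun_eq_iff flip: of_real_mult)
  then show ?thesis by (simp add: psd_on_rank_one)
qed

lemma psd_on_diff_compress_at: "psd_on I (\<lambda>i j. \<Gamma> (i, j) - compress_at I v \<Gamma> i j)"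
proof (rule psd_onI)
  fix c
  define a where "a = Re (herm_form I (curry \<Gamma>) v v)"
  have a: "herm_form I (curry \<Gamma>) v v = of_real a" "a \<ge> 0"
    unfolding a_def using psd_form_real[OF psd] by auto
  have "herm_form I (compress_at I v \<Gamma>) c c
      = herm_form I (\<lambda>i j. (\<Sum>m\<in>I. \<Gamma> (i, m) * v m) * cnj (\<Sum>m\<in>I. \<Gamma> (j, m) * v m)) c c / of_real a"
    by (simp only: herm_form_def[of I _ c c] compress_at_def a) (simp add: sum_divide_distrib)
  also have "\<dots> = of_real ((cmod (herm_form I (curry \<Gamma>) c v))\<^sup>2 / a)"
    unfolding herm_form_rank_one mult_cnj_self by (simp add: herm_form_right_sum)
  finally have U: "herm_form I (compress_at I v \<Gamma>) c c
      = of_real ((cmod (herm_form I (curry \<Gamma>) c v))\<^sup>2 / a)" .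
  have "herm_form I (\<lambda>i j. \<Gamma> (i, j) - compress_at I v \<Gamma> i j) c c
      = herm_form I (curry \<Gamma>) c c - herm_form I (compress_at I v \<Gamma>) c c"
    by (simp add: herm_form_diff_matrix[symmetric] curry_def)
  also have "\<dots> = of_real (Re (herm_form I (curry \<Gamma>) c c) - (cmod (herm_form I (curry \<Gamma>) c v))\<^sup>2 / a)"
    using psd_form_real(1)[OF psd, of c] U by (metis of_real_diff)
  finally show "herm_form I (\<lambda>i j. \<Gamma> (i, j) - compress_at I v \<Gamma> i j) c c
      = of_real (Re (herm_form I (curry \<Gamma>) c c) - (cmod (herm_form I (curry \<Gamma>) c v))\<^sup>2 / a)" .
  have "(cmod (herm_form I (curry \<Gamma>) c v))\<^sup>2 \<le> Re (herm_form I (curry \<Gamma>) c c) * a"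
    using psd_form_cauchy_schwarz[OF psd, of c v] by (simp add: a_def)
  then show "0 \<le> Re (herm_form I (curry \<Gamma>) c c) - (cmod (herm_form I (curry \<Gamma>) c v))\<^sup>2 / a"
    using a(2) psd_form_real(2)[OF psd, of c] by (cases "a = 0") (simp_all add: field_simps)
qed

end

text \<open>
  A maximiser \<open>\<Gamma>\<close> of \<open>v\<^sup>* \<Gamma> v\<close> leads to a matrix of rank one.  Let \<open>U\<close> be its part along \<open>u\<close> and
  \<open>\<Delta> = \<Gamma> - U\<close> the remaining part, which annihilates \<open>v\<close>.  A step replaces \<open>\<Delta>\<close> by its Schur
  product with \<open>B\<close>, and cannot decrease \<open>v\<^sup>* \<Gamma> v\<close>.  By maximality the new remainder annihilates \<open>v\<close> as
  well, so \<open>U\<close> stays the same and the step can be repeated.  As the entries of \<open>B\<close> are less than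
  \<open>1\<close> in modulus, the iterates converge to \<open>U\<close>.
\<close>

lemma rank_one_member:
  fixes \<C> :: "('i \<times> 'i \<Rightarrow> complex) set" and v :: "'i \<Rightarrow> complex" and p :: "nat \<Rightarrow> 'i \<Rightarrow> complex"
    and d :: nat
  defines "B \<equiv> \<lambda>i j. \<Sum>l<d. p l i * cnj (p l j)"
  assumes fin: "finite I" and closed: "closed \<C>" and ne: "\<C> \<noteq> {}"
    and bounded: "\<And>\<Gamma> q. \<Gamma> \<in> \<C> \<Longrightarrow> cmod (\<Gamma> q) \<le> b q"
    and supp: "\<And>\<Gamma> i j. \<Gamma> \<in> \<C> \<Longrightarrow> \<not> (i \<in> I \<and> j \<in> I) \<Longrightarrow> \<Gamma> (i, j) = 0"
    and psd: "\<And>\<Gamma>. \<Gamma> \<in> \<C> \<Longrightarrow> psd_on I (curry \<Gamma>)"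
    and step: "\<And>\<Gamma>. \<Gamma> \<in> \<C> \<Longrightarrow> (\<lambda>(i, j). if i \<in> I \<and> j \<in> I
        then compress_at I v \<Gamma> i j + (\<Gamma> (i, j) - compress_at I v \<Gamma> i j) * B i j else 0) \<in> \<C>"
    and B_less: "\<And>i j. i \<in> I \<Longrightarrow> j \<in> I \<Longrightarrow> cmod (B i j) < 1"
  shows "\<exists>\<Gamma>\<in>\<C>. \<exists>g. \<forall>i\<in>I. \<forall>j\<in>I. \<Gamma> (i, j) = g i * cnj (g j)"
proof -
  define \<alpha> where "\<alpha> \<Gamma> = Re (herm_form I (curry \<Gamma>) v v)" for \<Gamma>
  have "{f. \<forall>q. cmod (f q) \<le> b q} \<inter> \<C> = \<C>" using bounded by blast
  moreover have "compact ({f. \<forall>q. cmod (f q) \<le> b q} \<inter> \<C>)"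
    by (rule compact_Int_closed[OF compact_box closed])
  ultimately have comp: "compact \<C>" by simp
  have "continuous_on \<C> \<alpha>"
    unfolding \<alpha>_def herm_form_def curry_def
    by (intro continuous_intros continuous_on_subset[OF continuous_on_product_coordinates]) auto
  from continuous_attains_sup[OF comp ne this] obtain \<Gamma>
    where \<Gamma>: "\<Gamma> \<in> \<C>" and max: "\<And>\<Gamma>'. \<Gamma>' \<in> \<C> \<Longrightarrow> \<alpha> \<Gamma>' \<le> \<alpha> \<Gamma>" by blast
  define w where "w i = (\<Sum>m\<in>I. \<Gamma> (i, m) * v m)" for i
  define U where "U = compress_at I v \<Gamma>"
  define \<Delta> where "\<Delta> i j = \<Gamma> (i, j) - U i j" for i j
  define \<Gamma>' where "\<Gamma>' m = (\<lambda>(i, j). if i \<in> I \<and> j \<in> I then U i j + \<Delta> i j * B i j ^ m else 0)" for m :: nat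
  have Uv: "(\<Sum>j\<in>I. U i j * v j) = w i" if "i \<in> I" for i
    unfolding U_def w_def by (rule compress_at_apply[OF fin psd[OF \<Gamma>] that])
  have psd\<Delta>: "psd_on I (\<lambda>i j. \<Delta> i j * B i j ^ m)" for m
  proof (induction m)
    case 0
    show ?case using psd_on_diff_compress_at[OF fin psd[OF \<Gamma>], of v] by (simp add: \<Delta>_def U_def)
  next
    case (Suc m)
    from psd_on_schur[OF this, where d = d and p = p] show ?case by (simp add: B_def mult_ac)
  qed
  have key: "\<Gamma>' m \<in> \<C> \<and> (\<forall>i\<in>I. (\<Sum>j\<in>I. \<Delta> i j * B i j ^ m * v j) = 0)" for m
  proof (induction m)
    case 0
    have "\<Gamma>' 0 = \<Gamma>" using supp[OF \<Gamma>] by (auto simp: \<Gamma>'_def \<Delta>_def fun_eq_iff)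
    then show ?case using \<Gamma> Uv by (simp add: \<Delta>_def left_diff_distrib sum_subtractf w_def)
  next
    case (Suc m)
    have \<Gamma>'v: "(\<Sum>j\<in>I. \<Gamma>' m (i, j) * v j) = w i" if "i \<in> I" for i
    proof -
      have "(\<Sum>j\<in>I. \<Gamma>' m (i, j) * v j) = (\<Sum>j\<in>I. U i j * v j) + (\<Sum>j\<in>I. \<Delta> i j * B i j ^ m * v j)"
        using that by (simp add: \<Gamma>'_def distrib_right sum.distrib)
      then show ?thesis using Suc Uv that by simp
    qed
    have "herm_form I (curry (\<Gamma>' m)) v v = herm_form I (curry \<Gamma>) v v"
      unfolding herm_form_right_sum curry_conv
      by (rule sum.cong) (auto simp: \<Gamma>'v w_def)
    then have U': "compress_at I v (\<Gamma>' m) i j = U i j" if "i \<in> I" "j \<in> I" for i j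
      using that \<Gamma>'v by (simp add: compress_at_def U_def w_def)
    have e: "compress_at I v (\<Gamma>' m) i j + (\<Gamma>' m (i, j) - compress_at I v (\<Gamma>' m) i j) * B i j
        = U i j + \<Delta> i j * B i j ^ Suc m" if "i \<in> I" "j \<in> I" for i j
      using that unfolding U'[OF that] by (simp add: \<Gamma>'_def mult_ac)
    have "\<Gamma>' (Suc m) = (\<lambda>(i, j). if i \<in> I \<and> j \<in> I then compress_at I v (\<Gamma>' m) i j
        + (\<Gamma>' m (i, j) - compress_at I v (\<Gamma>' m) i j) * B i j else 0)"
      unfolding \<Gamma>'_def[of "Suc m"] by (intro ext) (simp add: e split: prod.split)
    moreover have "\<Gamma>' m \<in> \<C>" using Suc by blast
    ultimately have mem: "\<Gamma>' (Suc m) \<in> \<C>" by (simp only: step)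
    have "herm_form I (curry (\<Gamma>' (Suc m))) v v
        = herm_form I U v v + herm_form I (\<lambda>i j. \<Delta> i j * B i j ^ Suc m) v v"
      unfolding herm_form_add_matrix[symmetric]
      by (simp add: herm_form_def \<Gamma>'_def cong: sum.cong)
    moreover have "herm_form I U v v = herm_form I (curry \<Gamma>) v v"
      unfolding herm_form_right_sum curry_conv
      by (rule sum.cong) (auto simp: Uv w_def)
    ultimately have "Re (herm_form I (\<lambda>i j. \<Delta> i j * B i j ^ Suc m) v v) \<le> 0"
      using max[OF mem] by (simp add: \<alpha>_def)
    then have "Re (herm_form I (\<lambda>i j. \<Delta> i j * B i j ^ Suc m) v v) = 0"
      using psd_form_real(2)[OF psd\<Delta>[of "Suc m"], of v] by linarith
    from psd_on_null[OF psd\<Delta> fin _ this] mem show ?case by blast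
  qed
  define \<Gamma>0 where "\<Gamma>0 = (\<lambda>(i, j). if i \<in> I \<and> j \<in> I then U i j else 0)"
  have "\<Gamma>' \<longlonglongrightarrow> \<Gamma>0"
  proof (rule tendsto_pointwise)
    fix q :: "'i \<times> 'i"
    obtain i j where q: "q = (i, j)" by fastforce
    show "(\<lambda>m. \<Gamma>' m q) \<longlonglongrightarrow> \<Gamma>0 q"
    proof (cases "i \<in> I \<and> j \<in> I")
      case True
      then have "(\<lambda>m. U i j + \<Delta> i j * B i j ^ m) \<longlonglongrightarrow> U i j + \<Delta> i j * 0"
        by (intro tendsto_intros LIMSEQ_power_zero B_less) auto
      then show ?thesis using True by (simp add: \<Gamma>'_def \<Gamma>0_def q)
    next
      case False
      then show ?thesis by (auto simp: \<Gamma>'_def \<Gamma>0_def q)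
    qed
  qed
  moreover have "\<forall>\<^sub>F m in sequentially. \<Gamma>' m \<in> \<C>" using key by simp
  ultimately have mem: "\<Gamma>0 \<in> \<C>"
    by (intro Lim_in_closed_set[OF closed _ sequentially_bot])
  define a where "a = Re (herm_form I (curry \<Gamma>) v v)"
  have a: "herm_form I (curry \<Gamma>) v v = of_real a" "a \<ge> 0"
    unfolding a_def using psd_form_real[OF psd[OF \<Gamma>]] by auto
  have "\<forall>i\<in>I. \<forall>j\<in>I. \<Gamma>0 (i, j) = (w i / of_real (sqrt a)) * cnj (w j / of_real (sqrt a))"
    using a(2) by (simp add: \<Gamma>0_def U_def compress_at_def w_def a flip: of_real_mult)
  then show ?thesis
    by (intro bexI[OF _ mem] exI[of _ "\<lambda>i. w i / of_real (sqrt a)"])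
qed

section \<open>Reproducing kernel Hilbert spaces and multiplication operators\<close>

definition multiplies :: "('x \<Rightarrow> 'h::chilbert_space) \<Rightarrow> ('x \<Rightarrow> complex) \<Rightarrow> ('h \<Rightarrow> 'h) \<Rightarrow> bool" where
  "multiplies k t T \<longleftrightarrow> (\<forall>u z. cinner (T u) (k z) = t z * cinner u (k z))"

definition kernel_sum :: "('x \<Rightarrow> 'h::chilbert_space) \<Rightarrow> 'x set \<Rightarrow> ('x \<Rightarrow> complex) \<Rightarrow> 'h" where
  "kernel_sum k Z c = (\<Sum>z\<in>Z. c z *\<^sub>C k z)"

lemma cinner_kernel_sum: "cinner u (kernel_sum k Z c) = (\<Sum>z\<in>Z. cnj (c z) * cinner u (k z))"
  by (simp add: kernel_sum_def cinner_sum_right cinner_scaleC_right)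

lemma cinner_kernel_sums:
  "cinner (kernel_sum k Z a) (kernel_sum k Z a')
    = (\<Sum>w\<in>Z. \<Sum>w'\<in>Z. a w * cnj (a' w') * cinner (k w) (k w'))"
  unfolding kernel_sum_def herm_form_gram[symmetric] herm_form_def
  by (subst sum.swap) (simp add: mult_ac)

lemma kernel_sum_extend:
  assumes "finite Y" "Z \<subseteq> Y"
  shows "kernel_sum k Y (\<lambda>z. if z \<in> Z then c z else 0) = kernel_sum k Z c"
proof -
  have "kernel_sum k Y (\<lambda>z. if z \<in> Z then c z else 0) = (\<Sum>z\<in>Y. if z \<in> Z then c z *\<^sub>C k z else 0)"
    unfolding kernel_sum_def by (rule sum.cong) auto
  also have "\<dots> = (\<Sum>z\<in>Y \<inter> Z. c z *\<^sub>C k z)" using assms by (simp add: sum.inter_restrict)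
  also have "Y \<inter> Z = Z" using assms by blast
  finally show ?thesis by (simp add: kernel_sum_def)
qed

lemma kernel_sum_add: "kernel_sum k Z (\<lambda>z. c z + d z) = kernel_sum k Z c + kernel_sum k Z d"
  by (simp add: kernel_sum_def scaleC_add_left sum.distrib)

lemma kernel_sum_scale: "kernel_sum k Z (\<lambda>z. a * c z) = a *\<^sub>C kernel_sum k Z c"
  by (simp add: kernel_sum_def scaleC_sum_right scaleC_scaleC)

locale rkhs =
  fixes k :: "'x \<Rightarrow> 'h::chilbert_space"
  assumes reproducing: "reproducing_kernels k"
begin

lemma kernel_ext:
  assumes "\<And>z. cinner u (k z) = cinner v (k z)"
  shows "u = v"
  using reproducing assms unfolding reproducing_kernels_def inj_def fun_of_def by (metis ext)

lemma kernel_nonzero: "k z \<noteq> 0"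
  using reproducing by (simp add: reproducing_kernels_def)

lemma kernel_self_nonzero: "cinner (k z) (k z) \<noteq> 0"
  using kernel_nonzero by (simp add: cinner_self)

lemma kernel_sums_combine:
  assumes "finite Z" "finite Y"
  shows "\<exists>c'. kernel_sum k (Z \<union> Y) c' = kernel_sum k Z c + kernel_sum k Y d
    \<and> (\<forall>q. (\<Sum>z\<in>Z \<union> Y. c' z * q z) = (\<Sum>z\<in>Z. c z * q z) + (\<Sum>z\<in>Y. (d z * q z :: complex)))"
proof (intro exI conjI allI)
  let ?c = "\<lambda>z. if z \<in> Z then c z else 0" and ?d = "\<lambda>z. if z \<in> Y then d z else 0"
  show "kernel_sum k (Z \<union> Y) (\<lambda>z. ?c z + ?d z) = kernel_sum k Z c + kernel_sum k Y d"
    using assms by (simp add: kernel_sum_add kernel_sum_extend)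
  fix q :: "'x \<Rightarrow> complex"
  have "(\<Sum>z\<in>Z \<union> Y. (?c z + ?d z) * q z)
      = (\<Sum>z\<in>Z \<union> Y. if z \<in> Z then c z * q z else 0) + (\<Sum>z\<in>Z \<union> Y. if z \<in> Y then d z * q z else 0)"
    by (simp add: distrib_right flip: sum.distrib) (intro sum.cong, auto)
  also have "\<dots> = (\<Sum>z\<in>(Z \<union> Y) \<inter> Z. c z * q z) + (\<Sum>z\<in>(Z \<union> Y) \<inter> Y. d z * q z)"
    using assms by (simp only: sum.inter_restrict[OF finite_UnI[OF assms], symmetric])
  also have "(Z \<union> Y) \<inter> Z = Z" by blast
  also have "(Z \<union> Y) \<inter> Y = Y" by blast
  finally show "(\<Sum>z\<in>Z \<union> Y. (?c z + ?d z) * q z) = (\<Sum>z\<in>Z. c z * q z) + (\<Sum>z\<in>Y. d z * q z)" .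
qed

text \<open>
  Riesz representation of the functional that \<open>q\<close> induces on the span of the kernel functions;
  the bound also makes it well defined.
\<close>

lemma rkhs_member:
  assumes C: "C \<ge> 0"
    and bound: "\<And>Z c. finite Z \<Longrightarrow> cmod (\<Sum>z\<in>Z. cnj (c z) * q z) \<le> C * norm (kernel_sum k Z c)"
  shows "\<exists>u. norm u \<le> C \<and> (\<forall>z. cinner u (k z) = q z)"
proof -
  define S where "S = {(kernel_sum k Z c, \<Sum>z\<in>Z. c z * cnj (q z)) | Z c. finite Z}"
  have "\<exists>u \<in> closure (fst ` S). norm u \<le> C \<and> (\<forall>(x, l)\<in>S. cinner x u = l)"
  proof (rule riesz_on_graph)
    have "(kernel_sum k {} (\<lambda>z. 0), \<Sum>z\<in>{}. (\<lambda>z. 0) z * cnj (q z)) \<in> S" unfolding S_def by blast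
    then show "(0, 0) \<in> S" by (simp add: kernel_sum_def)
  next
    fix x l y m assume "(x, l) \<in> S" "(y, m) \<in> S"
    then obtain Z c Y d where *: "finite Z" "finite Y"
      "x = kernel_sum k Z c" "l = (\<Sum>z\<in>Z. c z * cnj (q z))"
      "y = kernel_sum k Y d" "m = (\<Sum>z\<in>Y. d z * cnj (q z))" unfolding S_def by blast
    obtain c' where "kernel_sum k (Z \<union> Y) c' = x + y" "(\<Sum>z\<in>Z \<union> Y. c' z * cnj (q z)) = l + m"
      using kernel_sums_combine[OF *(1,2), of c d] * by auto
    then show "(x + y, l + m) \<in> S" unfolding S_def using *(1,2)
      by (metis (mono_tags, lifting) finite_UnI mem_Collect_eq)
  next
    fix a x l assume "(x, l) \<in> S"
    then obtain Z c where *: "finite Z" "x = kernel_sum k Z c" "l = (\<Sum>z\<in>Z. c z * cnj (q z))"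
      unfolding S_def by blast
    then have "a *\<^sub>C x = kernel_sum k Z (\<lambda>z. a * c z)" "a * l = (\<Sum>z\<in>Z. (a * c z) * cnj (q z))"
      by (simp_all add: kernel_sum_scale sum_distrib_left mult_ac)
    then show "(a *\<^sub>C x, a * l) \<in> S" unfolding S_def using *(1) by blast
  next
    fix x l assume "(x, l) \<in> S"
    then obtain Z c where *: "finite Z" "x = kernel_sum k Z c" "l = (\<Sum>z\<in>Z. c z * cnj (q z))"
      unfolding S_def by blast
    have "cmod l = cmod (cnj l)" by simp
    also have "cnj l = (\<Sum>z\<in>Z. cnj (c z) * q z)" by (simp add: *)
    finally show "cmod l \<le> C * norm x" using bound[OF *(1)] * by simp
  qed (rule C)
  then obtain u where u: "norm u \<le> C" "\<forall>(x, l)\<in>S. cinner x u = l" by blast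
  have "cinner u (k z) = q z" for z
  proof -
    have "(kernel_sum k {z} (\<lambda>z. 1), \<Sum>z\<in>{z}. 1 * cnj (q z)) \<in> S" unfolding S_def by blast
    then have "cinner (k z) u = cnj (q z)" using u(2) by (auto simp: kernel_sum_def)
    then show ?thesis by (metis cinner_commute complex_cnj_cnj)
  qed
  then show ?thesis using u(1) by blast
qed

lemma kernel_sums_dense:
  assumes "e > 0"
  shows "\<exists>Z c. finite Z \<and> norm (kernel_sum k Z c - u) < e"
proof -
  define V where "V = {kernel_sum k Z c | Z c. finite Z}"
  have V: "complex_subspace V"
    unfolding complex_subspace_def
  proof (intro conjI ballI allI)
    show "0 \<in> V" unfolding V_def using kernel_sum_def[of k "{}"] by fastforce
    show "x + y \<in> V" if "x \<in> V" "y \<in> V" for x y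
      using that kernel_sums_combine unfolding V_def by (auto, metis finite_UnI)
    fix a x assume "x \<in> V"
    then obtain Z c where "finite Z" "x = kernel_sum k Z c" unfolding V_def by blast
    then have "finite Z" "a *\<^sub>C x = kernel_sum k Z (\<lambda>z. a * c z)" by (simp_all add: kernel_sum_scale)
    then show "a *\<^sub>C x \<in> V" unfolding V_def by blast
  qed
  have kV: "k z \<in> V" for z
  proof -
    have "k z = kernel_sum k {z} (\<lambda>_. 1)" by (simp add: kernel_sum_def)
    then show ?thesis unfolding V_def by blast
  qed
  have "u \<in> closure V"
  proof (rule in_closed_subspaceI[OF complex_subspace_closure[OF V] closed_closure])
    fix y assume "\<forall>z\<in>closure V. cinner z y = 0"
    then have "\<forall>z. cinner (k z) y = 0" using kV closure_subset by blast
    then have "cinner y (k z) = cinner 0 (k z)" for z by (metis cinner_commute cinner_zero_left complex_cnj_zero)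
    then have "y = 0" by (rule kernel_ext)
    then show "cinner u y = 0" by simp
  qed
  then obtain v where "v \<in> V" "dist v u < e" using assms closure_approachable by blast
  then show ?thesis unfolding V_def by (auto simp: dist_norm)
qed

text \<open>
  Gram--Schmidt, one kernel function at a time.  The vector \<open>w\<close> in the proof is zero when the new
  kernel function depends linearly on the previous ones.
\<close>

lemma kernel_projection:
  assumes "finite Z"
  shows "\<exists>c. (\<forall>z\<in>Z. cinner (kernel_sum k Z c) (k z) = cinner u (k z))
    \<and> norm (kernel_sum k Z c) \<le> norm u"
proof -
  have "\<exists>c. \<forall>z\<in>Z. cinner (kernel_sum k Z c) (k z) = cinner u (k z)" for u
    using assms
  proof (induction Z arbitrary: u)
    case (insert y Z)
    obtain c where c: "\<And>z. z \<in> Z \<Longrightarrow> cinner (kernel_sum k Z c) (k z) = cinner u (k z)"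
      using insert.IH by blast
    obtain e where e: "\<And>z. z \<in> Z \<Longrightarrow> cinner (kernel_sum k Z e) (k z) = cinner (k y) (k z)"
      using insert.IH by blast
    define w where "w = k y - kernel_sum k Z e"
    \<comment> \<open>For \<open>w = 0\<close> the division by zero gives \<open>t = 0\<close>, so that the projection stays the same.\<close>
    define t where "t = (cinner u w - cinner (kernel_sum k Z c) w) / cinner w w"
    define c' where "c' z = (if z = y then t else c z + (- t) * e z)" for z
    have "kernel_sum k (insert y Z) c' = t *\<^sub>C k y + kernel_sum k Z (\<lambda>z. c z + (- t) * e z)"
      using insert.hyps unfolding kernel_sum_def
      by (simp add: c'_def) (intro sum.cong, auto)
    also have "\<dots> = kernel_sum k Z c + t *\<^sub>C w"
      unfolding kernel_sum_add kernel_sum_scale w_def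
      using scaleC_add_right[of t "k y" "- kernel_sum k Z e"] scaleC_scaleC[of t "- 1" "kernel_sum k Z e"]
      by (simp add: scaleC_minus1)
    finally have g: "kernel_sum k (insert y Z) c' = kernel_sum k Z c + t *\<^sub>C w" .
    have wz: "cinner w (k z) = 0" if "z \<in> Z" for z
      using e[OF that] by (simp add: w_def cinner_diff_left)
    have pair: "cinner (kernel_sum k Z c) (kernel_sum k Z e) = cinner u (kernel_sum k Z e)"
      unfolding cinner_kernel_sum using c by (intro sum.cong) auto
    have we: "cinner w (kernel_sum k Z e) = 0"
      unfolding cinner_kernel_sum using wz by (intro sum.neutral) auto
    have "t * cinner w w = cinner u w - cinner (kernel_sum k Z c) w"
      by (cases "w = 0") (simp_all add: t_def cinner_self)
    moreover have "k y = w + kernel_sum k Z e" by (simp add: w_def)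
    ultimately have "cinner (kernel_sum k Z c + t *\<^sub>C w) (k y) = cinner u (k y)"
      by (simp add: cinner_add_left cinner_add_right cinner_scaleC_left we pair)
    then have "\<forall>z\<in>insert y Z. cinner (kernel_sum k (insert y Z) c') (k z) = cinner u (k z)"
      unfolding g by (auto simp: cinner_add_left cinner_scaleC_left wz c)
    then show ?case by blast
  qed simp
  then obtain c where c: "\<And>z. z \<in> Z \<Longrightarrow> cinner (kernel_sum k Z c) (k z) = cinner u (k z)" by blast
  let ?g = "kernel_sum k Z c"
  have "cinner ?g ?g = cinner u ?g"
    unfolding cinner_kernel_sum[of _ k Z c] using c by (intro sum.cong) auto
  then have "(norm ?g)\<^sup>2 \<le> norm u * norm ?g"
    using cmod_cinner_le[of u ?g] cmod_cinner_self[of ?g] by simp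
  then have "norm ?g \<le> norm u" by (rule le_of_square_le) simp
  then show ?thesis using c by blast
qed

lemma multiplies_add: "multiplies k t T \<Longrightarrow> T (u + v) = T u + T v"
  by (rule kernel_ext) (simp add: multiplies_def cinner_add_left distrib_left)

lemma multiplies_scaleC: "multiplies k t T \<Longrightarrow> T (c *\<^sub>C u) = c *\<^sub>C T u"
  by (rule kernel_ext) (simp add: multiplies_def cinner_scaleC_left)

lemma multiplies_mult_op:
  assumes "t \<in> multipliers k"
  shows "multiplies k t (mult_op k t)"
proof -
  have "\<exists>!g. fun_of k g = (\<lambda>x. t x * fun_of k h x)" for h
  proof -
    obtain g where g: "fun_of k g = (\<lambda>x. t x * fun_of k h x)"
      using assms unfolding multipliers_def by blast
    show ?thesis
    proof (rule ex1I)
      show "fun_of k g = (\<lambda>x. t x * fun_of k h x)" by (rule g)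
    next
      fix y assume "fun_of k y = (\<lambda>x. t x * fun_of k h x)"
      then have "fun_of k y = fun_of k g" using g by simp
      moreover have "inj (fun_of k)" using reproducing by (simp add: reproducing_kernels_def)
      ultimately show "y = g" by (simp only: inj_eq)
    qed
  qed
  from theI'[OF this] show ?thesis
    unfolding mult_op_def multiplies_def by (simp add: fun_of_def fun_eq_iff)
qed

lemma multiplies_imp_multiplier:
  assumes "multiplies k t T"
  shows "t \<in> multipliers k" "mult_op k t = T"
proof -
  show t: "t \<in> multipliers k"
    using assms unfolding multipliers_def multiplies_def fun_of_def by blast
  show "mult_op k t = T"
  proof
    fix u show "mult_op k t u = T u"
      using assms multiplies_mult_op[OF t] unfolding multiplies_def by (intro kernel_ext) simp
  qed
qed

lemma multiplies_unique:
  assumes "multiplies k t T" "multiplies k s T"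
  shows "t = s"
proof
  fix z
  have "cinner (T (k z)) (k z) = t z * cinner (k z) (k z)"
    using assms(1) by (simp add: multiplies_def)
  moreover have "cinner (T (k z)) (k z) = s z * cinner (k z) (k z)"
    using assms(2) by (simp add: multiplies_def)
  ultimately show "t z = s z" using kernel_self_nonzero by simp
qed

text \<open>
  The right-hand side only involves values of \<open>u\<close>, so it is visibly a closed condition on \<open>u\<close>,
  although \<open>T\<close> is not yet known to be continuous.
\<close>

lemma multiplies_norm_iff:
  assumes T: "multiplies k t T" and C: "C \<ge> 0"
  shows "norm (T u) \<le> C \<longleftrightarrow> (\<forall>Z c. finite Z \<longrightarrow>
    cmod (\<Sum>z\<in>Z. cnj (c z) * (t z * cinner u (k z))) \<le> C * norm (kernel_sum k Z c))"
proof
  assume le: "norm (T u) \<le> C"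
  have "cmod (\<Sum>z\<in>Z. cnj (c z) * (t z * cinner u (k z))) \<le> C * norm (kernel_sum k Z c)" for Z c
  proof -
    have "(\<Sum>z\<in>Z. cnj (c z) * (t z * cinner u (k z))) = cinner (T u) (kernel_sum k Z c)"
      using T by (simp add: cinner_kernel_sum multiplies_def)
    also have "cmod \<dots> \<le> norm (T u) * norm (kernel_sum k Z c)" by (rule cmod_cinner_le)
    also have "\<dots> \<le> C * norm (kernel_sum k Z c)" using le by (simp add: mult_right_mono)
    finally show ?thesis .
  qed
  then show "\<forall>Z c. finite Z \<longrightarrow>
    cmod (\<Sum>z\<in>Z. cnj (c z) * (t z * cinner u (k z))) \<le> C * norm (kernel_sum k Z c)" by blast
next
  assume "\<forall>Z c. finite Z \<longrightarrow>
    cmod (\<Sum>z\<in>Z. cnj (c z) * (t z * cinner u (k z))) \<le> C * norm (kernel_sum k Z c)"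
  then obtain v where v: "norm v \<le> C" "\<forall>z. cinner v (k z) = t z * cinner u (k z)"
    using rkhs_member[OF C, of "\<lambda>z. t z * cinner u (k z)"] by blast
  then have "v = T u" using T by (intro kernel_ext) (simp add: multiplies_def)
  then show "norm (T u) \<le> C" using v by simp
qed

text \<open>
  By Baire's theorem one of the closed sets \<open>{u. \<parallel>T u\<parallel> \<le> n}\<close> has an interior point.
\<close>

lemma multiplies_bounded:
  assumes T: "multiplies k t T"
  shows "T \<in> bounded_clinear_ops"
proof -
  define V where "V n = {u. norm (T u) \<le> real n}" for n :: nat
  have closed_V: "closed (V n)" for n
  proof -
    have "V n = (\<Inter>c. \<Inter>Z\<in>Collect finite.
        {u. cmod (\<Sum>z\<in>Z. cnj (c z) * (t z * cinner u (k z))) \<le> real n * norm (kernel_sum k Z c)})"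
      unfolding V_def using multiplies_norm_iff[OF T] by auto
    moreover have "closed {u. cmod (\<Sum>z\<in>Z. cnj (c z) * (t z * cinner u (k z))) \<le> real n * norm (kernel_sum k Z c)}"
      for Z c by (intro closed_Collect_le continuous_intros)
    ultimately show ?thesis by (auto intro!: closed_INT)
  qed
  have "\<exists>n. interior (V n) \<noteq> {}"
  proof (rule ccontr)
    assume "\<nexists>n. interior (V n) \<noteq> {}"
    then have "euclidean interior_of \<Union>(range V) = {}"
      by (intro Baire_category_alt) (auto simp: completely_metrizable_space_euclidean closed_V)
    moreover have "\<Union>(range V) = UNIV"
      using real_arch_simple by (auto simp: V_def)
    ultimately show False by simp
  qed
  then obtain n a r where r: "r > 0" and ball: "ball a r \<subseteq> V n"
    by (metis all_not_in_conv mem_interior)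
  define C where "C = 2 * (2 * real n / r)"
  have Tu: "norm (T u) \<le> C * norm u" for u
  proof (cases "u = 0")
    case True
    then show ?thesis using multiplies_add[OF T, of 0 0] by simp
  next
    case False
    define s where "s = r / (2 * norm u)"
    have s: "s > 0" using r False by (simp add: s_def)
    have "norm (of_real s *\<^sub>C u) < r"
      using r False s unfolding norm_scaleC norm_of_real by (simp add: s_def)
    then have "a + of_real s *\<^sub>C u \<in> V n" "a \<in> V n" using ball r by (auto simp: dist_norm)
    then have "norm (T a + of_real s *\<^sub>C T u) \<le> n" "norm (T a) \<le> n"
      by (auto simp: V_def multiplies_add[OF T] multiplies_scaleC[OF T])
    then have "norm (of_real s *\<^sub>C T u) \<le> 2 * n"
      using norm_triangle_ineq4[of "T a + of_real s *\<^sub>C T u" "T a"] by simp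
    then have "norm (T u) \<le> 2 * n / s" using s by (simp add: norm_scaleC field_simps)
    then show ?thesis using False r by (simp add: s_def C_def field_simps)
  qed
  have "bounded_linear T"
  proof (rule bounded_linear_intro[where K = C])
    show "T (c *\<^sub>R u) = c *\<^sub>R T u" for c u
      using multiplies_scaleC[OF T, of "of_real c" u] by (simp add: scaleC_of_real)
  qed (use multiplies_add[OF T] Tu in \<open>auto simp: mult.commute\<close>)
  then show ?thesis by (simp add: bounded_clinear_ops_def multiplies_scaleC[OF T])
qed

lemma mult_op_bounded:
  assumes "t \<in> multipliers k"
  shows "bounded_linear (mult_op k t)"
proof -
  have "mult_op k t \<in> bounded_clinear_ops"
    by (rule multiplies_bounded, rule multiplies_mult_op, rule assms)
  then show ?thesis unfolding bounded_clinear_ops_def by simp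
qed

lemma kernel_fun_conv: "kernel_fun k z w = cinner (k w) (k z)"
  by (simp add: kernel_fun_def)

end

section \<open>Contractive columns and rows of multipliers\<close>

context rkhs
begin

definition contractive_on :: "'x set \<Rightarrow> nat \<Rightarrow> (nat \<Rightarrow> 'x \<Rightarrow> complex) \<Rightarrow> bool" where
  "contractive_on Z r \<phi> \<longleftrightarrow> psd_on (Z \<times> {..<r})
    (\<lambda>(z, p) (w, q). kernel_fun k z w * ((if p = q then 1 else 0) - \<phi> p z * cnj (\<phi> q w)))"

text \<open>
  The adjoint of the column sends \<open>\<Sum> c (z, p) k z\<close> in the \<open>p\<close>-th component to
  \<open>\<Sum> c (z, p) cnj (\<phi> p z) k z\<close>, and \<open>contractive_on\<close> says that it is contractive on these sums.  The
  column itself is recovered from the adjoint by Riesz representation and density.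
\<close>

lemma contractive_column:
  fixes \<phi> :: "nat \<Rightarrow> 'x \<Rightarrow> complex"
  assumes contractive: "\<And>Z r. finite Z \<Longrightarrow> contractive_on Z r \<phi>"
  shows "\<exists>v. (\<forall>n z. cinner (v n) (k z) = \<phi> n z * cinner u (k z)) \<and>
    (\<forall>r. (\<Sum>n<r. (norm (v n))\<^sup>2) \<le> (norm u)\<^sup>2)"
proof -
  have contr: "norm (\<Sum>p<r. kernel_sum k Z (\<lambda>z. c (z, p) * cnj (\<phi> p z)))
      \<le> sqrt (\<Sum>p<r. (norm (kernel_sum k Z (\<lambda>z. c (z, p))))\<^sup>2)" if "finite Z" for Z r and c :: "'x \<times> nat \<Rightarrow> complex"
  proof -
    let ?D = "\<lambda>(z, p) (w, q). if p = q then kernel_fun k z w else 0"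
    let ?\<Phi> = "\<lambda>i j. cinner ((cnj (\<phi> (snd j) (fst j))) *\<^sub>C k (fst j)) ((cnj (\<phi> (snd i) (fst i))) *\<^sub>C k (fst i))"
    have D: "herm_form (Z \<times> {..<r}) ?D c c = of_real (\<Sum>p<r. (norm (kernel_sum k Z (\<lambda>z. c (z, p))))\<^sup>2)"
      unfolding herm_form_block_diagonal[OF finite_lessThan] kernel_fun_conv herm_form_gram cinner_self
      by (simp add: kernel_sum_def)
    have \<Phi>: "herm_form (Z \<times> {..<r}) ?\<Phi> c c
        = of_real ((norm (\<Sum>p<r. kernel_sum k Z (\<lambda>z. c (z, p) * cnj (\<phi> p z))))\<^sup>2)"
    proof -
      have "(\<Sum>i\<in>Z \<times> {..<r}. c i *\<^sub>C (cnj (\<phi> (snd i) (fst i))) *\<^sub>C k (fst i))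
          = (\<Sum>z\<in>Z. \<Sum>p<r. (c (z, p) * cnj (\<phi> p z)) *\<^sub>C k z)"
        by (simp add: sum.cartesian_product' scaleC_scaleC)
      also have "\<dots> = (\<Sum>p<r. kernel_sum k Z (\<lambda>z. c (z, p) * cnj (\<phi> p z)))"
        unfolding kernel_sum_def by (rule sum.swap)
      finally show ?thesis unfolding herm_form_gram cinner_self by simp
    qed
    have "herm_form (Z \<times> {..<r}) (\<lambda>(z, p) (w, q). kernel_fun k z w * ((if p = q then 1 else 0) - \<phi> p z * cnj (\<phi> q w))) c c
        = herm_form (Z \<times> {..<r}) ?D c c - herm_form (Z \<times> {..<r}) ?\<Phi> c c"
      unfolding herm_form_diff_matrix[symmetric]
      by (rule herm_form_cong)
         (auto simp: kernel_fun_conv cinner_scaleC_left cinner_scaleC_right algebra_simps)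
    moreover have "herm_form (Z \<times> {..<r}) (\<lambda>(z, p) (w, q). kernel_fun k z w * ((if p = q then 1 else 0) - \<phi> p z * cnj (\<phi> q w))) c c \<in> \<real>\<^sub>\<ge>\<^sub>0"
      using contractive[OF that, of r] unfolding contractive_on_def psd_on_iff by blast
    ultimately have "0 \<le> Re (herm_form (Z \<times> {..<r}) ?D c c - herm_form (Z \<times> {..<r}) ?\<Phi> c c)"
      by (simp add: complex_nonneg_Reals_iff)
    then show ?thesis unfolding D \<Phi> by (simp add: real_le_rsqrt)
  qed
  have pairing: "cmod (\<Sum>p<r. \<Sum>z\<in>Z. cnj (c (z, p)) * (\<phi> p z * cinner u (k z)))
      \<le> norm u * sqrt (\<Sum>p<r. (norm (kernel_sum k Z (\<lambda>z. c (z, p))))\<^sup>2)" if "finite Z" for Z r and c :: "'x \<times> nat \<Rightarrow> complex"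
  proof -
    have "(\<Sum>p<r. \<Sum>z\<in>Z. cnj (c (z, p)) * (\<phi> p z * cinner u (k z)))
        = cinner u (\<Sum>p<r. kernel_sum k Z (\<lambda>z. c (z, p) * cnj (\<phi> p z)))"
      by (simp add: cinner_sum_right cinner_kernel_sum mult_ac)
    also have "cmod \<dots> \<le> norm u * norm (\<Sum>p<r. kernel_sum k Z (\<lambda>z. c (z, p) * cnj (\<phi> p z)))"
      by (rule cmod_cinner_le)
    finally show ?thesis using mult_left_mono[OF contr[OF that, where r = r and c = c] norm_ge_zero[of u]] by linarith
  qed
  have "\<exists>x. norm x \<le> norm u \<and> (\<forall>z. cinner x (k z) = \<phi> n z * cinner u (k z))" for n
  proof (rule rkhs_member)
    fix Z :: "'x set" and c :: "'x \<Rightarrow> complex" assume Z: "finite Z"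
    define c' where "c' = (\<lambda>(z, p). if p = n then c z else (0 :: complex))"
    have "(\<Sum>p<Suc n. \<Sum>z\<in>Z. cnj (c' (z, p)) * (\<phi> p z * cinner u (k z)))
        = (\<Sum>p<Suc n. if p = n then \<Sum>z\<in>Z. cnj (c z) * (\<phi> n z * cinner u (k z)) else 0)"
      by (intro sum.cong) (auto simp: c'_def)
    moreover have "(\<Sum>p<Suc n. (norm (kernel_sum k Z (\<lambda>z. c' (z, p))))\<^sup>2)
        = (\<Sum>p<Suc n. if p = n then (norm (kernel_sum k Z c))\<^sup>2 else 0)"
      by (intro sum.cong) (auto simp: c'_def kernel_sum_def)
    ultimately show "cmod (\<Sum>z\<in>Z. cnj (c z) * (\<phi> n z * cinner u (k z))) \<le> norm u * norm (kernel_sum k Z c)"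
      using pairing[OF Z, where r = "Suc n" and c = c'] by simp
  qed simp
  then obtain v where v: "\<And>n z. cinner (v n) (k z) = \<phi> n z * cinner u (k z)" by metis
  have "(\<Sum>n<r. (norm (v n))\<^sup>2) \<le> (norm u)\<^sup>2" for r
  proof -
    have "\<exists>Z c. finite Z \<and> norm (kernel_sum k Z c - v n) < inverse (real (Suc m))" for n m
      by (rule kernel_sums_dense) simp
    then obtain Z0 c0 where Z0: "\<And>n m. finite (Z0 n m)"
      and c0: "\<And>n m. norm (kernel_sum k (Z0 n m) (c0 n m) - v n) < inverse (real (Suc m))"
      by metis
    define Z where "Z m = (\<Union>n<r. Z0 n m)" for m
    define c where "c m = (\<lambda>(z, n). if z \<in> Z0 n m then c0 n m z else 0)" for m
    define g where "g n m = kernel_sum k (Z m) (\<lambda>z. c m (z, n))" for n m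
    have fin: "finite (Z m)" for m by (simp add: Z_def Z0)
    have g: "g n m = kernel_sum k (Z0 n m) (c0 n m)" if "n < r" for n m
    proof -
      have "Z0 n m \<subseteq> Z m" using that by (auto simp: Z_def)
      then show ?thesis unfolding g_def c_def using kernel_sum_extend[OF fin] by simp
    qed
    have lim: "g n \<longlonglongrightarrow> v n" if "n < r" for n
    proof (rule LIM_zero_cancel, rule Lim_null_comparison)
      show "\<forall>\<^sub>F m in sequentially. norm (g n m - v n) \<le> inverse (real (Suc m))"
        using c0[of n] by (simp add: g[OF that] less_imp_le)
    qed (rule LIMSEQ_inverse_real_of_nat)
    have "cmod (\<Sum>n<r. cinner (v n) (g n m)) \<le> norm u * sqrt (\<Sum>n<r. (norm (g n m))\<^sup>2)" for m
      using pairing[OF fin[of m], where r = r and c = "c m"] unfolding g_def cinner_kernel_sum v .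
    moreover have "(\<lambda>m. cmod (\<Sum>n<r. cinner (v n) (g n m))) \<longlonglongrightarrow> cmod (\<Sum>n<r. cinner (v n) (v n))"
      by (intro tendsto_intros lim) simp
    moreover have "(\<lambda>m. norm u * sqrt (\<Sum>n<r. (norm (g n m))\<^sup>2))
        \<longlonglongrightarrow> norm u * sqrt (\<Sum>n<r. (norm (v n))\<^sup>2)"
      by (intro tendsto_intros lim) simp
    ultimately have le: "cmod (\<Sum>n<r. cinner (v n) (v n)) \<le> norm u * sqrt (\<Sum>n<r. (norm (v n))\<^sup>2)"
      using LIMSEQ_le by blast
    define s where "s = (\<Sum>n<r. (norm (v n))\<^sup>2)"
    have s0: "s \<ge> 0" by (simp add: s_def sum_nonneg)
    have "(\<Sum>n<r. cinner (v n) (v n)) = of_real s"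
      unfolding cinner_self s_def by simp
    then have "(sqrt s)\<^sup>2 \<le> norm u * sqrt s" using le s0 by (simp flip: s_def)
    then have "sqrt s \<le> norm u" by (rule le_of_square_le) simp
    then have "(sqrt s)\<^sup>2 \<le> (norm u)\<^sup>2" by (rule power_mono) (simp add: s0)
    then show ?thesis using s0 by (simp add: s_def)
  qed
  then show ?thesis using v by blast
qed

text \<open>
  The adjoints of the entries \<open>F 0 l\<close> map \<open>g = \<Sum> c x k x\<close> to vectors \<open>h l\<close>, and the row applied to
  the column \<open>h\<close>, paired with \<open>g\<close>, gives \<open>\<Sum> \<parallel>h l\<parallel>\<^sup>2\<close>.  The bound for the row therefore yields
  \<open>\<Sum> \<parallel>h l\<parallel>\<^sup>2 \<le> \<parallel>g\<parallel>\<^sup>2\<close>, which is the asserted positivity.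
\<close>

lemma row_contraction:
  assumes F: "\<And>a b. a < r \<Longrightarrow> b < r \<Longrightarrow> F a b \<in> multipliers k"
    and norm: "matrix_mult_norm k r F \<le> 1" and r: "0 < r"
  shows "psd_on Y (\<lambda>x w. kernel_fun k x w * (1 - (\<Sum>l<r. F 0 l x * cnj (F 0 l w))))"
proof (rule psd_onI)
  fix c
  define g where "g = kernel_sum k Y c"
  define h where "h l = kernel_sum k Y (\<lambda>x. c x * cnj (F 0 l x))" for l
  define s where "s = sqrt (\<Sum>l<r. (norm (h l))\<^sup>2)"
  have s2: "s\<^sup>2 = (\<Sum>l<r. (norm (h l))\<^sup>2)" by (simp add: s_def sum_nonneg)
  have s0: "s \<ge> 0" by (simp add: s_def sum_nonneg)
  have bl: "bounded_linear (mult_op k (F a b))" if "a < r" "b < r" for a b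
    using mult_op_bounded F that by blast
  have "kernel_fun k x w * (1 - (\<Sum>l<r. F 0 l x * cnj (F 0 l w)))
      = kernel_fun k x w - (\<Sum>l<r. kernel_fun k x w * (F 0 l x * cnj (F 0 l w)))" for x w
    by (simp add: right_diff_distrib sum_distrib_left)
  then have "herm_form Y (\<lambda>x w. kernel_fun k x w * (1 - (\<Sum>l<r. F 0 l x * cnj (F 0 l w)))) c c
      = herm_form Y (kernel_fun k) c c
        - herm_form Y (\<lambda>x w. \<Sum>l<r. kernel_fun k x w * (F 0 l x * cnj (F 0 l w))) c c"
    unfolding herm_form_diff_matrix[symmetric] by (intro herm_form_cong)
  also have "herm_form Y (kernel_fun k) c c = of_real ((norm g)\<^sup>2)"
    unfolding kernel_fun_conv[abs_def] herm_form_gram cinner_self g_def kernel_sum_def ..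
  also have "herm_form Y (\<lambda>x w. \<Sum>l<r. kernel_fun k x w * (F 0 l x * cnj (F 0 l w))) c c
      = (\<Sum>l<r. herm_form Y (kernel_fun k) (\<lambda>i. cnj (F 0 l i) * c i) (\<lambda>j. cnj (F 0 l j) * c j))"
    unfolding herm_form_schur[symmetric] by (intro herm_form_cong) (simp add: sum_distrib_left)
  also have "\<dots> = of_real (s\<^sup>2)"
    unfolding kernel_fun_conv[abs_def] herm_form_gram cinner_self s2 h_def kernel_sum_def
    by (simp add: mult.commute)
  finally show "herm_form Y (\<lambda>x w. kernel_fun k x w * (1 - (\<Sum>l<r. F 0 l x * cnj (F 0 l w)))) c c
      = of_real ((norm g)\<^sup>2 - s\<^sup>2)" by simp
  have "s \<le> norm g"
  proof (cases "s = 0")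
    case False
    then have s: "s > 0" using s0 by simp
    define h' where "h' l = (1 / s) *\<^sub>R h l" for l
    let ?B = "{h :: nat \<Rightarrow> 'h. L2_set (\<lambda>j. norm (h j)) {..<r} \<le> 1}"
    let ?N = "\<lambda>h. L2_set (\<lambda>i. norm (\<Sum>j<r. mult_op k (F i j) (h j))) {..<r}"
    have bdd: "bdd_above (?N ` ?B)"
    proof (rule bdd_aboveI2)
      fix h :: "nat \<Rightarrow> 'h" assume h: "h \<in> ?B"
      have hj: "norm (h j) \<le> 1" if "j < r" for j
        using member_le_L2_set[of "{..<r}" j "\<lambda>j. norm (h j)"] that h by simp
      have "?N h \<le> (\<Sum>i<r. norm (\<Sum>j<r. mult_op k (F i j) (h j)))"
        by (rule L2_set_le_sum) simp
      also have "\<dots> \<le> (\<Sum>i<r. \<Sum>j<r. onorm (mult_op k (F i j)))"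
      proof (intro sum_mono order_trans[OF norm_sum])
        fix i j assume "i \<in> {..<r}" "j \<in> {..<r}"
        then show "norm (mult_op k (F i j) (h j)) \<le> onorm (mult_op k (F i j))"
          using onorm[OF bl, of i j "h j"] mult_left_mono[OF hj onorm_pos_le[OF bl], of j i j] by simp
      qed
      finally show "?N h \<le> (\<Sum>i<r. \<Sum>j<r. onorm (mult_op k (F i j)))" .
    qed
    have "L2_set (\<lambda>j. norm (h' j)) {..<r} = 1"
      using s by (simp add: h'_def L2_set_def power_mult_distrib power_divide s2[symmetric]
          flip: sum_distrib_left sum_divide_distrib)
    then have "h' \<in> ?B" by simp
    then have N1: "?N h' \<le> 1"
      using cSUP_upper[OF _ bdd, of h'] norm unfolding matrix_mult_norm_def by linarith
    have N2: "norm (\<Sum>j<r. mult_op k (F 0 j) (h' j)) \<le> ?N h'"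
      by (rule member_le_L2_set[where f = "\<lambda>i. norm (\<Sum>j<r. mult_op k (F i j) (h' j))"]) (use r in auto)
    have "norm (\<Sum>j<r. mult_op k (F 0 j) (h' j)) \<le> 1" by (rule order_trans[OF N2 N1])
    moreover have "(\<Sum>j<r. mult_op k (F 0 j) (h' j)) = (1 / s) *\<^sub>R (\<Sum>j<r. mult_op k (F 0 j) (h j))"
      unfolding h'_def scaleR_right.sum
      by (intro sum.cong refl linear_scale bounded_linear.linear bl r) simp
    ultimately have "norm ((1 / s) *\<^sub>R (\<Sum>j<r. mult_op k (F 0 j) (h j))) \<le> 1" by simp
    then have le: "norm (\<Sum>j<r. mult_op k (F 0 j) (h j)) \<le> s" using s by (simp add: field_simps)
    have "cinner (\<Sum>j<r. mult_op k (F 0 j) (h j)) g = (\<Sum>j<r. cinner (h j) (h j))"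
    proof -
      have "cinner (mult_op k (F 0 j) (h j)) g = cinner (h j) (h j)" if "j < r" for j
        using multiplies_mult_op[OF F[OF r that]]
        unfolding multiplies_def g_def h_def cinner_kernel_sum by (simp add: mult_ac)
      then show ?thesis by (simp add: cinner_sum_left)
    qed
    also have "\<dots> = of_real (s\<^sup>2)" unfolding s2 cinner_self by simp
    finally have "cmod (of_real (s\<^sup>2)) \<le> norm (\<Sum>j<r. mult_op k (F 0 j) (h j)) * norm g"
      using cmod_cinner_le by metis
    also have "\<dots> \<le> s * norm g" using le by (simp add: mult_right_mono)
    finally have "s * s \<le> s * norm g" unfolding norm_of_real by (simp add: power2_eq_square)
    then show ?thesis using s by simp
  qed simp
  then show "0 \<le> (norm g)\<^sup>2 - s\<^sup>2" using s0 by (simp add: power_mono)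
qed

end

section \<open>The structure of complete Nevanlinna-Pick kernels\<close>

locale cnp_space = rkhs k for k :: "'x \<Rightarrow> 'h::chilbert_space" +
  assumes irreducible: "irreducible_kernel k" and cnp: "complete_nevanlinna_pick k"
begin

text \<open>
  The Pick property is applied to square matrices whose first row is \<open>b\<close>, padded by a zero, and whose
  other rows are zero.  Their Pick matrix is block diagonal: the first block is the hypothesis, the
  others are copies of \<open>k\<close>.  The padding makes the size of the matrices positive when \<open>d = 0\<close>.
\<close>

lemma cnp_row_extension:
  assumes Z: "finite Z" "Z \<noteq> {}"
    and psd: "psd_on Z (\<lambda>x w. kernel_fun k x w * (1 - (\<Sum>l<d. b l x * cnj (b l w))))"
  shows "\<exists>f. (\<forall>l\<le>d. \<forall>x\<in>Z. f l x = (if l < d then b l x else 0)) \<and>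
    (\<forall>Y. psd_on Y (\<lambda>x w. kernel_fun k x w * (1 - (\<Sum>l<Suc d. f l x * cnj (f l w)))))"
proof -
  define n where "n = card Z"
  obtain z where z: "bij_betw z {..<n} Z"
    using ex_bij_betw_nat_finite[OF Z(1)] by (auto simp: n_def atLeast0LessThan)
  have inj: "inj_on z {..<n}" and im: "z ` {..<n} = Z" using z by (auto simp: bij_betw_def)
  have n: "n \<ge> 1" using Z by (simp add: n_def Suc_le_eq card_gt_0_iff)
  define W where "W i a c = (if a = 0 \<and> c < d then b c (z i) else 0)" for i a c :: nat
  define A where "A p i j = (if p = (0::nat) then kernel_fun k (z i) (z j) * (1 - (\<Sum>l<d. b l (z i) * cnj (b l (z j))))
      else kernel_fun k (z i) (z j))" for p i j
  have psdA: "psd_on {..<n} (A p)" for p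
  proof (cases "p = 0")
    case True
    then show ?thesis using psd_on_reindex[OF psd Z(1) inj] im by (simp add: A_def[abs_def])
  next
    case False
    then have "A p = (\<lambda>i j. cinner (k (z j)) (k (z i)))" by (simp add: A_def kernel_fun_conv fun_eq_iff)
    then show ?thesis using psd_on_gram[of "{..<n}" "\<lambda>i. k (z i)"] by simp
  qed
  have W: "(\<Sum>c<Suc d. W i a c * cnj (W j a' c)) = (if a = 0 \<and> a' = 0 then \<Sum>l<d. b l (z i) * cnj (b l (z j)) else 0)"
    for i j a a' by (auto simp: W_def)
  have "psd_on ({..<n} \<times> {..<Suc d}) (\<lambda>(i, a) (j, b).
      ((if a = b then 1 else 0) - (\<Sum>c<Suc d. W i a c * cnj (W j b c))) * kernel_fun k (z i) (z j))"
  proof -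
    have "psd_on ({..<n} \<times> {..<Suc d}) (\<lambda>(i, p) (j, q). if p = q then A p i j else 0)"
      by (rule psd_on_block_diagonal) (simp_all add: psdA)
    moreover have "((if a = a' then 1 else 0) - (\<Sum>c<Suc d. W i a c * cnj (W j a' c))) * kernel_fun k (z i) (z j)
        = (if a = a' then A a i j else 0)" for i j a a'
      unfolding W by (auto simp: A_def)
    ultimately show ?thesis by simp
  qed
  from cnp[unfolded complete_nevanlinna_pick_def, rule_format, OF _ n inj this]
  obtain F where F: "\<forall>a<Suc d. \<forall>b<Suc d. F a b \<in> multipliers k" "matrix_mult_norm k (Suc d) F \<le> 1"
    "\<forall>i<n. \<forall>a<Suc d. \<forall>b<Suc d. F a b (z i) = W i a b"
    by auto
  show ?thesis
  proof (intro exI[of _ "F 0"] conjI allI impI ballI)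
    fix l x assume "l \<le> d" "x \<in> Z"
    then show "F 0 l x = (if l < d then b l x else 0)"
      using F(3) im by (auto simp: W_def)
  next
    fix Y show "psd_on Y (\<lambda>x w. kernel_fun k x w * (1 - (\<Sum>l<Suc d. F 0 l x * cnj (F 0 l w))))"
      by (rule row_contraction) (use F in auto)
  qed
qed

text \<open>
  The necessary condition of McCullough and Quiggin for the complete Pick property: on every finite
  set, \<open>1 - k(x, z0) k(z0, w) / (k(x, w) k(z0, z0))\<close> is a Gram matrix.  Points are added one at a
  time.  If \<open>b\<close> is a Gram family on \<open>Z\<close>, the matrix \<open>k(x, w) (1 - \<langle>b x, b w\<rangle>)\<close> has rank one there, so \<open>b\<close>
  extends to a contractive row of multipliers.  Positivity on \<open>Z \<union> {y}\<close> of a matrix whose \<open>Z\<close>-block has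
  rank one forces the inner products of \<open>b y\<close> with \<open>b x\<close> for \<open>x\<close> in \<open>Z\<close>, and leaves a nonnegative
  deficit at \<open>(y, y)\<close>, which one new coordinate absorbs.
\<close>

lemma mccullough_quiggin:
  assumes "finite Z"
  shows "\<exists>(d::nat) b. \<forall>x\<in>insert z0 Z. \<forall>w\<in>insert z0 Z.
    kernel_fun k x w * (1 - (\<Sum>l<d. b l x * cnj (b l w))) * kernel_fun k z0 z0
      = kernel_fun k x z0 * kernel_fun k z0 w"
  using assms
proof (induction Z)
  case empty
  show ?case by (rule exI[of _ 0]) simp
next
  case (insert y Z)
  let ?K = "kernel_fun k"
  define k00 where "k00 = (norm (k z0))\<^sup>2"
  have k00: "?K z0 z0 = of_real k00" "k00 > 0"
    using kernel_nonzero by (simp_all add: k00_def kernel_fun_conv cinner_self)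
  have K_sym: "?K w x = cnj (?K x w)" for x w
    unfolding kernel_fun_conv by (rule cinner_commute)
  let ?Z = "insert z0 Z"
  obtain d :: nat and b where b: "\<And>x w. x \<in> ?Z \<Longrightarrow> w \<in> ?Z \<Longrightarrow>
      ?K x w * (1 - (\<Sum>l<d. b l x * cnj (b l w))) * ?K z0 z0 = ?K x z0 * ?K z0 w"
    using insert.IH by blast
  show ?case
  proof (cases "y \<in> ?Z")
    case True
    then have "insert z0 (insert y Z) = ?Z" by blast
    then show ?thesis using b by (intro exI[of _ d] exI[of _ b]) simp
  next
    case False
    have b': "?K x w * (1 - (\<Sum>l<d. b l x * cnj (b l w))) = ?K x z0 / of_real (sqrt k00) * cnj (?K w z0 / of_real (sqrt k00))"
      if "x \<in> ?Z" "w \<in> ?Z" for x w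
    proof -
      have "?K x w * (1 - (\<Sum>l<d. b l x * cnj (b l w))) = ?K x z0 * cnj (?K w z0) / of_real k00"
        using b[OF that] k00 K_sym[of w z0] by (simp add: field_simps)
      then show ?thesis using k00(2) by (simp flip: of_real_mult)
    qed
    have "psd_on ?Z (\<lambda>x w. ?K x w * (1 - (\<Sum>l<d. b l x * cnj (b l w))))"
      by (subst psd_on_cong[OF b']) (simp_all only: psd_on_rank_one)
    then obtain f where f: "\<And>l x. l \<le> d \<Longrightarrow> x \<in> ?Z \<Longrightarrow> f l x = (if l < d then b l x else 0)"
      and fpsd: "\<And>Y. psd_on Y (\<lambda>x w. ?K x w * (1 - (\<Sum>l<Suc d. f l x * cnj (f l w))))"
      using cnp_row_extension[where Z = ?Z and d = d and b = b] insert.hyps(1) by auto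
    let ?Y = "insert y ?Z"
    define M where "M x w = ?K x w * (1 - (\<Sum>l<Suc d. f l x * cnj (f l w)))" for x w
    have psdM: "psd_on ?Y M" using fpsd[of ?Y] by (simp add: M_def[abs_def])
    have fin: "finite ?Y" using insert.hyps by simp
    have M_Z: "M x w * of_real k00 = ?K x z0 * ?K z0 w" if "x \<in> ?Z" "w \<in> ?Z" for x w
    proof -
      have "(\<Sum>l<Suc d. f l x * cnj (f l w)) = (\<Sum>l<d. b l x * cnj (b l w))"
        using f[OF _ that(1)] f[OF _ that(2)] by simp
      then show ?thesis using b[OF that] k00 by (simp add: M_def)
    qed
    have f0: "f l z0 = 0" if "l < Suc d" for l
    proof -
      have "M z0 z0 = ?K z0 z0" using M_Z[of z0 z0] k00 by simp
      then have "(\<Sum>l<Suc d. f l z0 * cnj (f l z0)) = 0"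
        using k00 by (simp add: M_def del: sum.lessThan_Suc)
      then have "complex_of_real (\<Sum>l<Suc d. (cmod (f l z0))\<^sup>2) = 0"
        unfolding mult_cnj_self by (simp only: of_real_sum)
      then have "(\<Sum>l<Suc d. (cmod (f l z0))\<^sup>2) = 0" by (simp only: of_real_eq_0_iff)
      then show ?thesis using that by (subst (asm) sum_nonneg_eq_0_iff) auto
    qed
    have My0: "M y z0 = ?K y z0" by (simp add: M_def f0)
    have My: "M y x * of_real k00 = ?K y z0 * ?K z0 x" if x: "x \<in> ?Z" for x
    proof (cases "x = z0")
      case True
      then show ?thesis using My0 k00 by simp
    next
      case x0: False
      \<comment> \<open>A null vector of the rank-one block; by positivity the row of \<open>y\<close> annihilates it, too.\<close>
      define c where "c w = (if w = x then of_real k00 else if w = z0 then - ?K z0 x else 0)" for w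
      have supp: "(\<Sum>w\<in>?Y. g w * c w) = g x * of_real k00 - g z0 * ?K z0 x" for g
      proof -
        have "(\<Sum>w\<in>?Y. g w * c w) = (\<Sum>w\<in>{x, z0}. g w * c w)"
          using x fin by (intro sum.mono_neutral_right) (auto simp: c_def)
        then show ?thesis using x0 by (simp add: c_def)
      qed
      have rows: "(\<Sum>w\<in>?Y. M v w * c w) = 0" if v: "v \<in> ?Z" for v
      proof -
        have "(M v x * of_real k00 - M v z0 * ?K z0 x) * of_real k00
            = ?K v z0 * ?K z0 x * of_real k00 - ?K v z0 * of_real k00 * ?K z0 x"
          using M_Z[OF v x] M_Z[OF v, of z0] k00 by (simp add: algebra_simps)
        then show ?thesis unfolding supp using k00 by simp
      qed
      have "herm_form ?Y M c c = (\<Sum>v\<in>?Y. cnj (c v) * (\<Sum>w\<in>?Y. M v w * c w))"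
        by (rule herm_form_right_sum)
      also have "\<dots> = 0"
      proof (rule sum.neutral, intro ballI)
        fix v assume "v \<in> ?Y"
        then show "cnj (c v) * (\<Sum>w\<in>?Y. M v w * c w) = 0"
          using rows[of v] False x by (cases "v = y") (auto simp: c_def)
      qed
      finally have "(\<Sum>w\<in>?Y. M y w * c w) = 0"
        using psd_on_null[OF psdM fin, of y c] by simp
      then show ?thesis unfolding supp My0 by simp
    qed
    \<comment> \<open>The square of the new coordinate at \<open>y\<close>.\<close>
    define e where "e = (Re (M y y) - (cmod (?K y z0))\<^sup>2 / k00) / (norm (k y))\<^sup>2"
    have Myy: "M y y = of_real (Re (M y y))" using psd_on_diag[OF psdM fin, of y] by simp
    have Kyy: "?K y y = of_real ((norm (k y))\<^sup>2)" "norm (k y) > 0"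
      using kernel_nonzero by (simp_all add: kernel_fun_conv cinner_self)
    have e: "e \<ge> 0"
    proof -
      have "M z0 z0 = of_real k00" using M_Z[of z0 z0] k00 by simp
      then have "(cmod (?K y z0))\<^sup>2 \<le> Re (M y y) * k00"
        using psd_on_entry_le[OF psdM fin, of y z0] My0 by simp
      then show ?thesis using k00 by (simp add: e_def field_simps)
    qed
    define f' where "f' l x = (if l < Suc d then f l x else if x = y then of_real (sqrt e) else 0)" for l x
    have f'_sum: "(\<Sum>l<Suc (Suc d). f' l x * cnj (f' l w))
        = (\<Sum>l<Suc d. f l x * cnj (f l w)) + (if x = y \<and> w = y then of_real e else 0)" for x w
      using e by (simp add: f'_def flip: of_real_mult)
    have "?K x w * (1 - (\<Sum>l<Suc (Suc d). f' l x * cnj (f' l w))) * ?K z0 z0 = ?K x z0 * ?K z0 w"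
      if xw: "x \<in> ?Y" "w \<in> ?Y" for x w
    proof -
      have off: "?K x w * (1 - (\<Sum>l<Suc (Suc d). f' l x * cnj (f' l w))) = M x w" if "\<not> (x = y \<and> w = y)"
        using that unfolding f'_sum M_def by auto
      consider "x = y" "w = y" | "x \<in> ?Z" "w \<in> ?Z" | "x = y" "w \<in> ?Z" | "x \<in> ?Z" "w = y"
        using xw by blast
      then show ?thesis
      proof cases
        case 1
        have "?K y y * (1 - (\<Sum>l<Suc (Suc d). f' l y * cnj (f' l y))) = M y y - ?K y y * of_real e"
          unfolding f'_sum M_def by (simp add: algebra_simps)
        also have "\<dots> = of_real (Re (M y y) - (norm (k y))\<^sup>2 * e)"
          using Myy unfolding Kyy by (metis of_real_diff of_real_mult)
        also have "\<dots> = of_real ((cmod (?K y z0))\<^sup>2 / k00)" using Kyy(2) by (simp add: e_def)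
        finally show ?thesis
          using k00 unfolding 1 K_sym[of z0 y] mult_cnj_self by simp
      next
        case 2
        then have off': "\<not> (x = y \<and> w = y)" using False by blast
        show ?thesis unfolding off[OF off'] k00(1) by (intro M_Z 2)
      next
        case 3
        then have off': "\<not> (x = y \<and> w = y)" using False by blast
        show ?thesis unfolding off[OF off'] k00(1) unfolding 3(1) by (intro My 3)
      next
        case 4
        have "M x y = cnj (M y x)" using psd_on_hermitian[OF psdM fin, of y x] 4 by simp
        then have "M x y * of_real k00 = cnj (M y x * of_real k00)" by simp
        also have "\<dots> = ?K x z0 * ?K z0 y"
          unfolding My[OF 4(1)] by (simp add: K_sym[of x z0] K_sym[of y z0])
        finally have "M x y * of_real k00 = ?K x z0 * ?K z0 y" .
        moreover have off': "\<not> (x = y \<and> w = y)" using 4 False by blast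
        ultimately show ?thesis unfolding off[OF off'] k00(1) unfolding 4(2) by simp
      qed
    qed
    moreover have "insert z0 (insert y Z) = ?Y" by blast
    ultimately show ?thesis by (intro exI[of _ "Suc (Suc d)"] exI[of _ f']) (simp only:, blast)
  qed
qed

end

section \<open>Factorization through a single vector\<close>

lemma sum_product_zero_slice:
  assumes "\<And>w o'. o' \<noteq> 0 \<Longrightarrow> f (w, o') = 0"
  shows "(\<Sum>i\<in>Z \<times> {..<Suc r}. f i) = (\<Sum>w\<in>Z. f (w, 0 :: nat) :: complex)"
proof -
  have "(\<Sum>i\<in>Z \<times> {..<Suc r}. f i) = (\<Sum>w\<in>Z. \<Sum>o'<Suc r. f (w, o'))"
    by (simp only: sum.cartesian_product')
  also have "\<dots> = (\<Sum>w\<in>Z. f (w, 0))"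
  proof (rule sum.cong[OF refl])
    fix w
    have "(\<Sum>o'<Suc r. f (w, o')) = (\<Sum>o'\<in>{0}. f (w, o'))"
      using assms by (intro sum.mono_neutral_right) auto
    then show "(\<Sum>o'<Suc r. f (w, o')) = f (w, 0)" by simp
  qed
  finally show ?thesis .
qed

context cnp_space
begin

text \<open>
  A factorization \<open>x p = \<Phi> p y\<close> on \<open>Z\<close> through \<open>y = \<Sum> k w \<otimes> a w\<close>, with coefficients \<open>a w\<close> in an
  auxiliary Hilbert space, is recorded by the Gram matrix of these coefficients, at index \<open>(w, 0)\<close>,
  and of the adjoints of the rows \<open>\<Phi> p z\<close>, at index \<open>(z, Suc p)\<close>.  Being such a factorization is then a
  set of linear constraints on a positive semidefinite matrix of fixed size.  The linear form \<open>v\<close>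
  picks out \<open>y z0 = \<Sum> k(z0, w) a w\<close>.  Splitting off the direction of \<open>y z0\<close> and dividing the rest of
  \<open>y\<close> by the row \<open>b\<close>, while multiplying the rest of \<open>\<Phi>\<close> by \<open>b\<close>, is a step in the sense of
  \<open>rank_one_member\<close>.  A Gram matrix of rank one is a factorization through a scalar \<open>y\<close>.
\<close>

lemma finite_factorization:
  fixes x :: "nat \<Rightarrow> 'h" and r :: nat
  assumes Z: "finite Z" and z0: "z0 \<in> Z"
  shows "\<exists>h \<phi>. (norm h)\<^sup>2 \<le> (\<Sum>p<r. (norm (x p))\<^sup>2)
    \<and> (\<forall>z\<in>Z. \<forall>p<r. cinner (x p) (k z) = \<phi> p z * cinner h (k z))
    \<and> contractive_on Z r \<phi>"
proof -
  let ?K = "kernel_fun k"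
  define I where "I = Z \<times> {..<Suc r}"
  have fin: "finite I" using Z by (simp add: I_def)
  have K_sym: "?K w z = cnj (?K z w)" for z w
    unfolding kernel_fun_conv by (rule cinner_commute)
  define k00 where "k00 = (norm (k z0))\<^sup>2"
  have k00: "?K z0 z0 = of_real k00" "k00 > 0"
    using kernel_nonzero by (simp_all add: k00_def kernel_fun_conv cinner_self)
  obtain d :: nat and b where "\<forall>z\<in>insert z0 Z. \<forall>w\<in>insert z0 Z.
      ?K z w * (1 - (\<Sum>l<d. b l z * cnj (b l w))) * ?K z0 z0 = ?K z z0 * ?K z0 w"
    using mccullough_quiggin[OF Z] by blast
  then have b0: "?K z w * (1 - (\<Sum>l<d. b l z * cnj (b l w))) * of_real k00 = ?K z z0 * ?K z0 w"
    if "z \<in> Z" "w \<in> Z" for z w using that unfolding k00(1) by blast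
  define \<beta> where "\<beta> z w = (\<Sum>l<d. b l z * cnj (b l w))" for z w
  have b: "?K z w * (1 - \<beta> z w) = ?K z z0 * ?K z0 w / of_real k00" if "z \<in> Z" "w \<in> Z" for z w
    using b0[OF that] k00 by (simp add: \<beta>_def field_simps)
  define bb where "bb l i = cnj (b l (fst i))" for l and i :: "'x \<times> nat"
  define B where "B i j = (\<Sum>l<d. bb l i * cnj (bb l j))" for i j
  have B: "B i j = \<beta> (fst j) (fst i)" for i j by (simp add: B_def bb_def \<beta>_def mult.commute)
  have psdB: "psd_on I B" unfolding B_def by (rule psd_on_gram_sum)
  have B_diag: "Re (B i i) < 1" if "i \<in> I" for i
  proof -
    let ?z = "fst i"
    have z: "?z \<in> Z" using that by (auto simp: I_def)
    have "?K ?z z0 \<noteq> 0"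
    proof (cases "?z = z0")
      case False
      then show ?thesis using irreducible unfolding irreducible_kernel_def kernel_fun_conv by metis
    qed (use k00 in simp)
    have "of_real ((norm (k ?z))\<^sup>2) * (1 - B i i) = of_real ((cmod (?K ?z z0))\<^sup>2) / of_real k00"
      using b[OF z z] unfolding B K_sym[of z0 ?z] mult_cnj_self
      by (simp add: kernel_fun_conv cinner_self)
    then have "of_real ((norm (k ?z))\<^sup>2 * (1 - Re (B i i))) = complex_of_real ((cmod (?K ?z z0))\<^sup>2 / k00)"
      using psd_on_diag(1)[OF psdB fin that] by (metis of_real_1 of_real_diff of_real_divide of_real_mult)
    then have "(norm (k ?z))\<^sup>2 * (1 - Re (B i i)) = (cmod (?K ?z z0))\<^sup>2 / k00"
      by (simp only: of_real_eq_iff)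
    moreover have "(cmod (?K ?z z0))\<^sup>2 / k00 > 0" using \<open>?K ?z z0 \<noteq> 0\<close> k00 by simp
    ultimately show ?thesis by (metis diff_gt_0_iff_gt zero_less_mult_pos zero_less_power2 kernel_nonzero norm_eq_zero)
  qed
  have B_less: "cmod (B i j) < 1" if "i \<in> I" "j \<in> I" for i j
  proof -
    have "(cmod (B i j))\<^sup>2 \<le> Re (B i i) * Re (B j j)"
      using psd_on_entry_le[OF psdB fin that] .
    also have "\<dots> \<le> Re (B i i) * 1"
      using B_diag[OF that(2)] psd_on_diag(2)[OF psdB fin] that by (intro mult_left_mono) auto
    also have "\<dots> < 1\<^sup>2" using B_diag[OF that(1)] by simp
    finally show ?thesis by (rule power_less_imp_less_base) simp
  qed
  define X where "X p z = cinner (x p) (k z)" for p z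
  have "\<exists>c. (\<forall>z\<in>Z. cinner (kernel_sum k Z c) (k z) = X p z) \<and> norm (kernel_sum k Z c) \<le> norm (x p)" for p
    unfolding X_def by (rule kernel_projection[OF Z])
  then obtain c where c: "\<And>p z. z \<in> Z \<Longrightarrow> cinner (kernel_sum k Z (c p)) (k z) = X p z"
    and c_norm: "\<And>p. norm (kernel_sum k Z (c p)) \<le> norm (x p)" by metis
  define N where "N = (\<Sum>p<r. (norm (kernel_sum k Z (c p)))\<^sup>2)"
  define g0 where "g0 p i = (if snd i = 0 then c p (fst i) else if snd i = Suc p then 1 else 0)"
    for p and i :: "'x \<times> nat"
  \<comment> \<open>The trivial factorization: \<open>y\<close> is the tuple of the \<open>x p\<close>, and \<open>\<Phi>\<close> is the identity.\<close>
  define \<Gamma>0 where "\<Gamma>0 = (\<lambda>(i, j). if i \<in> I \<and> j \<in> I then \<Sum>p<r. g0 p i * cnj (g0 p j) else 0)"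
  define D where "D i = Re (\<Gamma>0 (i, i))" for i
  define v where "v i = (if snd i = 0 then ?K (fst i) z0 else 0)" for i :: "'x \<times> nat"
  define R where "R \<Gamma> = (\<lambda>(z, p) (w, q). ?K z w * ((if p = q then 1 else 0) - \<Gamma> ((w, Suc q), (z, Suc p))))"
    for \<Gamma> :: "('x \<times> nat) \<times> ('x \<times> nat) \<Rightarrow> complex"
  \<comment> \<open>The last three constraints say that \<open>\<Phi> y = x\<close>, that \<open>\<parallel>y\<parallel>\<^sup>2 = N\<close>, and that \<open>\<Phi>\<close> is contractive.
    The diagonal is bounded because steps cannot increase it; this makes the set compact.\<close>
  define \<C> where "\<C> = {\<Gamma>. \<forall>q\<in>- (I \<times> I). \<Gamma> q = 0}
    \<inter> {\<Gamma>. psd_on I (curry \<Gamma>)} \<inter> {\<Gamma>. \<forall>i\<in>I. Re (\<Gamma> (i, i)) \<le> D i}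
    \<inter> {\<Gamma>. \<forall>z\<in>Z. \<forall>p\<in>{..<r}. (\<Sum>w\<in>Z. ?K z w * \<Gamma> ((w, 0), (z, Suc p))) = X p z}
    \<inter> {\<Gamma>. (\<Sum>w\<in>Z. \<Sum>w'\<in>Z. \<Gamma> ((w, 0), (w', 0)) * ?K w' w) = of_real N}
    \<inter> {\<Gamma>. psd_on (Z \<times> {..<r}) (R \<Gamma>)}"
  have "\<exists>\<Gamma>\<in>\<C>. \<exists>g. \<forall>i\<in>I. \<forall>j\<in>I. \<Gamma> (i, j) = g i * cnj (g j)"
  proof (rule rank_one_member[OF fin, where v = v and p = bb and d = d and b = "\<lambda>(i, j). sqrt \<bar>D i * D j\<bar>", folded B_def])
    have cont: "continuous_on UNIV (\<lambda>\<Gamma> :: ('x \<times> nat) \<times> ('x \<times> nat) \<Rightarrow> complex. \<Gamma> q)" for q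
      by simp
    show "closed \<C>"
      unfolding \<C>_def
    proof (intro closed_Int)
      show "closed {\<Gamma>. psd_on (Z \<times> {..<r}) (R \<Gamma>)}"
        by (rule closed_psd) (auto simp: R_def intro!: continuous_intros)
      show "closed {\<Gamma>. psd_on I (curry \<Gamma>)}"
        by (rule closed_psd) (auto simp: curry_def)
      show "closed {\<Gamma>. \<forall>i\<in>I. Re (\<Gamma> (i, i)) \<le> D i}"
        by (intro closed_Collect_Ball closed_Collect_le continuous_intros) auto
      show "closed {\<Gamma> :: _ \<Rightarrow> complex. \<forall>q\<in>- (I \<times> I). \<Gamma> q = 0}"
        by (intro closed_Collect_Ball closed_Collect_eq continuous_intros) auto
      show "closed {\<Gamma>. \<forall>z\<in>Z. \<forall>p\<in>{..<r}. (\<Sum>w\<in>Z. ?K z w * \<Gamma> ((w, 0), (z, Suc p))) = X p z}"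
        by (intro closed_Collect_Ball closed_Collect_eq continuous_intros) auto
      show "closed {\<Gamma>. (\<Sum>w\<in>Z. \<Sum>w'\<in>Z. \<Gamma> ((w, 0), (w', 0)) * ?K w' w) = of_real N}"
        by (intro closed_Collect_eq continuous_intros) auto
    qed
  next
    fix \<Gamma> assume \<Gamma>: "\<Gamma> \<in> \<C>"
    have supp: "\<Gamma> (i, j) = 0" if "\<not> (i \<in> I \<and> j \<in> I)" for i j using \<Gamma> that unfolding \<C>_def by auto
    have psd: "psd_on I (curry \<Gamma>)" using \<Gamma> unfolding \<C>_def by blast
    have diag: "Re (\<Gamma> (i, i)) \<le> D i" if "i \<in> I" for i using \<Gamma> that unfolding \<C>_def by blast
    have row: "(\<Sum>w\<in>Z. ?K z w * \<Gamma> ((w, 0), (z, Suc p))) = X p z" if "z \<in> Z" "p < r" for z p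
      using \<Gamma> that unfolding \<C>_def by blast
    have nrm: "(\<Sum>w\<in>Z. \<Sum>w'\<in>Z. \<Gamma> ((w, 0), (w', 0)) * ?K w' w) = of_real N"
      using \<Gamma> unfolding \<C>_def by blast
    have psdR: "psd_on (Z \<times> {..<r}) (R \<Gamma>)" using \<Gamma> unfolding \<C>_def by blast
    show "psd_on I (curry \<Gamma>)" by (rule psd)
    show "\<Gamma> (i, j) = 0" if "\<not> (i \<in> I \<and> j \<in> I)" for i j by (rule supp[OF that])
    show "cmod (\<Gamma> q) \<le> (case q of (i, j) \<Rightarrow> sqrt \<bar>D i * D j\<bar>)" for q
    proof -
      obtain i j where Pair: "q = (i, j)" by (rule prod.exhaust)
      show ?thesis
      proof (cases "i \<in> I \<and> j \<in> I")
        case True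
        then have ij: "i \<in> I" "j \<in> I" by auto
        have "(cmod (\<Gamma> (i, j)))\<^sup>2 \<le> Re (\<Gamma> (i, i)) * Re (\<Gamma> (j, j))"
          using psd_on_entry_le[OF psd fin ij] by simp
        also have "\<dots> \<le> D i * D j"
          using diag[OF ij(1)] diag[OF ij(2)] psd_on_diag(2)[OF psd fin ij(1)] psd_on_diag(2)[OF psd fin ij(2)]
          by (intro mult_mono) auto
        finally show ?thesis unfolding Pair prod.case by (intro real_le_rsqrt) linarith
      qed (simp add: Pair supp)
    qed
    define U where "U = compress_at I v \<Gamma>"
    define \<Delta> where "\<Delta> i j = \<Gamma> (i, j) - U i j" for i j
    define \<Gamma>' where "\<Gamma>' = (\<lambda>(i, j). if i \<in> I \<and> j \<in> I then U i j + \<Delta> i j * B i j else 0)"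
    have psdU: "psd_on I U" unfolding U_def by (rule psd_on_compress_at[OF fin psd])
    have psd\<Delta>: "psd_on I \<Delta>" unfolding \<Delta>_def U_def by (rule psd_on_diff_compress_at[OF fin psd])
    have \<Delta>v: "(\<Sum>w\<in>Z. ?K z0 w * \<Delta> (w, 0) j) = 0" if j: "j \<in> I" for j
    proof -
      have "(\<Sum>i\<in>I. \<Delta> j i * v i) = 0"
        using compress_at_apply[OF fin psd j, of v]
        by (simp add: \<Delta>_def U_def left_diff_distrib sum_subtractf)
      moreover have "(\<Sum>i\<in>I. \<Delta> j i * v i) = (\<Sum>w\<in>Z. \<Delta> j (w, 0) * v (w, 0))"
        unfolding I_def by (rule sum_product_zero_slice) (simp add: v_def)
      ultimately have "cnj (\<Sum>w\<in>Z. \<Delta> j (w, 0) * v (w, 0)) = 0" by simp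
      moreover have "cnj (\<Sum>w\<in>Z. \<Delta> j (w, 0) * v (w, 0)) = (\<Sum>w\<in>Z. ?K z0 w * \<Delta> (w, 0) j)"
        unfolding cnj_sum
      proof (rule sum.cong[OF refl])
        fix w assume "w \<in> Z"
        then have "(w, 0) \<in> I" by (simp add: I_def)
        from psd_on_hermitian[OF psd\<Delta> fin j this]
        show "cnj (\<Delta> j (w, 0) * v (w, 0)) = ?K z0 w * \<Delta> (w, 0) j"
          by (simp add: v_def K_sym[of z0 w])
      qed
      ultimately show ?thesis by simp
    qed
    have zero: "(\<Sum>w\<in>Z. ?K z w * (1 - \<beta> z w) * \<Delta> (w, 0) j) = 0" if "z \<in> Z" "j \<in> I" for z j
    proof -
      have "(\<Sum>w\<in>Z. ?K z w * (1 - \<beta> z w) * \<Delta> (w, 0) j)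
          = (\<Sum>w\<in>Z. (?K z z0 / of_real k00) * (?K z0 w * \<Delta> (w, 0) j))"
        using that by (intro sum.cong refl) (simp add: b)
      also have "\<dots> = (?K z z0 / of_real k00) * (\<Sum>w\<in>Z. ?K z0 w * \<Delta> (w, 0) j)"
        by (rule sum_distrib_left[symmetric])
      finally show ?thesis unfolding \<Delta>v[OF that(2)] by simp
    qed
    \<comment> \<open>In each constraint the change caused by a step is the sum in \<open>zero\<close> or a rescaling of \<open>\<Delta>\<close>,
      because \<open>k (1 - \<beta>)\<close> has rank one.\<close>
    have \<Gamma>': "\<Gamma>' ((w, o'), (z, q)) = \<Gamma> ((w, o'), (z, q)) - (1 - \<beta> z w) * \<Delta> (w, o') (z, q)"
      if "w \<in> Z" "z \<in> Z" "o' \<le> r" "q \<le> r" for w o' z q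
      using that by (simp add: \<Gamma>'_def I_def B \<Delta>_def algebra_simps)
    have "\<Gamma>' \<in> \<C>"
      unfolding \<C>_def
    proof (intro IntI CollectI ballI allI impI)
      show "\<Gamma>' q = 0" if "q \<in> - (I \<times> I)" for q using that by (auto simp: \<Gamma>'_def split: prod.split)
    next
      have "psd_on I (\<lambda>i j. U i j + \<Delta> i j * B i j)"
        unfolding B_def by (intro psd_on_add psdU psd_on_schur psd\<Delta>)
      then show "psd_on I (curry \<Gamma>')" by (subst psd_on_cong[where B = "\<lambda>i j. U i j + \<Delta> i j * B i j"]) (auto simp: \<Gamma>'_def)
    next
      fix i assume i: "i \<in> I"
      note B_real = psd_on_diag[OF psdB fin i] and \<Delta>_real = psd_on_diag[OF psd\<Delta> fin i]
      have "Re (\<Delta> i i * B i i) = Re (\<Delta> i i) * Re (B i i)"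
        using B_real(1) \<Delta>_real(1) by (metis Re_complex_of_real of_real_mult)
      also have "\<dots> \<le> Re (\<Delta> i i) * 1"
        using B_diag[OF i] \<Delta>_real(2) by (intro mult_left_mono) auto
      finally have "Re (\<Gamma>' (i, i)) \<le> Re (\<Gamma> (i, i))" using i by (simp add: \<Gamma>'_def \<Delta>_def)
      then show "Re (\<Gamma>' (i, i)) \<le> D i" using diag[OF i] by linarith
    next
      fix z p assume z: "z \<in> Z" and p: "p \<in> {..<r}"
      then have j: "(z, Suc p) \<in> I" by (simp add: I_def)
      have "(\<Sum>w\<in>Z. ?K z w * \<Gamma>' ((w, 0), (z, Suc p))) = (\<Sum>w\<in>Z. ?K z w * \<Gamma> ((w, 0), (z, Suc p)))
          - (\<Sum>w\<in>Z. ?K z w * (1 - \<beta> z w) * \<Delta> (w, 0) (z, Suc p))"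
        unfolding sum_subtractf[symmetric] using z p
        by (intro sum.cong refl) (simp add: \<Gamma>' algebra_simps)
      then show "(\<Sum>w\<in>Z. ?K z w * \<Gamma>' ((w, 0), (z, Suc p))) = X p z"
        using zero[OF z j] row z p by simp
    next
      have "(\<Sum>w\<in>Z. \<Sum>w'\<in>Z. \<Gamma>' ((w, 0), (w', 0)) * ?K w' w)
          = (\<Sum>w\<in>Z. \<Sum>w'\<in>Z. \<Gamma> ((w, 0), (w', 0)) * ?K w' w)
          - (\<Sum>w\<in>Z. \<Sum>w'\<in>Z. ?K w' w * (1 - \<beta> w' w) * \<Delta> (w, 0) (w', 0))"
        unfolding sum_subtractf[symmetric]
        by (intro sum.cong refl) (simp add: \<Gamma>' algebra_simps)
      also have "(\<Sum>w\<in>Z. \<Sum>w'\<in>Z. ?K w' w * (1 - \<beta> w' w) * \<Delta> (w, 0) (w', 0)) = 0"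
        by (subst sum.swap) (simp add: zero I_def)
      finally show "(\<Sum>w\<in>Z. \<Sum>w'\<in>Z. \<Gamma>' ((w, 0), (w', 0)) * ?K w' w) = of_real N"
        using nrm by simp
    next
      let ?f = "\<lambda>(z, p). (z, Suc p)"
      let ?s = "\<lambda>(z, p :: nat). ?K z z0 / of_real (sqrt k00)"
      have f: "inj_on ?f (Z \<times> {..<r})" "?f ` (Z \<times> {..<r}) \<subseteq> I" by (auto simp: inj_on_def I_def)
      have "psd_on (Z \<times> {..<r}) (\<lambda>i j. ?s i * \<Delta> (?f j) (?f i) * cnj (?s j))"
        by (rule psd_on_scale, rule psd_on_reindex[OF psd_on_transpose[OF psd\<Delta>] fin f])
      from psd_on_add[OF psdR this]
      show "psd_on (Z \<times> {..<r}) (R \<Gamma>')"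
      proof (rule iffD2[OF psd_on_cong, rotated])
        fix i j assume "i \<in> Z \<times> {..<r}" "j \<in> Z \<times> {..<r}"
        then obtain z p w q where ij: "i = (z, p)" "j = (w, q)" "z \<in> Z" "w \<in> Z" "p < r" "q < r" by auto
        have eq: "?K z z0 / of_real (sqrt k00) * cnj (?K w z0 / of_real (sqrt k00)) = ?K z w * (1 - \<beta> z w)"
          unfolding b[OF ij(3,4)] K_sym[of z0 w] using k00(2) by (simp flip: of_real_mult)
        have s: "?K z z0 / of_real (sqrt k00) * \<Delta> (w, Suc q) (z, Suc p) * cnj (?K w z0 / of_real (sqrt k00))
            = ?K z w * (1 - \<beta> z w) * \<Delta> (w, Suc q) (z, Suc p)"
          unfolding eq[symmetric] by (simp only: mult_ac)
        show "R \<Gamma>' i j = R \<Gamma> i j + ?s i * \<Delta> (?f j) (?f i) * cnj (?s j)"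
          using ij unfolding R_def ij(1,2) prod.case s by (simp add: \<Gamma>' algebra_simps)
      qed
    qed
    then show "(\<lambda>(i, j). if i \<in> I \<and> j \<in> I then compress_at I v \<Gamma> i j
        + (\<Gamma> (i, j) - compress_at I v \<Gamma> i j) * B i j else 0) \<in> \<C>"
      unfolding \<Gamma>'_def \<Delta>_def U_def .
  next
    have g00: "g0 p (w, 0) = c p w" "g0 p (w, Suc q) = (if q = p then 1 else 0)" for p q w
      by (auto simp: g0_def)
    have \<Gamma>0: "\<Gamma>0 (i, j) = (\<Sum>p<r. g0 p i * cnj (g0 p j))" if "i \<in> I" "j \<in> I" for i j
      using that by (simp add: \<Gamma>0_def)
    have mem: "(w, 0) \<in> I" "p < r \<Longrightarrow> (w, Suc p) \<in> I" if "w \<in> Z" for w p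
      using that by (auto simp: I_def)
    have "\<Gamma>0 \<in> \<C>"
      unfolding \<C>_def
    proof (intro IntI CollectI ballI allI impI)
      show "\<Gamma>0 q = 0" if "q \<in> - (I \<times> I)" for q using that by (auto simp: \<Gamma>0_def split: prod.split)
      show "psd_on I (curry \<Gamma>0)"
        by (subst psd_on_cong[where B = "\<lambda>i j. \<Sum>p<r. g0 p i * cnj (g0 p j)"]) (simp_all add: \<Gamma>0 psd_on_gram_sum)
      show "Re (\<Gamma>0 (i, i)) \<le> D i" for i by (simp add: D_def)
    next
      fix z p assume z: "z \<in> Z" and p: "p \<in> {..<r}"
      have "(\<Sum>w\<in>Z. ?K z w * \<Gamma>0 ((w, 0), (z, Suc p))) = (\<Sum>w\<in>Z. c p w * ?K z w)"
        using z p by (intro sum.cong refl) (simp add: \<Gamma>0 mem g00 if_distrib[of cnj] if_distrib[of "\<lambda>a. _ * a"] mult.commute cong: if_cong)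
      also have "\<dots> = cinner (kernel_sum k Z (c p)) (k z)"
        by (simp add: kernel_sum_def cinner_sum_left cinner_scaleC_left kernel_fun_conv)
      finally show "(\<Sum>w\<in>Z. ?K z w * \<Gamma>0 ((w, 0), (z, Suc p))) = X p z" using c[OF z] by simp
    next
      have "(\<Sum>w\<in>Z. \<Sum>w'\<in>Z. \<Gamma>0 ((w, 0), (w', 0)) * ?K w' w)
          = (\<Sum>w\<in>Z. \<Sum>w'\<in>Z. \<Sum>p<r. c p w * cnj (c p w') * ?K w' w)"
        by (intro sum.cong refl) (simp add: \<Gamma>0 mem g00 sum_distrib_right)
      also have "\<dots> = (\<Sum>p<r. \<Sum>w\<in>Z. \<Sum>w'\<in>Z. c p w * cnj (c p w') * ?K w' w)"
        by (subst sum.swap[of _ Z "{..<r}"], subst sum.swap[of _ Z "{..<r}"], rule refl)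
      also have "\<dots> = (\<Sum>p<r. cinner (kernel_sum k Z (c p)) (kernel_sum k Z (c p)))"
        unfolding cinner_kernel_sums kernel_fun_conv ..
      finally show "(\<Sum>w\<in>Z. \<Sum>w'\<in>Z. \<Gamma>0 ((w, 0), (w', 0)) * ?K w' w) = of_real N"
        by (simp add: N_def cinner_self)
    next
      have R0: "R \<Gamma>0 i j = 0" if ij0: "i \<in> Z \<times> {..<r}" "j \<in> Z \<times> {..<r}" for i j
      proof -
        obtain z p w q where ij: "i = (z, p)" "j = (w, q)" "z \<in> Z" "w \<in> Z" "p < r" "q < r" using ij0 by auto
        have "\<Gamma>0 ((w, Suc q), (z, Suc p)) = (if p = q then 1 else 0)"
          using ij by (simp add: \<Gamma>0 mem g00 if_distrib[of cnj] if_distrib[of "\<lambda>a. _ * a"] cong: if_cong)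
        then show ?thesis by (simp add: R_def ij)
      qed
      show "psd_on (Z \<times> {..<r}) (R \<Gamma>0)"
        by (subst psd_on_cong[OF R0]) (simp_all add: psd_on_def)
    qed
    then show "\<C> \<noteq> {}" by blast
  qed (rule B_less)
  then obtain \<Gamma> g where \<Gamma>: "\<Gamma> \<in> \<C>" and g: "\<And>i j. i \<in> I \<Longrightarrow> j \<in> I \<Longrightarrow> \<Gamma> (i, j) = g i * cnj (g j)" by blast
  have mem: "(w, 0) \<in> I" "p < r \<Longrightarrow> (w, Suc p) \<in> I" if "w \<in> Z" for w p
    using that by (auto simp: I_def)
  define h where "h = kernel_sum k Z (\<lambda>w. g (w, 0))"
  define \<phi> where "\<phi> p z = cnj (g (z, Suc p))" for p z
  have hz: "cinner h (k z) = (\<Sum>w\<in>Z. ?K z w * g (w, 0))" for z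
    by (simp add: h_def kernel_sum_def cinner_sum_left cinner_scaleC_left kernel_fun_conv mult.commute)
  have "cinner h h = (\<Sum>w\<in>Z. \<Sum>w'\<in>Z. \<Gamma> ((w, 0), (w', 0)) * ?K w' w)"
    unfolding h_def cinner_kernel_sums kernel_fun_conv
    by (intro sum.cong refl) (simp add: g mem)
  also have "\<dots> = of_real N" using \<Gamma> unfolding \<C>_def by blast
  finally have "(norm h)\<^sup>2 = N" unfolding cinner_self of_real_eq_iff .
  also have "N \<le> (\<Sum>p<r. (norm (x p))\<^sup>2)"
    unfolding N_def by (intro sum_mono power_mono c_norm) simp
  finally have "(norm h)\<^sup>2 \<le> (\<Sum>p<r. (norm (x p))\<^sup>2)" .
  moreover have "cinner (x p) (k z) = \<phi> p z * cinner h (k z)" if "z \<in> Z" "p < r" for z p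
  proof -
    have "X p z = (\<Sum>w\<in>Z. ?K z w * \<Gamma> ((w, 0), (z, Suc p)))"
      using \<Gamma> that unfolding \<C>_def by auto
    also have "\<dots> = (\<Sum>w\<in>Z. \<phi> p z * (?K z w * g (w, 0)))"
      using that by (intro sum.cong refl) (simp add: g mem \<phi>_def mult_ac)
    finally show ?thesis unfolding X_def hz by (simp only: sum_distrib_left)
  qed
  moreover have "contractive_on Z r \<phi>"
  proof -
    have "psd_on (Z \<times> {..<r}) (R \<Gamma>)" using \<Gamma> unfolding \<C>_def by blast
    then show ?thesis unfolding contractive_on_def
      by (rule iffD1[OF psd_on_cong, rotated]) (auto simp: R_def g mem \<phi>_def mult.commute)
  qed
  ultimately show ?thesis by blast
qed

text \<open>
  The conditions on \<open>h\<close> and \<open>\<phi>\<close> each involve finitely many points and indices, and pass to limits in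
  the product topology; so the finite factorizations have a limit.  A candidate is encoded as one
  function, with the values of \<open>h\<close> at \<open>(0, z)\<close> and those of \<open>\<phi> n\<close> at \<open>(Suc n, z)\<close>.
\<close>

theorem factorization:
  fixes x :: "nat \<Rightarrow> 'h"
  assumes summable: "summable (\<lambda>n. (norm (x n))\<^sup>2)"
  shows "\<exists>h \<phi>. (norm h)\<^sup>2 \<le> (\<Sum>n. (norm (x n))\<^sup>2)
    \<and> (\<forall>n z. cinner (x n) (k z) = \<phi> n z * cinner h (k z))
    \<and> (\<forall>Z r. finite Z \<longrightarrow> contractive_on Z r \<phi>)"
proof -
  define C where "C = sqrt (\<Sum>n. (norm (x n))\<^sup>2)"
  have S0: "0 \<le> (\<Sum>n. (norm (x n))\<^sup>2)" by (rule suminf_nonneg[OF summable]) simp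
  then have C0: "C \<ge> 0" and C2: "C\<^sup>2 = (\<Sum>n. (norm (x n))\<^sup>2)" by (simp_all add: C_def)
  define R where "R f = (\<lambda>(z, p) (w, q). kernel_fun k z w * ((if p = q then 1 else 0) - f (Suc p, z) * cnj (f (Suc q, w))))"
    for f :: "nat \<times> 'x \<Rightarrow> complex"
  define T where "T Z r = {f. \<forall>z\<in>Z. \<forall>n\<in>{..<r}. cinner (x n) (k z) = f (Suc n, z) * f (0, z)}
      \<inter> {f. \<forall>c\<in>UNIV. cmod (\<Sum>z\<in>Z. cnj (c z) * f (0, z)) \<le> C * norm (kernel_sum k Z c)}
      \<inter> {f. psd_on (Z \<times> {..<r}) (R f)}" for Z r
  define \<F> where "\<F> = (\<lambda>(Z, r). T Z r) ` {(Z, r). finite Z}"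
  define bd where "bd = (\<lambda>(n, z). if n = (0::nat) then C * norm (k z) else 1)"
  have "\<exists>f. (\<forall>i. cmod (f i) \<le> bd i) \<and> (\<forall>T\<in>\<F>. f \<in> T)"
  proof (rule box_fip)
    fix T' assume "T' \<in> \<F>"
    then obtain Z r where T': "T' = T Z r" by (auto simp: \<F>_def)
    show "closed T'"
      unfolding T' T_def
    proof (intro closed_Int)
      show "closed {f. psd_on (Z \<times> {..<r}) (R f)}"
        by (rule closed_psd) (auto simp: R_def intro!: continuous_intros)
      show "closed {f. \<forall>z\<in>Z. \<forall>n\<in>{..<r}. cinner (x n) (k z) = f (Suc n, z) * f (0, z)}"
        by (intro closed_Collect_Ball closed_Collect_eq continuous_intros) auto
      show "closed {f. \<forall>c\<in>UNIV. cmod (\<Sum>z\<in>Z. cnj (c z) * f (0, z)) \<le> C * norm (kernel_sum k Z c)}"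
        by (intro closed_Collect_Ball closed_Collect_le continuous_intros) auto
    qed
  next
    fix \<G> assume "finite \<G>" "\<G> \<subseteq> \<F>"
    then obtain P where P: "finite P" "P \<subseteq> {(Z, r). finite Z}" and \<G>: "\<G> = (\<lambda>(Z, r). T Z r) ` P"
      unfolding \<F>_def using finite_subset_image by meson
    define z0 :: 'x where "z0 = undefined"
    define Y where "Y = insert z0 (\<Union>(fst ` P))"
    define r where "r = (\<Sum>q\<in>P. snd q)"
    have Y: "finite Y" "z0 \<in> Y" using P by (auto simp: Y_def)
    obtain h \<phi> where h: "(norm h)\<^sup>2 \<le> (\<Sum>p<r. (norm (x p))\<^sup>2)"
      and fac0: "\<forall>z\<in>Y. \<forall>p<r. cinner (x p) (k z) = \<phi> p z * cinner h (k z)"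
      and psd: "contractive_on Y r \<phi>"
      using finite_factorization[OF Y, where r = r and x = x] by (elim exE conjE) (rule that)
    have fac: "cinner (x p) (k z) = \<phi> p z * cinner h (k z)" if "z \<in> Y" "p < r" for z p
      using fac0 that by simp
    have hC: "norm h \<le> C"
    proof -
      have "(\<Sum>p<r. (norm (x p))\<^sup>2) \<le> (\<Sum>n. (norm (x n))\<^sup>2)"
        by (rule sum_le_suminf[OF summable]) auto
      with h have "(norm h)\<^sup>2 \<le> C\<^sup>2" unfolding C2 by (rule order_trans)
      then show ?thesis by (rule power2_le_imp_le[OF _ C0])
    qed
    define f where "f = (\<lambda>(n, z). case n of 0 \<Rightarrow> cinner h (k z)
        | Suc p \<Rightarrow> if z \<in> Y \<and> p < r then \<phi> p z else 0)"
    have \<phi>1: "cmod (\<phi> p z) \<le> 1" if "z \<in> Y" "p < r" for z p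
    proof -
      have zp: "(z, p) \<in> Y \<times> {..<r}" using that by simp
      have fin: "finite (Y \<times> {..<r})" using Y by simp
      have "0 \<le> Re (kernel_fun k z z * (1 - \<phi> p z * cnj (\<phi> p z)))"
        using psd_on_diag(2)[OF psd[unfolded contractive_on_def] fin zp] by simp
      also have "\<dots> = (norm (k z))\<^sup>2 * (1 - (cmod (\<phi> p z))\<^sup>2)"
        unfolding kernel_fun_conv cinner_self mult_cnj_self
        by (metis Re_complex_of_real of_real_1 of_real_diff of_real_mult)
      finally have "(cmod (\<phi> p z))\<^sup>2 \<le> 1\<^sup>2"
        using kernel_nonzero[of z] by (simp add: zero_le_mult_iff)
      then show ?thesis by (rule power2_le_imp_le) simp
    qed
    show "\<exists>f. (\<forall>i. cmod (f i) \<le> bd i) \<and> (\<forall>T\<in>\<G>. f \<in> T)"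
    proof (intro exI[of _ f] conjI allI ballI)
      fix i :: "nat \<times> 'x"
      obtain n z where i: "i = (n, z)" by (rule prod.exhaust)
      have "cmod (cinner h (k z)) \<le> C * norm (k z)"
        by (rule order_trans[OF cmod_cinner_le mult_right_mono[OF hC norm_ge_zero]])
      then show "cmod (f i) \<le> bd i"
        using \<phi>1 by (cases n) (auto simp: i f_def bd_def)
    next
      fix T' assume "T' \<in> \<G>"
      then obtain Z r' where P': "(Z, r') \<in> P" and T': "T' = T Z r'" by (auto simp: \<G>)
      have ZY: "Z \<subseteq> Y" using P' by (force simp: Y_def)
      have "snd (Z, r') \<le> r" unfolding r_def by (rule member_le_sum[OF P' _ P(1)]) simp
      then have r': "r' \<le> r" by simp
      show "f \<in> T'"
        unfolding T' T_def
      proof (intro IntI CollectI ballI)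
        show "cinner (x n) (k z) = f (Suc n, z) * f (0, z)" if "z \<in> Z" "n \<in> {..<r'}" for z n
          using that fac[of z n] ZY r' by (auto simp: f_def)
      next
        fix c
        have "(\<Sum>z\<in>Z. cnj (c z) * f (0, z)) = cinner h (kernel_sum k Z c)"
          by (simp add: f_def cinner_kernel_sum)
        then show "cmod (\<Sum>z\<in>Z. cnj (c z) * f (0, z)) \<le> C * norm (kernel_sum k Z c)"
          by (simp only:) (rule order_trans[OF cmod_cinner_le mult_right_mono[OF hC norm_ge_zero]])
      next
        have "psd_on (Z \<times> {..<r'}) (\<lambda>(z, p) (w, q).
            kernel_fun k z w * ((if p = q then 1 else 0) - \<phi> p z * cnj (\<phi> q w)))"
          by (rule psd_on_subset[OF psd[unfolded contractive_on_def]]) (use Y ZY r' in auto)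
        then show "psd_on (Z \<times> {..<r'}) (R f)"
        proof (rule iffD1[OF psd_on_cong, rotated])
          fix i j assume "i \<in> Z \<times> {..<r'}" "j \<in> Z \<times> {..<r'}"
          then obtain z p w q where ij: "i = (z, p)" "j = (w, q)" "z \<in> Z" "w \<in> Z" "p < r'" "q < r'"
            by auto
          then have "z \<in> Y" "w \<in> Y" "p < r" "q < r" using ZY r' by auto
          with ij show "(case i of (z, p) \<Rightarrow> \<lambda>(w, q).
              kernel_fun k z w * ((if p = q then 1 else 0) - \<phi> p z * cnj (\<phi> q w))) j = R f i j"
            by (simp add: R_def f_def)
        qed
      qed
    qed
  qed
  then obtain f where "\<forall>T\<in>\<F>. f \<in> T" by (elim exE conjE) (rule that)
  then have f: "f \<in> T Z r" if "finite Z" for Z r using that unfolding \<F>_def by auto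
  have "\<exists>h. norm h \<le> C \<and> (\<forall>z. cinner h (k z) = f (0, z))"
  proof (rule rkhs_member[OF C0])
    fix Z c assume "finite (Z :: 'x set)"
    from f[OF this, of 0] show "cmod (\<Sum>z\<in>Z. cnj (c z) * f (0, z)) \<le> C * norm (kernel_sum k Z c)"
      unfolding T_def by blast
  qed
  then obtain h where h: "norm h \<le> C" "\<And>z. cinner h (k z) = f (0, z)" by blast
  have "(norm h)\<^sup>2 \<le> (\<Sum>n. (norm (x n))\<^sup>2)"
    using h(1) unfolding C2[symmetric] by (simp add: power_mono)
  moreover have "cinner (x n) (k z) = f (Suc n, z) * cinner h (k z)" for n z
    using f[of "{z}" "Suc n"] unfolding h(2) T_def by auto
  moreover have "contractive_on Z r (\<lambda>n z. f (Suc n, z))" if "finite Z" for Z r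
    using f[OF that, of r] unfolding T_def R_def contractive_on_def by blast
  ultimately show ?thesis by (intro exI[of _ h] exI[of _ "\<lambda>n z. f (Suc n, z)"]) blast
qed

definition dominates :: "'h \<Rightarrow> (nat \<Rightarrow> 'h) \<Rightarrow> bool" where
  "dominates h x \<longleftrightarrow> (\<forall>t T r. multiplies k t T \<longrightarrow> (\<Sum>n<r. (norm (T (x n)))\<^sup>2) \<le> (norm (T h))\<^sup>2)"

lemma dominatesD:
  assumes "dominates h x" "multiplies k t T"
  shows "(\<Sum>n<r. (norm (T (x n)))\<^sup>2) \<le> (norm (T h))\<^sup>2"
  using assms unfolding dominates_def by simp

text \<open>
  Multiplication operators commute with the contractive column of the factorization.
\<close>

lemma domination:
  fixes x :: "nat \<Rightarrow> 'h"
  assumes "summable (\<lambda>n. (norm (x n))\<^sup>2)"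
  shows "\<exists>h. (norm h)\<^sup>2 \<le> (\<Sum>n. (norm (x n))\<^sup>2)
    \<and> (\<forall>n z. cinner (x n) (k z) \<noteq> 0 \<longrightarrow> cinner h (k z) \<noteq> 0) \<and> dominates h x"
proof -
  obtain h \<phi> where h: "(norm h)\<^sup>2 \<le> (\<Sum>n. (norm (x n))\<^sup>2)"
    and fac: "\<And>n z. cinner (x n) (k z) = \<phi> n z * cinner h (k z)"
    and psd: "\<And>Z r. finite Z \<Longrightarrow> contractive_on Z r \<phi>"
    using factorization[OF assms] by blast
  have "(\<Sum>n<r. (norm (T (x n)))\<^sup>2) \<le> (norm (T h))\<^sup>2" if T: "multiplies k t T" for t T r
  proof -
    obtain v where v: "\<And>n z. cinner (v n) (k z) = \<phi> n z * cinner (T h) (k z)"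
      and le: "\<And>r. (\<Sum>n<r. (norm (v n))\<^sup>2) \<le> (norm (T h))\<^sup>2"
      using contractive_column[OF psd, of "T h"] by blast
    have "v n = T (x n)" for n
      using T by (intro kernel_ext) (simp add: v fac multiplies_def)
    then show ?thesis using le by simp
  qed
  then have "dominates h x" by (simp add: dominates_def)
  then show ?thesis using h fac by auto
qed

lemma multiplies_diff: "multiplies k t T \<Longrightarrow> multiplies k s S \<Longrightarrow> multiplies k (\<lambda>z. t z - s z) (\<lambda>u. T u - S u)"
  by (simp add: multiplies_def cinner_diff_left left_diff_distrib)

section \<open>Weak-star closed algebras of multipliers\<close>

text \<open>
  On multiplication operators, the weak-star topology is weaker than the strong operator topology:
  a basic neighbourhood constrains a square summable sequence of vectors, which can be replaced
  by one dominating vector.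
\<close>

lemma weak_star_neighbourhood:
  assumes "openin weak_star_topology \<O>" "T \<in> \<O>" and T: "multiplies k t T"
  shows "\<exists>h e. e > 0 \<and> (\<forall>s S. multiplies k s S \<longrightarrow> norm (T h - S h) < e \<longrightarrow> S \<in> \<O>)"
proof -
  have "generate_topology_on {{T \<in> bounded_clinear_ops. (\<Sum>n. cinner (T (x n)) (y n)) \<in> U} | x y U.
      summable (\<lambda>n::nat. (norm (x n))\<^sup>2) \<and> summable (\<lambda>n. (norm (y n))\<^sup>2) \<and> open U} \<O>"
    using assms(1) unfolding weak_star_topology_def openin_topology_generated_by_iff .
  then show ?thesis using \<open>T \<in> \<O>\<close>
  proof (induction \<O> rule: generate_topology_on.induct)
    case Empty
    then show ?case by simp
  next
    case (Int a b)
    then obtain h1 e1 h2 e2 where 1: "e1 > 0" "\<And>s S. multiplies k s S \<Longrightarrow> norm (T h1 - S h1) < e1 \<Longrightarrow> S \<in> a"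
      and 2: "e2 > 0" "\<And>s S. multiplies k s S \<Longrightarrow> norm (T h2 - S h2) < e2 \<Longrightarrow> S \<in> b"
      by auto
    define x where "x n = (if n = 0 then h1 else if n = 1 then h2 else 0)" for n :: nat
    have "summable (\<lambda>n. (norm (x n))\<^sup>2)"
      by (rule summable_finite[of "{0, 1}"]) (auto simp: x_def)
    then obtain h where dom: "dominates h x" using domination by blast
    have "S \<in> a \<inter> b" if S: "multiplies k s S" "norm (T h - S h) < min e1 e2" for s S
    proof -
      have "(\<Sum>n<2. (norm (T (x n) - S (x n)))\<^sup>2) \<le> (norm (T h - S h))\<^sup>2"
        by (rule dominatesD[OF dom multiplies_diff[OF T S(1)]])
      then have sum: "(norm (T h1 - S h1))\<^sup>2 + (norm (T h2 - S h2))\<^sup>2 \<le> (norm (T h - S h))\<^sup>2"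
        by (simp add: x_def numeral_2_eq_2)
      have "norm (T h1 - S h1) \<le> norm (T h - S h)" "norm (T h2 - S h2) \<le> norm (T h - S h)"
        by (rule power2_le_imp_le; use sum in \<open>smt (verit) zero_le_power2 norm_ge_zero\<close>)+
      then show ?thesis using 1(2)[OF S(1)] 2(2)[OF S(1)] S(2) by simp
    qed
    then show ?case using 1(1) 2(1) by (intro exI[of _ h] exI[of _ "min e1 e2"]) simp
  next
    case (UN K)
    then obtain a where a: "a \<in> K" "T \<in> a" by blast
    from UN.IH[OF this] show ?case using a(1) by blast
  next
    case (Basis s)
    then obtain x y U where s: "s = {T \<in> bounded_clinear_ops. (\<Sum>n. cinner (T (x n)) (y n)) \<in> U}"
      and x: "summable (\<lambda>n::nat. (norm (x n))\<^sup>2)" and y: "summable (\<lambda>n. (norm (y n))\<^sup>2)" and U: "open U"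
      by auto
    obtain h where dom: "dominates h x" using domination[OF x] by blast
    define Y where "Y = sqrt (\<Sum>n. (norm (y n))\<^sup>2)"
    have Y0: "Y \<ge> 0" by (simp add: Y_def suminf_nonneg[OF y])
    have partial: "(\<Sum>n<r. norm (cinner (S (x n)) (y n))) \<le> norm (S h) * Y" if "multiplies k t' S" for t' S r
    proof -
      have "(\<Sum>n<r. norm (cinner (S (x n)) (y n))) \<le> (\<Sum>n<r. \<bar>norm (S (x n))\<bar> * \<bar>norm (y n)\<bar>)"
        by (intro sum_mono) (simp add: cmod_cinner_le)
      also have "\<dots> \<le> L2_set (\<lambda>n. norm (S (x n))) {..<r} * L2_set (\<lambda>n. norm (y n)) {..<r}"
        by (rule L2_set_mult_ineq)
      also have "\<dots> \<le> norm (S h) * Y"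
      proof (rule mult_mono)
        show "L2_set (\<lambda>n. norm (S (x n))) {..<r} \<le> norm (S h)"
          unfolding L2_set_def using dominatesD[OF dom that, of r] by (simp add: real_le_lsqrt sum_nonneg)
        have "(\<Sum>n<r. (norm (y n))\<^sup>2) \<le> (\<Sum>n. (norm (y n))\<^sup>2)"
          by (rule sum_le_suminf[OF y]) auto
        then show "L2_set (\<lambda>n. norm (y n)) {..<r} \<le> Y"
          unfolding L2_set_def Y_def by simp
      qed (simp_all add: L2_set_nonneg)
      finally show ?thesis .
    qed
    have summ: "summable (\<lambda>n. norm (cinner (S (x n)) (y n)))" if "multiplies k t' S" for t' S
      by (rule summableI_nonneg_bounded[OF _ partial[OF that]]) simp
    have "(\<Sum>n. cinner (T (x n)) (y n)) \<in> U" using Basis.prems by (simp add: s)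
    then obtain \<epsilon> where \<epsilon>: "\<epsilon> > 0" "ball (\<Sum>n. cinner (T (x n)) (y n)) \<epsilon> \<subseteq> U"
      using U open_contains_ball by blast
    have "S \<in> s" if S: "multiplies k s' S" "norm (T h - S h) < \<epsilon> / (Y + 1)" for s' S
    proof -
      have D: "multiplies k (\<lambda>z. t z - s' z) (\<lambda>u. T u - S u)" by (rule multiplies_diff[OF T S(1)])
      have "(\<Sum>n. cinner (T (x n)) (y n)) - (\<Sum>n. cinner (S (x n)) (y n))
          = (\<Sum>n. cinner (T (x n) - S (x n)) (y n))"
        unfolding cinner_diff_left
        by (rule suminf_diff) (rule summable_norm_cancel, rule summ, rule T S)+
      also have "norm \<dots> \<le> (\<Sum>n. norm (cinner (T (x n) - S (x n)) (y n)))"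
        by (rule summable_norm[OF summ[OF D]])
      also have "\<dots> \<le> norm (T h - S h) * Y"
        by (rule suminf_le_const[OF summ[OF D] partial[OF D]])
      also have "\<dots> \<le> norm (T h - S h) * (Y + 1)" by (simp add: mult_left_mono)
      also have "\<dots> < \<epsilon>" using S(2) Y0 by (simp add: field_simps)
      finally have "(\<Sum>n. cinner (S (x n)) (y n)) \<in> U"
        using \<epsilon>(2) by (auto simp: dist_norm)
      then show ?thesis using multiplies_bounded[OF S(1)] by (simp add: s)
    qed
    then show ?case using \<epsilon>(1) Y0 by (intro exI[of _ h] exI[of _ "\<epsilon> / (Y + 1)"]) auto
  qed
qed

text \<open>
  The hypothesis provides approximation at single vectors, and by the previous lemma weak-star
  neighbourhoods of multiplication operators require no more.
\<close>

lemma dual_subalgebra_reflexive: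
  assumes A: "dual_subalgebra k A" and T: "multiplies k t T"
    and cyc: "\<And>h. T h \<in> closure ((\<lambda>f. mult_op k f h) ` A)"
  shows "t \<in> A"
proof (rule ccontr)
  assume t: "t \<notin> A"
  have AM: "A \<subseteq> multipliers k" and cl: "closedin weak_star_topology (mult_op k ` A)"
    using A unfolding dual_subalgebra_def by simp_all
  have TA: "T \<notin> mult_op k ` A"
  proof
    assume "T \<in> mult_op k ` A"
    then obtain f where f: "f \<in> A" "T = mult_op k f" by blast
    then have "multiplies k f T" using multiplies_mult_op AM by blast
    then show False using multiplies_unique[OF T] f t by blast
  qed
  have "topspace weak_star_topology = (bounded_clinear_ops :: ('h \<Rightarrow> 'h) set)"
  proof
    show "topspace weak_star_topology \<subseteq> (bounded_clinear_ops :: ('h \<Rightarrow> 'h) set)"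
      unfolding weak_star_topology_def by auto
    have "(bounded_clinear_ops :: ('h \<Rightarrow> 'h) set) \<in> {{T \<in> bounded_clinear_ops. (\<Sum>n. cinner (T (x n)) (y n)) \<in> U} | x y U.
        summable (\<lambda>n::nat. (norm (x n))\<^sup>2) \<and> summable (\<lambda>n. (norm (y n))\<^sup>2) \<and> open U}"
      by (auto intro!: exI[of _ "\<lambda>_. 0"] exI[of _ UNIV])
    then show "(bounded_clinear_ops :: ('h \<Rightarrow> 'h) set) \<subseteq> topspace weak_star_topology"
      unfolding weak_star_topology_def topology_generated_by_topspace by blast
  qed
  then have "T \<in> topspace weak_star_topology - mult_op k ` A"
    using multiplies_bounded[OF T] TA by simp
  moreover have "openin weak_star_topology (topspace weak_star_topology - mult_op k ` A)"
    using cl by (simp add: closedin_def)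
  ultimately have "\<exists>h e. e > 0 \<and> (\<forall>s S. multiplies k s S \<longrightarrow> norm (T h - S h) < e \<longrightarrow>
      S \<in> topspace weak_star_topology - mult_op k ` A)"
    by (intro weak_star_neighbourhood[OF _ _ T])
  then obtain h e where e: "e > 0" and near: "\<forall>s S. multiplies k s S \<longrightarrow> norm (T h - S h) < e \<longrightarrow>
      S \<in> topspace weak_star_topology - mult_op k ` A"
    by (elim exE conjE) (rule that)
  obtain f where f: "f \<in> A" "dist (mult_op k f h) (T h) < e"
    using cyc[of h] e unfolding closure_approachable by auto
  then have "multiplies k f (mult_op k f)" using multiplies_mult_op AM by blast
  with near f(2) have "mult_op k f \<notin> mult_op k ` A" by (simp add: dist_norm norm_minus_commute)
  then show False using f(1) by blast
qed

end

section \<open>A minimax lemma\<close>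

text \<open>
  Otherwise \<open>f a < 0\<close> forces \<open>g a \<ge> 0\<close> and vice versa.  Mixing a point of the first kind with one of the
  second shows that the ratios \<open>- g b / f b\<close> for \<open>g b < 0\<close> lie below the ratios \<open>- g a / f a\<close> for
  \<open>f a < 0\<close>.  If \<open>\<tau>\<close> separates them, then \<open>\<tau> f + g\<close> is nonnegative everywhere, which contradicts the
  hypothesis for the weight \<open>1 / (1 + \<tau>)\<close>.
\<close>

lemma minimax_two:
  fixes f g :: "'a \<Rightarrow> real"
  assumes mix: "\<And>a b s. a \<in> K \<Longrightarrow> b \<in> K \<Longrightarrow> 0 \<le> s \<Longrightarrow> s \<le> 1 \<Longrightarrow>
      \<exists>c\<in>K. f c \<le> (1 - s) * f a + s * f b \<and> g c \<le> (1 - s) * g a + s * g b"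
    and low: "\<And>t. 0 \<le> t \<Longrightarrow> t \<le> 1 \<Longrightarrow> \<exists>a\<in>K. (1 - t) * f a + t * g a < 0"
  shows "\<exists>a\<in>K. f a < 0 \<and> g a < 0"
proof (rule ccontr)
  assume "\<not> (\<exists>a\<in>K. f a < 0 \<and> g a < 0)"
  then have no: "f a < 0 \<Longrightarrow> g a \<ge> 0" "g a < 0 \<Longrightarrow> f a \<ge> 0" if "a \<in> K" for a
    using that by force+
  have cross: "f a * g b \<le> g a * f b" if a: "a \<in> K" "f a < 0" and b: "b \<in> K" "g b < 0" for a b
  proof (rule ccontr)
    assume "\<not> f a * g b \<le> g a * f b"
    then have lt: "g a * f b < f a * g b" by simp
    have ga: "g a \<ge> 0" and fb: "f b \<ge> 0" using no a b by auto
    define r0 where "r0 = g a / (- g b)"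
    have r0: "r0 \<ge> 0" "r0 * g b = - g a" using ga b by (simp_all add: r0_def divide_nonneg_neg)
    have gap: "- f a - r0 * f b > 0"
    proof -
      have "(- f a - r0 * f b) * (- g b) = f a * g b + f b * (r0 * g b)"
        by (simp add: algebra_simps)
      then have "(- f a - r0 * f b) * (- g b) = f a * g b - g a * f b"
        unfolding r0(2) by (simp add: mult.commute)
      then have "(- f a - r0 * f b) * (- g b) > 0" using lt by simp
      then show ?thesis using b zero_less_mult_pos2[of "- f a - r0 * f b" "- g b"] by linarith
    qed
    define \<eta> where "\<eta> = (- f a - r0 * f b) / (f b + 1)"
    have \<eta>: "\<eta> > 0" "\<eta> * f b < - f a - r0 * f b"
      using gap fb by (simp_all add: \<eta>_def field_simps)
    define r where "r = r0 + \<eta>"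
    have r: "r > 0" "f a + r * f b < 0" "g a + r * g b < 0"
      using \<eta> r0 b by (simp_all add: r_def algebra_simps mult_pos_neg)
    define s where "s = r / (1 + r)"
    have s: "0 \<le> s" "s \<le> 1" "1 - s = 1 / (1 + r)" using r by (simp_all add: s_def field_simps)
    obtain c where c: "c \<in> K" "f c \<le> (1 - s) * f a + s * f b" "g c \<le> (1 - s) * g a + s * g b"
      using mix[OF a(1) b(1) s(1,2)] by blast
    have "(1 - s) * x + s * y = (x + r * y) / (1 + r)" for x y
      unfolding s(3) by (simp add: s_def add_divide_distrib)
    then have "f c < 0" "g c < 0"
      using c(2,3) r by (auto simp: divide_neg_pos elim!: order.strict_trans1)
    then show False using no c(1) by force
  qed
  obtain a0 where a0: "a0 \<in> K" "f a0 < 0" using low[of 0] by auto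
  obtain b0 where b0: "b0 \<in> K" "g b0 < 0" using low[of 1] by auto
  have fpos: "f b > 0" if "b \<in> K" "g b < 0" for b
  proof -
    have "0 < f a0 * g b" using a0 that by (simp add: mult_neg_neg)
    then have "0 < g a0 * f b" using cross[OF a0 that] by linarith
    then show ?thesis using no(1)[OF a0] by (simp add: zero_less_mult_iff)
  qed
  define S where "S = (\<lambda>b. - g b / f b) ` {b \<in> K. g b < 0}"
  define \<tau> where "\<tau> = Sup S"
  have upper: "x \<le> g a / (- f a)" if "x \<in> S" "a \<in> K" "f a < 0" for x a
  proof -
    obtain b where b: "b \<in> K" "g b < 0" "x = - g b / f b" using \<open>x \<in> S\<close> by (auto simp: S_def)
    show ?thesis using cross[OF that(2,3) b(1,2)] fpos[OF b(1,2)] that(3) unfolding b(3)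
      by (simp add: field_simps)
  qed
  have bdd: "bdd_above S" using upper[OF _ a0] by (rule bdd_aboveI)
  have "- g b0 / f b0 \<in> S" using b0 by (auto simp: S_def)
  then have ne: "S \<noteq> {}" and "- g b0 / f b0 \<le> \<tau>" unfolding \<tau>_def using bdd by (auto intro: cSup_upper)
  moreover have "- g b0 / f b0 > 0" using fpos[OF b0] b0 by (simp add: divide_neg_pos)
  ultimately have \<tau>: "\<tau> > 0" by linarith
  obtain a where a: "a \<in> K" "(1 - 1 / (1 + \<tau>)) * f a + 1 / (1 + \<tau>) * g a < 0"
    using low[of "1 / (1 + \<tau>)"] \<tau> by auto
  have "1 - 1 / (1 + \<tau>) = \<tau> / (1 + \<tau>)" using \<tau> by (simp add: field_simps)
  then have "(1 - 1 / (1 + \<tau>)) * f a + 1 / (1 + \<tau>) * g a = (\<tau> * f a + g a) / (1 + \<tau>)"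
    by (simp add: add_divide_distrib)
  then have neg: "\<tau> * f a + g a < 0" using a(2) \<tau> by (simp add: divide_less_0_iff)
  consider "f a < 0" | "g a < 0" | "f a \<ge> 0" "g a \<ge> 0" by linarith
  then show False
  proof cases
    case 1
    have "\<tau> \<le> g a / (- f a)" unfolding \<tau>_def using ne upper a(1) 1 by (intro cSup_least)
    then show False using neg 1 by (simp add: field_simps)
  next
    case 2
    then have "- g a / f a \<le> \<tau>" unfolding \<tau>_def using bdd a(1) by (intro cSup_upper) (auto simp: S_def)
    then show False using neg fpos[OF a(1) 2] by (simp add: field_simps)
  next
    case 3
    then show False using neg \<tau> by (smt (verit) mult_nonneg_nonneg)
  qed
qed

text \<open>
  Induction on the number of functions: \<open>minimax_two\<close> is applied to an average of the first ones and
  to the last one, in order to pass to the set where the last one is negative.  Convexity enters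
  through mixtures of points, the form in which an algebra of functions provides it.
\<close>

lemma minimax:
  fixes F :: "'i \<Rightarrow> 'a \<Rightarrow> real"
  assumes "finite I" "I \<noteq> {}"
    and mix: "\<And>a b s. a \<in> K \<Longrightarrow> b \<in> K \<Longrightarrow> 0 \<le> s \<Longrightarrow> s \<le> 1 \<Longrightarrow>
      \<exists>c\<in>K. \<forall>i\<in>I. F i c \<le> (1 - s) * F i a + s * F i b"
    and low: "\<And>p. (\<forall>i\<in>I. 0 \<le> p i) \<Longrightarrow> sum p I = 1 \<Longrightarrow> \<exists>a\<in>K. (\<Sum>i\<in>I. p i * F i a) < 0"
  shows "\<exists>a\<in>K. \<forall>i\<in>I. F i a < 0"
  using assms
proof (induction I arbitrary: K rule: finite_ne_induct)
  case (singleton i)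
  from singleton(2)[of "\<lambda>_. 1"] show ?case by simp
next
  case (insert j I)
  define K' where "K' = {a \<in> K. F j a < 0}"
  have "\<exists>a\<in>K'. \<forall>i\<in>I. F i a < 0"
  proof (rule insert.IH)
    fix a b s assume ab: "a \<in> K'" "b \<in> K'" and s: "0 \<le> s" "s \<le> (1 :: real)"
    then obtain c where c: "c \<in> K" "\<forall>i\<in>insert j I. F i c \<le> (1 - s) * F i a + s * F i b"
      using insert.prems(1)[of a b s] by (auto simp: K'_def)
    have neg: "F j a < 0" "F j b < 0" using ab by (auto simp: K'_def)
    have "(1 - s) * F j a + s * F j b < 0"
    proof (cases "s = 0")
      case False
      then have "s * F j b < 0" using s neg by (simp add: mult_pos_neg)
      moreover have "(1 - s) * F j a \<le> 0" using s neg by (simp add: mult_nonneg_nonpos)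
      ultimately show ?thesis by linarith
    qed (use neg in simp)
    moreover have "F j c \<le> (1 - s) * F j a + s * F j b" using c by simp
    ultimately have "c \<in> K'" using c by (simp add: K'_def)
    then show "\<exists>c\<in>K'. \<forall>i\<in>I. F i c \<le> (1 - s) * F i a + s * F i b" using c by blast
  next
    fix p :: "'i \<Rightarrow> real" assume p: "\<forall>i\<in>I. 0 \<le> p i" "sum p I = 1"
    have "\<exists>a\<in>K. (\<Sum>i\<in>I. p i * F i a) < 0 \<and> F j a < 0"
    proof (rule minimax_two)
      fix a b s assume ab: "a \<in> K" "b \<in> K" and s: "0 \<le> s" "s \<le> (1 :: real)"
      then obtain c where c: "c \<in> K" "\<forall>i\<in>insert j I. F i c \<le> (1 - s) * F i a + s * F i b"
        using insert.prems(1)[of a b s] by auto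
      have "(\<Sum>i\<in>I. p i * F i c) \<le> (\<Sum>i\<in>I. p i * ((1 - s) * F i a + s * F i b))"
        using c(2) p(1) by (intro sum_mono mult_left_mono) auto
      also have "\<dots> = (1 - s) * (\<Sum>i\<in>I. p i * F i a) + s * (\<Sum>i\<in>I. p i * F i b)"
        by (simp add: sum_distrib_left sum.distrib algebra_simps sum_subtractf)
      finally show "\<exists>c\<in>K. (\<Sum>i\<in>I. p i * F i c) \<le> (1 - s) * (\<Sum>i\<in>I. p i * F i a) + s * (\<Sum>i\<in>I. p i * F i b)
          \<and> F j c \<le> (1 - s) * F j a + s * F j b"
        using c by blast
    next
      fix t :: real assume t: "0 \<le> t" "t \<le> 1"
      define q where "q i = (if i = j then t else (1 - t) * p i)" for i
      have q_sum: "(\<Sum>i\<in>I. q i * x i) = (1 - t) * (\<Sum>i\<in>I. p i * x i)" for x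
        unfolding sum_distrib_left using insert.hyps by (intro sum.cong) (auto simp: q_def)
      have "sum q (insert j I) = 1"
        using insert.hyps q_sum[of "\<lambda>_. 1"] p(2) by (simp add: q_def)
      moreover have "\<forall>i\<in>insert j I. 0 \<le> q i" using t p(1) by (auto simp: q_def)
      ultimately obtain a where "a \<in> K" "(\<Sum>i\<in>insert j I. q i * F i a) < 0"
        using insert.prems(2)[of q] by blast
      moreover have "(\<Sum>i\<in>insert j I. q i * F i a) = t * F j a + (1 - t) * (\<Sum>i\<in>I. p i * F i a)"
        using insert.hyps q_sum[of "\<lambda>i. F i a"] by (simp add: q_def)
      ultimately show "\<exists>a\<in>K. (1 - t) * (\<Sum>i\<in>I. p i * F i a) + t * F j a < 0"
        by (intro bexI[of _ a]) auto
    qed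
    then show "\<exists>a\<in>K'. (\<Sum>i\<in>I. p i * F i a) < 0" by (auto simp: K'_def)
  qed
  then show ?case by (auto simp: K'_def)
qed

section \<open>Interpolants of minimal norm\<close>

lemma norm_mix_sq:
  fixes x y :: "'a::real_inner"
  assumes "0 \<le> s" "s \<le> 1"
  shows "(norm ((1 - s) *\<^sub>R x + s *\<^sub>R y))\<^sup>2 \<le> (1 - s) * (norm x)\<^sup>2 + s * (norm y)\<^sup>2"
proof -
  have "(1 - s) * (norm x)\<^sup>2 + s * (norm y)\<^sup>2 - (norm ((1 - s) *\<^sub>R x + s *\<^sub>R y))\<^sup>2
      = s * (1 - s) * (norm (x - y))\<^sup>2"
    unfolding power2_norm_eq_inner
    by (simp add: inner_add_left inner_add_right inner_diff_left inner_diff_right inner_commute[of y x]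
        algebra_simps)
  moreover have "s * (1 - s) * (norm (x - y))\<^sup>2 \<ge> 0" using assms by simp
  ultimately show ?thesis by linarith
qed

locale dual_algebra = cnp_space k for k :: "'x \<Rightarrow> 'h::chilbert_space" +
  fixes A
  assumes dual: "dual_subalgebra k A"
begin

lemma A_multiplier: "f \<in> A \<Longrightarrow> f \<in> multipliers k"
  using dual unfolding dual_subalgebra_def by blast

lemma A_mult: "f \<in> A \<Longrightarrow> multiplies k f (mult_op k f)"
  by (rule multiplies_mult_op[OF A_multiplier])

lemma A_value: "f \<in> A \<Longrightarrow> cinner (mult_op k f u) (k z) = f z * cinner u (k z)"
  using A_mult unfolding multiplies_def by simp

lemma A_one: "(\<lambda>x. 1) \<in> A"
  using dual unfolding dual_subalgebra_def by simp

lemma A_add: "f \<in> A \<Longrightarrow> g \<in> A \<Longrightarrow> (\<lambda>x. f x + g x) \<in> A"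
  using dual unfolding dual_subalgebra_def by simp

lemma A_times: "f \<in> A \<Longrightarrow> g \<in> A \<Longrightarrow> (\<lambda>x. f x * g x) \<in> A"
  using dual unfolding dual_subalgebra_def by simp

lemma A_scale: "f \<in> A \<Longrightarrow> (\<lambda>x. c * f x) \<in> A"
  using dual unfolding dual_subalgebra_def by simp

lemma A_diff: "f \<in> A \<Longrightarrow> g \<in> A \<Longrightarrow> (\<lambda>x. f x - g x) \<in> A"
  using A_add[OF _ A_scale[of g "- 1"]] by simp

lemma A_sum: "(\<And>i. i \<in> I \<Longrightarrow> f i \<in> A) \<Longrightarrow> (\<lambda>x. \<Sum>i\<in>I. f i x) \<in> A"
proof (induction I rule: infinite_finite_induct)
  case (infinite I)
  then show ?case using A_scale[OF A_one, of 0] by simp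
next
  case empty
  then show ?case using A_scale[OF A_one, of 0] by simp
next
  case (insert i I)
  then show ?case using A_add[of "f i" "\<lambda>x. \<Sum>i\<in>I. f i x"] by simp
qed

lemma A_prod: "finite I \<Longrightarrow> (\<And>i. i \<in> I \<Longrightarrow> f i \<in> A) \<Longrightarrow> (\<lambda>x. \<Prod>i\<in>I. f i x) \<in> A"
proof (induction I rule: finite_induct)
  case empty
  then show ?case using A_one by simp
next
  case (insert i I)
  then show ?case using A_times[of "f i" "\<lambda>x. \<Prod>i\<in>I. f i x"] by simp
qed

lemma mult_op_one: "mult_op k (\<lambda>x. 1) u = u"
  by (rule kernel_ext) (simp add: A_value[OF A_one])

lemma mult_op_add: "f \<in> A \<Longrightarrow> g \<in> A \<Longrightarrow> mult_op k (\<lambda>x. f x + g x) u = mult_op k f u + mult_op k g u"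
  by (rule kernel_ext) (simp add: A_value A_value[OF A_add] cinner_add_left algebra_simps)

lemma mult_op_diff: "f \<in> A \<Longrightarrow> g \<in> A \<Longrightarrow> mult_op k (\<lambda>x. f x - g x) u = mult_op k f u - mult_op k g u"
  by (rule kernel_ext) (simp add: A_value A_value[OF A_diff] cinner_diff_left algebra_simps)

lemma mult_op_scale: "f \<in> A \<Longrightarrow> mult_op k (\<lambda>x. c * f x) u = c *\<^sub>C mult_op k f u"
  by (rule kernel_ext) (simp add: A_value A_value[OF A_scale] cinner_scaleC_left)

lemma mult_op_times: "f \<in> A \<Longrightarrow> g \<in> A \<Longrightarrow> mult_op k (\<lambda>x. f x * g x) u = mult_op k f (mult_op k g u)"
  by (rule kernel_ext) (simp add: A_value A_value[OF A_times])

abbreviation ideal :: "'x set \<Rightarrow> ('x \<Rightarrow> complex) set" where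
  "ideal E \<equiv> vanishing_ideal A E"

lemma ideal_empty: "ideal {} = A"
  by (simp add: vanishing_ideal_def)

lemma idealD: "g \<in> ideal E \<Longrightarrow> g \<in> A" "g \<in> ideal E \<Longrightarrow> x \<in> E \<Longrightarrow> g x = 0"
  by (simp_all add: vanishing_ideal_def)

lemma ideal_zero: "(\<lambda>x. 0 * 1) \<in> ideal E"
  using A_scale[OF A_one, of 0] by (simp add: vanishing_ideal_def)

lemma ideal_orbit_subspace: "complex_subspace ((\<lambda>f. mult_op k f u) ` ideal E)"
  unfolding complex_subspace_def
proof (intro conjI ballI allI)
  have "mult_op k (\<lambda>x. 0 * 1) u = 0" by (simp only: mult_op_scale[OF A_one] scaleC_zero_left)
  then show "0 \<in> (\<lambda>f. mult_op k f u) ` ideal E" by (intro image_eqI[OF _ ideal_zero]) (rule sym)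
next
  fix x y assume "x \<in> (\<lambda>f. mult_op k f u) ` ideal E" "y \<in> (\<lambda>f. mult_op k f u) ` ideal E"
  then obtain f g where "f \<in> ideal E" "g \<in> ideal E" "x = mult_op k f u" "y = mult_op k g u" by blast
  then show "x + y \<in> (\<lambda>f. mult_op k f u) ` ideal E"
    by (intro image_eqI[of _ _ "\<lambda>x. f x + g x"]) (simp_all add: mult_op_add A_add vanishing_ideal_def)
next
  fix c x assume "x \<in> (\<lambda>f. mult_op k f u) ` ideal E"
  then obtain f where "f \<in> ideal E" "x = mult_op k f u" by blast
  then show "c *\<^sub>C x \<in> (\<lambda>f. mult_op k f u) ` ideal E"
    by (intro image_eqI[of _ _ "\<lambda>x. c * f x"]) (simp_all add: mult_op_scale A_scale vanishing_ideal_def)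
qed

text \<open>
  By the minimax lemma it suffices to bound weighted averages, and a weighted family of vectors is
  dominated by a single one.  Adding small multiples of kernel functions to the family keeps the
  dominating vector away from zero on \<open>E\<close>.
\<close>

lemma simultaneous_bound:
  assumes f0: "f0 \<in> A" and E: "finite E"
    and single: "\<And>h e. e > 0 \<Longrightarrow> (\<forall>z\<in>E. cinner h (k z) \<noteq> 0) \<Longrightarrow>
      \<exists>g\<in>A. (\<forall>z\<in>E. g z = f0 z) \<and> (norm (mult_op k g h))\<^sup>2 < c\<^sup>2 * (norm h)\<^sup>2 + e"
    and V: "finite V" and \<delta>: "\<delta> > 0"
  shows "\<exists>g\<in>A. (\<forall>z\<in>E. g z = f0 z) \<and> (\<forall>v\<in>V. (norm (mult_op k g v))\<^sup>2 < c\<^sup>2 * (norm v)\<^sup>2 + \<delta>)"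
proof (cases "V = {}")
  case True
  then show ?thesis using f0 by blast
next
  case False
  define K where "K = {g \<in> A. \<forall>z\<in>E. g z = f0 z}"
  have "\<exists>g\<in>K. \<forall>v\<in>V. (norm (mult_op k g v))\<^sup>2 - (c\<^sup>2 * (norm v)\<^sup>2 + \<delta>) < 0"
  proof (rule minimax[OF V False])
    fix a b s assume ab: "a \<in> K" "b \<in> K" and s: "0 \<le> s" "s \<le> (1::real)"
    define g where "g x = of_real (1 - s) * a x + of_real s * b x" for x
    have A: "a \<in> A" "b \<in> A" using ab by (auto simp: K_def)
    have "g \<in> A" unfolding g_def[abs_def] by (intro A_add A_scale A)
    moreover have "g z = f0 z" if "z \<in> E" for z
      using ab that by (simp add: g_def K_def algebra_simps)
    ultimately have "g \<in> K" by (simp add: K_def)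
    have g: "mult_op k g v = (1 - s) *\<^sub>R mult_op k a v + s *\<^sub>R mult_op k b v" for v
      unfolding g_def[abs_def] mult_op_add[OF A_scale[OF A(1)] A_scale[OF A(2)]]
        mult_op_scale[OF A(1)] mult_op_scale[OF A(2)] scaleC_of_real ..
    have "(norm (mult_op k g v))\<^sup>2 - (c\<^sup>2 * (norm v)\<^sup>2 + \<delta>)
        \<le> (1 - s) * ((norm (mult_op k a v))\<^sup>2 - (c\<^sup>2 * (norm v)\<^sup>2 + \<delta>))
          + s * ((norm (mult_op k b v))\<^sup>2 - (c\<^sup>2 * (norm v)\<^sup>2 + \<delta>))" for v
      using norm_mix_sq[OF s, of "mult_op k a v" "mult_op k b v"] unfolding g by (simp add: algebra_simps)
    then show "\<exists>g\<in>K. \<forall>v\<in>V. (norm (mult_op k g v))\<^sup>2 - (c\<^sup>2 * (norm v)\<^sup>2 + \<delta>)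
        \<le> (1 - s) * ((norm (mult_op k a v))\<^sup>2 - (c\<^sup>2 * (norm v)\<^sup>2 + \<delta>))
          + s * ((norm (mult_op k b v))\<^sup>2 - (c\<^sup>2 * (norm v)\<^sup>2 + \<delta>))"
      using \<open>g \<in> K\<close> by blast
  next
    fix p :: "'h \<Rightarrow> real" assume p: "\<forall>v\<in>V. 0 \<le> p v" "sum p V = 1"
    define V' where "V' = V \<union> k ` E"
    have V': "finite V'" using V E by (simp add: V'_def)
    define s where "s = (\<Sum>v\<in>V'. (norm v)\<^sup>2)"
    have s0: "s \<ge> 0" by (simp add: s_def sum_nonneg)
    define \<eta> where "\<eta> = \<delta> / (2 * (c\<^sup>2 * s + 1))"
    have pos: "c\<^sup>2 * s + 1 > 0" using s0 by (simp add: add_nonneg_pos)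
    have \<eta>: "\<eta> > 0" "c\<^sup>2 * (\<eta> * s) < \<delta> / 2"
    proof -
      show "\<eta> > 0" using \<delta> pos by (simp add: \<eta>_def)
      then have "\<eta> * (c\<^sup>2 * s) < \<eta> * (c\<^sup>2 * s + 1)" by simp
      also have "\<dots> = \<delta> / 2" using pos by (simp add: \<eta>_def field_simps)
      finally show "c\<^sup>2 * (\<eta> * s) < \<delta> / 2" by (simp add: mult_ac)
    qed
    \<comment> \<open>The extra weight \<open>\<eta>\<close> costs at most \<open>\<delta> / 2\<close>.\<close>
    define q where "q v = (if v \<in> V then p v else 0) + \<eta>" for v
    have q: "q v \<ge> \<eta>" for v using p(1) by (simp add: q_def)
    have q_sum: "(\<Sum>v\<in>V'. q v * F v) = (\<Sum>v\<in>V. p v * F v) + \<eta> * (\<Sum>v\<in>V'. F v)" for F :: "'h \<Rightarrow> real"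
    proof -
      have "(\<Sum>v\<in>V'. q v * F v) = (\<Sum>v\<in>V'. if v \<in> V then p v * F v else 0) + (\<Sum>v\<in>V'. \<eta> * F v)"
        unfolding sum.distrib[symmetric] by (intro sum.cong) (auto simp: q_def algebra_simps)
      also have "(\<Sum>v\<in>V'. if v \<in> V then p v * F v else 0) = (\<Sum>v\<in>V' \<inter> V. p v * F v)"
        by (simp only: sum.inter_restrict[OF V', symmetric])
      also have "V' \<inter> V = V" by (auto simp: V'_def)
      finally show ?thesis by (simp add: sum_distrib_left)
    qed
    define m where "m = card V'"
    obtain e where e: "bij_betw e {..<m} V'"
      using ex_bij_betw_nat_finite[OF V'] by (auto simp: m_def atLeast0LessThan)
    define x where "x n = (if n < m then sqrt (q (e n)) *\<^sub>R e n else 0)" for n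
    have norm_x: "(\<Sum>n<m. F (e n)) = (\<Sum>v\<in>V'. F v)" for F :: "'h \<Rightarrow> real"
      by (rule sum.reindex_bij_betw[OF e])
    have sq: "(norm (sqrt (q v) *\<^sub>R y))\<^sup>2 = q v * (norm y)\<^sup>2" for v and y :: 'h
      using q[of v] \<eta>(1) by (simp add: power_mult_distrib)
    have sums: "(\<lambda>n. (norm (x n))\<^sup>2) sums (\<Sum>n<m. (norm (x n))\<^sup>2)"
      by (rule sums_finite) (auto simp: x_def)
    have "(\<Sum>n<m. (norm (x n))\<^sup>2) = (\<Sum>n<m. q (e n) * (norm (e n))\<^sup>2)"
      by (intro sum.cong refl) (simp only: x_def sq lessThan_iff if_True)
    also have "\<dots> = (\<Sum>v\<in>V. p v * (norm v)\<^sup>2) + \<eta> * s"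
      unfolding norm_x[of "\<lambda>v. q v * (norm v)\<^sup>2"] q_sum s_def ..
    finally have suminf: "(\<Sum>n. (norm (x n))\<^sup>2) = (\<Sum>v\<in>V. p v * (norm v)\<^sup>2) + \<eta> * s"
      using sums_unique[OF sums] by simp
    obtain h where h: "(norm h)\<^sup>2 \<le> (\<Sum>n. (norm (x n))\<^sup>2)"
      and nz: "\<forall>n z. cinner (x n) (k z) \<noteq> 0 \<longrightarrow> cinner h (k z) \<noteq> 0" and dom: "dominates h x"
      using domination[OF sums_summable[OF sums]] by blast
    have "cinner h (k z) \<noteq> 0" if "z \<in> E" for z
    proof -
      have "k z \<in> e ` {..<m}" using e that by (auto simp: bij_betw_def V'_def)
      then obtain n where n: "n < m" "e n = k z" by auto
      have "cinner (x n) (k z) = of_real (sqrt (q (k z))) * cinner (k z) (k z)"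
        using n by (simp add: x_def cinner_scaleR_left)
      then have "cinner (x n) (k z) \<noteq> 0"
        using q[of "k z"] \<eta>(1) kernel_self_nonzero[of z] by simp
      then show ?thesis using nz by blast
    qed
    then obtain g where g: "g \<in> A" "\<forall>z\<in>E. g z = f0 z"
      and g_h: "(norm (mult_op k g h))\<^sup>2 < c\<^sup>2 * (norm h)\<^sup>2 + \<delta> / 2"
      using single[of "\<delta> / 2" h] \<delta> by auto
    have lin: "mult_op k g (r *\<^sub>R y) = r *\<^sub>R mult_op k g y" for r y
      using multiplies_scaleC[OF A_mult[OF g(1)], of "of_real r" y] by (simp add: scaleC_of_real)
    have "(\<Sum>v\<in>V. p v * (norm (mult_op k g v))\<^sup>2) \<le> (\<Sum>v\<in>V'. q v * (norm (mult_op k g v))\<^sup>2)"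
      unfolding q_sum using \<eta>(1) by (simp add: sum_nonneg)
    also have "\<dots> = (\<Sum>n<m. q (e n) * (norm (mult_op k g (e n)))\<^sup>2)" by (rule norm_x[of "\<lambda>v. q v * (norm (mult_op k g v))\<^sup>2", symmetric])
    also have "\<dots> = (\<Sum>n<m. (norm (mult_op k g (x n)))\<^sup>2)"
      by (intro sum.cong refl) (simp only: x_def lin sq lessThan_iff if_True)
    also have "\<dots> \<le> (norm (mult_op k g h))\<^sup>2" by (rule dominatesD[OF dom A_mult[OF g(1)]])
    also have "\<dots> < c\<^sup>2 * (norm h)\<^sup>2 + \<delta> / 2" by (rule g_h)
    also have "c\<^sup>2 * (norm h)\<^sup>2 \<le> c\<^sup>2 * ((\<Sum>v\<in>V. p v * (norm v)\<^sup>2) + \<eta> * s)"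
      using h unfolding suminf by (simp add: mult_left_mono)
    finally have "(\<Sum>v\<in>V. p v * (norm (mult_op k g v))\<^sup>2) < c\<^sup>2 * (\<Sum>v\<in>V. p v * (norm v)\<^sup>2) + \<delta>"
      using \<eta>(2) by (simp add: distrib_left)
    moreover have "(\<Sum>v\<in>V. p v * ((norm (mult_op k g v))\<^sup>2 - (c\<^sup>2 * (norm v)\<^sup>2 + \<delta>)))
        = (\<Sum>v\<in>V. p v * (norm (mult_op k g v))\<^sup>2) - (c\<^sup>2 * (\<Sum>v\<in>V. p v * (norm v)\<^sup>2) + \<delta> * sum p V)"
      unfolding sum_distrib_left sum.distrib[symmetric] sum_subtractf[symmetric]
      by (intro sum.cong refl) (simp add: algebra_simps)
    ultimately show "\<exists>g\<in>K. (\<Sum>v\<in>V. p v * ((norm (mult_op k g v))\<^sup>2 - (c\<^sup>2 * (norm v)\<^sup>2 + \<delta>))) < 0"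
      using g p(2) by (intro bexI[of _ g]) (auto simp: K_def)
  qed
  then show ?thesis by (auto simp: K_def)
qed

text \<open>
  The almost optimal multipliers of the previous lemma have a limit as pairings \<open>\<langle>g u, y\<rangle>\<close>.  Linearity
  in \<open>y\<close>, the multiplication rule at kernel functions and orthogonality to the complement of the
  cyclic subspace of \<open>u\<close> are closed conditions; together with the norm bound they make the limit the
  pairing of an operator that belongs to the algebra by reflexivity.
\<close>

lemma interpolant_exists:
  assumes f0: "f0 \<in> A" and E: "finite E" and c: "c \<ge> 0"
    and single: "\<And>h e. e > 0 \<Longrightarrow> (\<forall>z\<in>E. cinner h (k z) \<noteq> 0) \<Longrightarrow>
      \<exists>g\<in>A. (\<forall>z\<in>E. g z = f0 z) \<and> (norm (mult_op k g h))\<^sup>2 < c\<^sup>2 * (norm h)\<^sup>2 + e"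
  shows "\<exists>g\<in>A. (\<forall>z\<in>E. g z = f0 z) \<and> onorm (mult_op k g) \<le> c"
proof -
  \<comment> \<open>Norm bound, additivity and conjugate homogeneity in \<open>y\<close>, multiplication rule, membership in cyclic
    subspaces, values on \<open>E\<close>.  Only finitely many \<open>u\<close> are constrained at a time, since the previous
    lemma controls a multiplier at finitely many vectors only.\<close>
  define P where "P W e = {F :: 'h \<times> 'h \<Rightarrow> complex. \<forall>u\<in>W. \<forall>y\<in>UNIV. (cmod (F (u, y)))\<^sup>2 \<le> (c\<^sup>2 * (norm u)\<^sup>2 + e) * (norm y)\<^sup>2}
    \<inter> {F. \<forall>u\<in>W. \<forall>y\<in>UNIV. \<forall>y'\<in>UNIV. F (u, y + y') = F (u, y) + F (u, y')}
    \<inter> {F. \<forall>u\<in>W. \<forall>a\<in>UNIV. \<forall>y\<in>UNIV. F (u, a *\<^sub>C y) = cnj a * F (u, y)}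
    \<inter> {F. \<forall>u\<in>W. \<forall>z\<in>{z. k z \<in> W}. F (u, k z) * cinner (k z) (k z) = F (k z, k z) * cinner u (k z)}
    \<inter> {F. \<forall>u\<in>W. \<forall>y\<in>{y. \<forall>f\<in>A. cinner (mult_op k f u) y = 0}. F (u, y) = 0}
    \<inter> {F. \<forall>z\<in>{z\<in>E. k z \<in> W}. F (k z, k z) = f0 z * cinner (k z) (k z)}" for W e
  define \<F> where "\<F> = (\<lambda>(W, e). P W e) ` {(W, e). finite W \<and> e > 0}"
  define bd where "bd = (\<lambda>(u :: 'h, y :: 'h). sqrt (c\<^sup>2 * (norm u)\<^sup>2 + 1) * norm y)"
  have "\<exists>F. (\<forall>i. cmod (F i) \<le> bd i) \<and> (\<forall>T\<in>\<F>. F \<in> T)"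
  proof (rule box_fip)
    fix T assume "T \<in> \<F>"
    then obtain W e where T: "T = P W e" by (auto simp: \<F>_def)
    show "closed T"
      unfolding T P_def
      by (intro closed_Int closed_Collect_Ball closed_Collect_eq closed_Collect_le continuous_intros) auto
  next
    fix \<G> assume "finite \<G>" "\<G> \<subseteq> \<F>"
    then obtain Q where Q: "finite Q" "Q \<subseteq> {(W, e). finite W \<and> e > 0}" and \<G>: "\<G> = (\<lambda>(W, e). P W e) ` Q"
      unfolding \<F>_def using finite_subset_image by meson
    define V where "V = (\<Union>q\<in>Q. fst q)"
    define e where "e = Min (insert 1 (snd ` Q))"
    have V: "finite V" using Q by (auto simp: V_def)
    have e: "e > 0" "e \<le> 1" using Q by (auto simp: e_def)
    obtain g where g: "g \<in> A" "\<forall>z\<in>E. g z = f0 z"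
      and gV: "\<forall>v\<in>V. (norm (mult_op k g v))\<^sup>2 < c\<^sup>2 * (norm v)\<^sup>2 + e"
      using simultaneous_bound[OF f0 E single V e(1)] by blast
    have pair: "(cmod (cinner (mult_op k g v) y))\<^sup>2 \<le> (c\<^sup>2 * (norm v)\<^sup>2 + e) * (norm y)\<^sup>2" if "v \<in> V" for v and y :: 'h
    proof -
      have "(cmod (cinner (mult_op k g v) y))\<^sup>2 \<le> (norm (mult_op k g v) * norm y)\<^sup>2"
        by (rule power_mono[OF cmod_cinner_le]) simp
      also have "\<dots> = (norm (mult_op k g v))\<^sup>2 * (norm y)\<^sup>2" by (rule power_mult_distrib)
      also have "\<dots> \<le> (c\<^sup>2 * (norm v)\<^sup>2 + e) * (norm y)\<^sup>2"
        using gV that by (intro mult_right_mono) (auto intro: less_imp_le)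
      finally show ?thesis .
    qed
    \<comment> \<open>Outside \<open>V\<close> there is no bound for \<open>g u\<close>, so the pairing is cut off there.\<close>
    define F where "F = (\<lambda>(u, y). if u \<in> V then cinner (mult_op k g u) y else 0)"
    show "\<exists>F. (\<forall>i. cmod (F i) \<le> bd i) \<and> (\<forall>T\<in>\<G>. F \<in> T)"
    proof (intro exI[of _ F] conjI allI ballI)
      fix i :: "'h \<times> 'h"
      obtain u y where i: "i = (u, y)" by (rule prod.exhaust)
      show "cmod (F i) \<le> bd i"
      proof (cases "u \<in> V")
        case True
        have "(c\<^sup>2 * (norm u)\<^sup>2 + e) * (norm y)\<^sup>2 \<le> (c\<^sup>2 * (norm u)\<^sup>2 + 1) * (norm y)\<^sup>2"
          using e by (intro mult_right_mono) auto
        then have "cmod (cinner (mult_op k g u) y) \<le> sqrt ((c\<^sup>2 * (norm u)\<^sup>2 + 1) * (norm y)\<^sup>2)"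
          using pair[OF True, of y] by (intro real_le_rsqrt) linarith
        then show ?thesis using True by (simp add: i F_def bd_def real_sqrt_mult)
      qed (simp add: i F_def bd_def)
    next
      fix T assume "T \<in> \<G>"
      then obtain W e' where Q': "(W, e') \<in> Q" and T: "T = P W e'" by (auto simp: \<G>)
      have WV: "W \<subseteq> V" using Q' by (force simp: V_def)
      have "e' \<in> snd ` Q" using Q' by force
      then have e': "e \<le> e'" unfolding e_def using Q(1) by (intro Min_le) auto
      have F: "F (u, y) = cinner (mult_op k g u) y" if "u \<in> W" for u y using that WV by (auto simp: F_def)
      show "F \<in> T"
        unfolding T P_def
      proof (intro IntI CollectI ballI)
        fix u y :: 'h assume u: "u \<in> W"
        have "(c\<^sup>2 * (norm u)\<^sup>2 + e) * (norm y)\<^sup>2 \<le> (c\<^sup>2 * (norm u)\<^sup>2 + e') * (norm y)\<^sup>2"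
          using e' by (intro mult_right_mono) auto
        then show "(cmod (F (u, y)))\<^sup>2 \<le> (c\<^sup>2 * (norm u)\<^sup>2 + e') * (norm y)\<^sup>2"
          using pair[of u y] WV u unfolding F[OF u] by (auto intro: order_trans)
      next
        fix u y y' assume u: "u \<in> W"
        show "F (u, y + y') = F (u, y) + F (u, y')" unfolding F[OF u] by (rule cinner_add_right)
      next
        fix u a y assume u: "u \<in> W"
        show "F (u, a *\<^sub>C y) = cnj a * F (u, y)" unfolding F[OF u] by (rule cinner_scaleC_right)
      next
        fix u z assume u: "u \<in> W" and "z \<in> {z. k z \<in> W}"
        then have z: "k z \<in> W" by simp
        show "F (u, k z) * cinner (k z) (k z) = F (k z, k z) * cinner u (k z)"
          unfolding F[OF u] F[OF z] by (simp add: A_value[OF g(1)])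
      next
        fix u y assume u: "u \<in> W" and "y \<in> {y. \<forall>f\<in>A. cinner (mult_op k f u) y = 0}"
        then show "F (u, y) = 0" unfolding F[OF u] using g(1) by simp
      next
        fix z assume "z \<in> {z\<in>E. k z \<in> W}"
        then have z: "z \<in> E" "k z \<in> W" by auto
        show "F (k z, k z) = f0 z * cinner (k z) (k z)"
          unfolding F[OF z(2)] using g(2) z(1) by (simp add: A_value[OF g(1)])
      qed
    qed
  qed
  then obtain F where "\<forall>T\<in>\<F>. F \<in> T" by (elim exE conjE) (rule that)
  then have FP: "F \<in> P W e" if "finite W" "e > 0" for W e using that unfolding \<F>_def by auto
  have F_add: "F (u, y + y') = F (u, y) + F (u, y')" for u y y'
    using FP[of "{u}" 1] unfolding P_def by simp
  have F_scale: "F (u, a *\<^sub>C y) = cnj a * F (u, y)" for u a y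
    using FP[of "{u}" 1] unfolding P_def by simp
  have F_mult: "F (u, k z) * cinner (k z) (k z) = F (k z, k z) * cinner u (k z)" for u z
    using FP[of "{u, k z}" 1] unfolding P_def by auto
  have F_orth: "F (u, y) = 0" if "\<forall>f\<in>A. cinner (mult_op k f u) y = 0" for u y
    using FP[of "{u}" 1] that unfolding P_def by simp
  have F_val: "F (k z, k z) = f0 z * cinner (k z) (k z)" if "z \<in> E" for z
    using FP[of "{k z}" 1] that unfolding P_def by simp
  have F_bound: "cmod (F (u, y)) \<le> c * norm u * norm y" for u y
  proof -
    have le: "(cmod (F (u, y)))\<^sup>2 \<le> (c\<^sup>2 * (norm u)\<^sup>2 + e) * (norm y)\<^sup>2" if "e > 0" for e
      using FP[of "{u}" e] that unfolding P_def by simp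
    have "(cmod (F (u, y)))\<^sup>2 \<le> c\<^sup>2 * (norm u)\<^sup>2 * (norm y)\<^sup>2 + e" if "e > 0" for e
    proof -
      have pos: "(norm y)\<^sup>2 + 1 > 0" by (simp add: add_nonneg_pos)
      have "e / ((norm y)\<^sup>2 + 1) * (norm y)\<^sup>2 \<le> e" using that pos by (simp add: field_simps)
      then show ?thesis using le[of "e / ((norm y)\<^sup>2 + 1)"] that pos by (simp add: distrib_right)
    qed
    then have "(cmod (F (u, y)))\<^sup>2 \<le> c\<^sup>2 * (norm u)\<^sup>2 * (norm y)\<^sup>2" by (rule field_le_epsilon)
    also have "\<dots> = (c * norm u * norm y)\<^sup>2" by (simp add: power_mult_distrib)
    finally show ?thesis by (rule power2_le_imp_le) (simp add: c)
  qed
  have "\<exists>v. norm v \<le> c * norm u \<and> (\<forall>y. cinner v y = F (u, y))" for u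
  proof -
    define S where "S = range (\<lambda>y. (y, cnj (F (u, y))))"
    have "\<exists>v \<in> closure (fst ` S). norm v \<le> c * norm u \<and> (\<forall>(y, l)\<in>S. cinner y v = l)"
    proof (rule riesz_on_graph)
      show "(0, 0) \<in> S" using F_scale[of u 0 0] by (auto simp: S_def intro!: image_eqI[of _ _ 0])
      show "(y + y', l + l') \<in> S" if "(y, l) \<in> S" "(y', l') \<in> S" for y l y' l'
        using that by (auto simp: S_def F_add)
      show "(a *\<^sub>C y, a * l) \<in> S" if "(y, l) \<in> S" for a y l
        using that by (auto simp: S_def F_scale)
      show "cmod l \<le> c * norm u * norm y" if "(y, l) \<in> S" for y l
        using that F_bound by (auto simp: S_def)
    qed (simp add: c)
    then obtain v where v: "norm v \<le> c * norm u" "\<forall>(y, l)\<in>S. cinner y v = l" by blast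
    have "cinner v y = F (u, y)" for y
    proof -
      have "cinner y v = cnj (F (u, y))" using v(2) by (auto simp: S_def)
      then show ?thesis using cinner_commute[of v y] by simp
    qed
    then show ?thesis using v(1) by blast
  qed
  then obtain T where T_norm: "\<And>u. norm (T u) \<le> c * norm u" and T: "\<And>u y. cinner (T u) y = F (u, y)"
    by metis
  define t where "t z = F (k z, k z) / cinner (k z) (k z)" for z
  have mult: "multiplies k t T"
    unfolding multiplies_def
  proof (intro allI)
    fix u z
    have "F (u, k z) * cinner (k z) (k z) = (t z * cinner u (k z)) * cinner (k z) (k z)"
      unfolding F_mult using kernel_self_nonzero[of z] by (simp add: t_def)
    then show "cinner (T u) (k z) = t z * cinner u (k z)"
      unfolding T using kernel_self_nonzero[of z] by simp
  qed
  have "t \<in> A"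
  proof (rule dual_subalgebra_reflexive[OF dual mult])
    fix u
    show "T u \<in> closure ((\<lambda>f. mult_op k f u) ` A)"
    proof (rule in_closed_subspaceI[OF complex_subspace_closure[OF ideal_orbit_subspace[of _ "{}", unfolded ideal_empty]] closed_closure])
      fix y assume y: "\<forall>z\<in>closure ((\<lambda>f. mult_op k f u) ` A). cinner z y = 0"
      have "cinner (mult_op k f u) y = 0" if "f \<in> A" for f
        using y closure_subset[of "(\<lambda>f. mult_op k f u) ` A"] that by blast
      then show "cinner (T u) y = 0" unfolding T using F_orth by blast
    qed
  qed
  moreover have "t z = f0 z" if "z \<in> E" for z
    using F_val[OF that] kernel_self_nonzero[of z] by (simp add: t_def)
  moreover have "onorm (mult_op k t) \<le> c"
    unfolding multiplies_imp_multiplier(2)[OF mult] by (rule onorm_bound[OF c T_norm])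
  ultimately show ?thesis by blast
qed

section \<open>Cyclic subspaces\<close>

abbreviation cyc :: "'h \<Rightarrow> 'h set" where
  "cyc h \<equiv> cyclic_subspace k A h"

lemma cyclic_ideal_subspace: "complex_subspace (cyclic_subspace k (ideal E) h)"
  unfolding cyclic_subspace_def by (rule complex_subspace_closure[OF ideal_orbit_subspace])

lemma cyclic_closed: "closed (cyclic_subspace k B h)"
  unfolding cyclic_subspace_def by (rule closed_closure)

lemma cyc_subspace: "complex_subspace (cyc h)"
  using cyclic_ideal_subspace[of "{}" h] by (simp add: ideal_empty)

lemma cyclic_generator: "f \<in> B \<Longrightarrow> mult_op k f h \<in> cyclic_subspace k B h"
  unfolding cyclic_subspace_def by (rule subsetD[OF closure_subset]) simp

lemma in_cyc: "h \<in> cyc h"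
  using cyclic_generator[OF A_one, of h] by (simp add: mult_op_one)

lemma mult_op_bounded_linear: "f \<in> A \<Longrightarrow> bounded_linear (mult_op k f)"
  by (rule mult_op_bounded[OF A_multiplier])

lemma mult_op_clinear: "f \<in> A \<Longrightarrow> mult_op k f \<in> bounded_clinear_ops"
  by (rule multiplies_bounded[OF A_mult])

lemma mult_op_closure:
  assumes f: "f \<in> A" and gen: "\<And>g. g \<in> B \<Longrightarrow> (\<lambda>x. f x * g x) \<in> B'" and B: "B \<subseteq> A"
    and x: "x \<in> cyclic_subspace k B h"
  shows "mult_op k f x \<in> cyclic_subspace k B' h"
proof -
  have "mult_op k f ` closure ((\<lambda>g. mult_op k g h) ` B) \<subseteq> cyclic_subspace k B' h"
  proof (rule image_closure_subset)
    show "continuous_on (closure ((\<lambda>g. mult_op k g h) ` B)) (mult_op k f)"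
      by (rule linear_continuous_on[OF mult_op_bounded_linear[OF f]])
    show "closed (cyclic_subspace k B' h)" by (rule cyclic_closed)
    show "mult_op k f ` (\<lambda>g. mult_op k g h) ` B \<subseteq> cyclic_subspace k B' h"
    proof
      fix y assume "y \<in> mult_op k f ` (\<lambda>g. mult_op k g h) ` B"
      then obtain g where g: "g \<in> B" "y = mult_op k f (mult_op k g h)" by blast
      then have "y = mult_op k (\<lambda>x. f x * g x) h" using mult_op_times[OF f, of g h] B by auto
      then show "y \<in> cyclic_subspace k B' h" using cyclic_generator[OF gen[OF g(1)]] by simp
    qed
  qed
  then show ?thesis using x unfolding cyclic_subspace_def by blast
qed

lemma mult_op_cyc: "f \<in> A \<Longrightarrow> x \<in> cyc h \<Longrightarrow> mult_op k f x \<in> cyc h"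
  by (rule mult_op_closure[of f A A]) (simp_all add: A_times)

lemma mult_op_ideal_cyc: "g \<in> ideal E \<Longrightarrow> x \<in> cyc h \<Longrightarrow> mult_op k g x \<in> cyclic_subspace k (ideal E) h"
  by (rule mult_op_closure[of g A]) (simp_all add: vanishing_ideal_def A_times)

lemma mult_op_cyc_ideal:
  "f \<in> A \<Longrightarrow> x \<in> cyclic_subspace k (ideal E) h \<Longrightarrow> mult_op k f x \<in> cyclic_subspace k (ideal E) h"
  by (rule mult_op_closure[of f "ideal E"]) (auto simp: vanishing_ideal_def A_times)

lemma cyclic_ideal_subset: "cyclic_subspace k (ideal E) h \<subseteq> cyc h"
  unfolding cyclic_subspace_def by (intro closure_mono image_mono) (auto simp: vanishing_ideal_def)

lemma quotient_space_iff:
  "x \<in> quotient_space k A E L \<longleftrightarrow> x \<in> L \<and> (\<forall>g\<in>ideal E. \<forall>y\<in>L. cinner x (mult_op k g y) = 0)"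
  unfolding quotient_space_def orth_diff_def by blast

lemma quotient_space_subspace:
  assumes "complex_subspace L"
  shows "complex_subspace (quotient_space k A E L)"
  using assms unfolding complex_subspace_def
  by (intro conjI ballI allI) (simp_all add: quotient_space_iff cinner_add_left cinner_scaleC_left)

lemma quotient_space_closed:
  assumes "closed L"
  shows "closed (quotient_space k A E L)"
proof -
  have "quotient_space k A E L = L \<inter> (\<Inter>g\<in>ideal E. \<Inter>y\<in>L. {x. cinner x (mult_op k g y) = 0})"
    by (auto simp: quotient_space_iff)
  moreover have "closed {x. cinner x (mult_op k g y) = 0}" for g y
    by (intro closed_Collect_eq continuous_intros)
  ultimately show ?thesis using assms by (simp add: closed_Int closed_INT)
qed

lemma residual_in_quotient:
  fixes x h :: 'h and E :: "'x set"
  assumes x: "x \<in> cyc h"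
  defines "y \<equiv> x - orth_proj (cyclic_subspace k (ideal E) h) x"
  shows "y \<in> quotient_space k A E (cyc h)" "norm y \<le> norm x"
    "\<And>p. p \<in> cyclic_subspace k (ideal E) h \<Longrightarrow> cinner y p = 0" "cinner y y = cinner y x"
proof -
  let ?M = "cyclic_subspace k (ideal E) h"
  have M: "complex_subspace ?M" "closed ?M" by (rule cyclic_ideal_subspace, rule cyclic_closed)
  show orth: "cinner y p = 0" if "p \<in> ?M" for p
    unfolding y_def by (rule orth_proj_orth[OF M that])
  have "orth_proj ?M x \<in> cyc h" using orth_proj_in[OF M, of x] cyclic_ideal_subset by blast
  then have "y \<in> cyc h" unfolding y_def by (rule complex_subspace_diff[OF cyc_subspace x])
  then show "y \<in> quotient_space k A E (cyc h)"
    unfolding quotient_space_iff using orth mult_op_ideal_cyc by blast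
  show yy: "cinner y y = cinner y x"
    using orth[OF orth_proj_in[OF M, of x]] by (simp add: y_def cinner_diff_right)
  have "(norm y)\<^sup>2 \<le> norm x * norm y"
    using cmod_cinner_le[of y x] cmod_cinner_self[of y] unfolding yy by (simp add: mult.commute)
  then show "norm y \<le> norm x" by (rule le_of_square_le) simp
qed

lemma approximate_in_closure:
  fixes y p :: 'h
  assumes y: "norm y \<le> a" and p: "p \<in> closure S" and e: "e > 0"
  shows "\<exists>s\<in>S. (norm (y + p - s))\<^sup>2 < a\<^sup>2 + e"
proof -
  have a: "a \<ge> 0" using y norm_ge_zero order_trans by blast
  define \<eta> where "\<eta> = min 1 (e / (2 * a + 1))"
  have \<eta>: "\<eta> > 0" "\<eta> \<le> 1" using e a by (auto simp: \<eta>_def)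
  have "\<eta> * (2 * a + 1) \<le> e / (2 * a + 1) * (2 * a + 1)"
    using a by (intro mult_right_mono) (simp_all add: \<eta>_def)
  then have \<eta>e: "\<eta> * (2 * a + 1) \<le> e" using a by simp
  obtain s where s: "s \<in> S" "dist s p < \<eta>" using p \<eta>(1) closure_approachable by blast
  have "norm (y + p - s) \<le> norm y + norm (p - s)" using norm_triangle_ineq[of y "p - s"] by (simp add: algebra_simps)
  also have "\<dots> < a + \<eta>" using y s(2) by (simp add: dist_norm norm_minus_commute)
  finally have "(norm (y + p - s))\<^sup>2 < (a + \<eta>)\<^sup>2" by (intro power_strict_mono) auto
  also have "(a + \<eta>)\<^sup>2 = a\<^sup>2 + \<eta> * (2 * a + \<eta>)" by (simp add: power2_eq_square algebra_simps)
  also have "\<dots> \<le> a\<^sup>2 + \<eta> * (2 * a + 1)" using \<eta> by (simp add: mult_left_mono)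
  also have "\<dots> \<le> a\<^sup>2 + e" using \<eta>e by simp
  finally show ?thesis using s(1) by blast
qed

text \<open>
  Subtract from \<open>f\<close> an element of the ideal that almost realises the projection of \<open>f h\<close> to the
  closed ideal orbit of \<open>h\<close>.
\<close>

lemma congruent_multiplier:
  assumes f: "f \<in> A" and e: "e > 0"
    and y: "norm (mult_op k f h - orth_proj (cyclic_subspace k (ideal E) h) (mult_op k f h)) \<le> a"
  shows "\<exists>g\<in>A. (\<forall>z\<in>E. g z = f z) \<and> (norm (mult_op k g h))\<^sup>2 < a\<^sup>2 + e"
proof -
  let ?M = "cyclic_subspace k (ideal E) h" and ?S = "(\<lambda>g. mult_op k g h) ` ideal E"
  define p where "p = orth_proj ?M (mult_op k f h)"
  have "p \<in> closure ?S"
    using orth_proj_in[OF cyclic_ideal_subspace cyclic_closed, of E h "mult_op k f h"]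
    by (simp add: p_def cyclic_subspace_def)
  from approximate_in_closure[OF y[folded p_def] this e]
  obtain g where g: "g \<in> ideal E" "(norm (mult_op k f h - p + p - mult_op k g h))\<^sup>2 < a\<^sup>2 + e" by blast
  then have "(norm (mult_op k (\<lambda>x. f x - g x) h))\<^sup>2 < a\<^sup>2 + e"
    using mult_op_diff[OF f, of g h] idealD(1)[OF g(1)] by simp
  moreover have "(\<lambda>x. f x - g x) \<in> A" using A_diff[OF f] idealD(1)[OF g(1)] by blast
  moreover have "\<forall>z\<in>E. f z - g z = f z" using idealD(2)[OF g(1)] by simp
  ultimately show ?thesis by (intro bexI[of _ "\<lambda>x. f x - g x"]) auto
qed

section \<open>The distance formula\<close>

lemma cadjoint_scaleR: "T \<in> bounded_clinear_ops \<Longrightarrow> cadjoint T (r *\<^sub>R x) = r *\<^sub>R cadjoint T x"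
proof (rule cinner_ext)
  fix z assume T: "T \<in> bounded_clinear_ops"
  have "cinner z (cadjoint T (r *\<^sub>R x)) = cinner z (r *\<^sub>R cadjoint T x)"
    by (simp add: cinner_cadjoint[OF T, symmetric] cinner_scaleR_right)
  then show "cinner (cadjoint T (r *\<^sub>R x)) z = cinner (r *\<^sub>R cadjoint T x) z"
    by (metis cinner_commute)
qed

lemma orth_proj_scaleR:
  assumes "complex_subspace N" "closed N"
  shows "orth_proj N (r *\<^sub>R x) = r *\<^sub>R orth_proj N x"
proof (rule orth_proj_unique[OF assms])
  show "r *\<^sub>R orth_proj N x \<in> N"
    using orth_proj_in[OF assms, of x] assms(1) unfolding complex_subspace_def scaleC_of_real[symmetric] by blast
  show "cinner (r *\<^sub>R x - r *\<^sub>R orth_proj N x) z = 0" if "z \<in> N" for z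
    using orth_proj_orth[OF assms that, of x]
    by (simp add: cinner_scaleR_left flip: scaleR_diff_right)
qed

context
  fixes f :: "'x \<Rightarrow> complex" and E :: "'x set" and h :: 'h and N :: "'h set" and T :: "'h \<Rightarrow> 'h"
  assumes f: "f \<in> A"
  defines "N \<equiv> quotient_space k A E (cyc h)"
    and "T \<equiv> (\<lambda>x. orth_proj N (cadjoint (mult_op k f) x))"
begin

lemma N_subspace: "complex_subspace N" "closed N"
  unfolding N_def by (rule quotient_space_subspace[OF cyc_subspace], rule quotient_space_closed[OF cyclic_closed])

text \<open>
  For \<open>g\<close> in the ideal, \<open>x\<close> is orthogonal to \<open>g (T x)\<close>; hence \<open>\<langle>T x, T x\<rangle> = \<langle>f (T x), x\<rangle>\<close> does not change
  when \<open>f\<close> is replaced by \<open>f - g\<close>.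
\<close>

lemma compression_le:
  assumes x: "x \<in> N" and g: "g \<in> ideal E"
  shows "norm (T x) \<le> onorm (\<lambda>h. mult_op k f h - mult_op k g h) * norm x"
proof -
  let ?D = "\<lambda>h. mult_op k f h - mult_op k g h"
  have gA: "g \<in> A" by (rule idealD(1)[OF g])
  have bl: "bounded_linear ?D"
    by (rule bounded_linear_sub[OF mult_op_bounded_linear[OF f] mult_op_bounded_linear[OF gA]])
  have TN: "T x \<in> N" unfolding T_def by (rule orth_proj_in[OF N_subspace])
  have "cinner x (mult_op k g (T x)) = 0"
    using x g TN unfolding N_def quotient_space_iff by blast
  then have gx: "cinner (mult_op k g (T x)) x = 0" using cinner_commute by (metis complex_cnj_zero)
  have "cinner (T x) (T x) = cinner (T x) (cadjoint (mult_op k f) x)"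
    using cinner_orth_proj(2)[OF N_subspace TN, of "cadjoint (mult_op k f) x"] by (simp add: T_def)
  also have "\<dots> = cinner (mult_op k f (T x)) x"
    by (rule cinner_cadjoint[OF mult_op_clinear[OF f], symmetric])
  also have "\<dots> = cinner (?D (T x)) x" using gx by (simp add: cinner_diff_left)
  finally have "(norm (T x))\<^sup>2 = cmod (cinner (?D (T x)) x)" using cmod_cinner_self by metis
  also have "\<dots> \<le> norm (?D (T x)) * norm x" by (rule cmod_cinner_le)
  also have "\<dots> \<le> (onorm ?D * norm (T x)) * norm x"
    by (rule mult_right_mono[OF onorm[OF bl]]) simp
  finally have "(norm (T x))\<^sup>2 \<le> (onorm ?D * norm x) * norm (T x)" by (simp add: mult_ac)
  then show ?thesis by (rule le_of_square_le) (simp add: onorm_pos_le[OF bl])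
qed

lemma unit_ball_nonempty: "{x \<in> N. norm x \<le> 1} \<noteq> {}"
proof -
  have "0 \<in> N" using N_subspace(1) unfolding complex_subspace_def by blast
  then show ?thesis by (auto intro!: exI[of _ 0])
qed

lemma norm_on_compression_le:
  assumes g: "g \<in> ideal E"
  shows "norm_on N T \<le> onorm (\<lambda>h. mult_op k f h - mult_op k g h)"
  unfolding norm_on_def
proof (rule cSUP_least[OF unit_ball_nonempty])
  fix x assume x: "x \<in> {x \<in> N. norm x \<le> 1}"
  have "bounded_linear (\<lambda>h. mult_op k f h - mult_op k g h)"
    by (rule bounded_linear_sub[OF mult_op_bounded_linear[OF f] mult_op_bounded_linear[OF idealD(1)[OF g]]])
  from onorm_pos_le[OF this] show "norm (T x) \<le> onorm (\<lambda>h. mult_op k f h - mult_op k g h)"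
    using compression_le[OF _ g, of x] x
      mult_left_mono[of "norm x" 1 "onorm (\<lambda>h. mult_op k f h - mult_op k g h)"] by simp
qed

lemma norm_on_compression_ge:
  assumes x: "x \<in> N"
  shows "norm (T x) \<le> norm_on N T * norm x"
proof (cases "x = 0")
  case True
  have "0 *\<^sub>R x = x" by (simp add: True)
  then have "T x = 0 *\<^sub>R T x"
    unfolding T_def using orth_proj_scaleR[OF N_subspace, of 0] cadjoint_scaleR[OF mult_op_clinear[OF f], of 0 x]
    by metis
  then show ?thesis using True by simp
next
  case False
  have bdd: "bdd_above ((\<lambda>x. norm (T x)) ` {x \<in> N. norm x \<le> 1})"
  proof (rule bdd_aboveI2)
    fix y assume y: "y \<in> {x \<in> N. norm x \<le> 1}"
    let ?B = "onorm (\<lambda>h. mult_op k f h - mult_op k (\<lambda>x. 0 * 1) h)"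
    have "norm (T y) \<le> ?B * norm y" using compression_le[OF _ ideal_zero, of y] y by blast
    also have "\<dots> \<le> \<bar>?B\<bar> * 1" by (rule mult_mono) (use y in auto)
    finally show "norm (T y) \<le> \<bar>?B\<bar>" by simp
  qed
  define y where "y = (1 / norm x) *\<^sub>R x"
  have "y \<in> N"
    using N_subspace(1) x unfolding y_def complex_subspace_def scaleC_of_real[symmetric] by blast
  then have "norm (T y) \<le> norm_on N T"
    unfolding norm_on_def using False by (intro cSUP_upper bdd) (simp add: y_def)
  moreover have "T y = (1 / norm x) *\<^sub>R T x"
    unfolding T_def y_def cadjoint_scaleR[OF mult_op_clinear[OF f]] orth_proj_scaleR[OF N_subspace] ..
  ultimately show ?thesis using False by (simp add: field_simps)
qed

lemma norm_on_compression_nonneg: "0 \<le> norm_on N T"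
proof (cases "\<exists>x\<in>N. x \<noteq> 0")
  case True
  then obtain x where "x \<in> N" "x \<noteq> 0" by blast
  then show ?thesis using norm_on_compression_ge[of x]
    by (meson norm_ge_zero order_trans zero_le_mult_iff zero_less_norm_iff not_le)
next
  case False
  then have "{x \<in> N. norm x \<le> 1} = {0}" using unit_ball_nonempty by auto
  then show ?thesis unfolding norm_on_def by simp
qed

text \<open>
  Let \<open>y\<close> and \<open>h'\<close> be the residuals of \<open>f h\<close> and \<open>h\<close> modulo the closed ideal orbit.  Since \<open>f\<close> maps this
  orbit into itself and \<open>y\<close> is orthogonal to it, \<open>\<langle>y, y\<rangle> = \<langle>y, f h'\<rangle>\<close>, and here the adjoint of \<open>f\<close> can be
  compressed to \<open>N\<close>, which contains both residuals.
\<close>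

lemma residual_le:
  "norm (mult_op k f h - orth_proj (cyclic_subspace k (ideal E) h) (mult_op k f h)) \<le> norm_on N T * norm h"
proof -
  let ?M = "cyclic_subspace k (ideal E) h"
  define y where "y = mult_op k f h - orth_proj ?M (mult_op k f h)"
  define h' where "h' = h - orth_proj ?M h"
  note y = residual_in_quotient[where x = "mult_op k f h" and h = h and E = E,
      OF mult_op_cyc[OF f in_cyc], folded y_def N_def]
  note h' = residual_in_quotient[where x = h and h = h and E = E, OF in_cyc, folded h'_def N_def]
  have "orth_proj ?M h \<in> ?M" by (rule orth_proj_in[OF cyclic_ideal_subspace cyclic_closed])
  then have "cinner y (mult_op k f (orth_proj ?M h)) = 0" by (intro y(3) mult_op_cyc_ideal[OF f])
  moreover have "mult_op k f h = mult_op k f h' + mult_op k f (orth_proj ?M h)"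
    unfolding multiplies_add[OF A_mult[OF f], symmetric] by (simp add: h'_def)
  ultimately have "cinner y y = cinner y (mult_op k f h')" using y(4) by (simp add: cinner_add_right)
  also have "\<dots> = cnj (cinner (mult_op k f h') y)" by (rule cinner_commute)
  also have "cinner (mult_op k f h') y = cinner h' (cadjoint (mult_op k f) y)"
    by (rule cinner_cadjoint[OF mult_op_clinear[OF f]])
  also have "\<dots> = cinner h' (T y)"
    unfolding T_def by (rule cinner_orth_proj(2)[OF N_subspace h'(1), symmetric])
  finally have "(norm y)\<^sup>2 = cmod (cinner h' (T y))" using cmod_cinner_self[of y] by simp
  also have "\<dots> \<le> norm h' * norm (T y)" by (rule cmod_cinner_le)
  also have "\<dots> \<le> norm h * (norm_on N T * norm y)"
    by (rule mult_mono[OF h'(2) norm_on_compression_ge[OF y(1)]]) auto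
  finally have "(norm y)\<^sup>2 \<le> (norm_on N T * norm h) * norm y" by (simp add: mult_ac)
  then have "norm y \<le> norm_on N T * norm h"
    by (rule le_of_square_le) (simp add: norm_on_compression_nonneg)
  then show ?thesis by (simp add: y_def)
qed

end

text \<open>
  The compressions only see \<open>f\<close> modulo the ideal, so they are bounded by the distance.  Conversely
  their supremum bounds all residuals, and \<open>interpolant_exists\<close> turns that into one multiplier.
\<close>

theorem distance_formula:
  assumes E: "finite E" and f: "f \<in> A"
  shows "mult_dist k f (ideal E) = (SUP L\<in>CycLat k A. let N = quotient_space k A E L in
    norm_on N (\<lambda>x. orth_proj N (cadjoint (mult_op k f) x)))"
proof -
  define \<nu> where "\<nu> h = norm_on (quotient_space k A E (cyc h))
      (\<lambda>x. orth_proj (quotient_space k A E (cyc h)) (cadjoint (mult_op k f) x))" for h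
  define \<sigma> where "\<sigma> = (SUP h. \<nu> h)"
  have rhs: "(SUP L\<in>CycLat k A. let N = quotient_space k A E L in
    norm_on N (\<lambda>x. orth_proj N (cadjoint (mult_op k f) x))) = \<sigma>"
    unfolding \<sigma>_def \<nu>_def CycLat_def Let_def by (simp add: image_image)
  have le: "\<nu> h \<le> onorm (\<lambda>h. mult_op k f h - mult_op k g h)" if "g \<in> ideal E" for g h
    unfolding \<nu>_def by (rule norm_on_compression_le[OF f that])
  have bdd: "bdd_above (range \<nu>)" by (rule bdd_aboveI2) (rule le[OF ideal_zero])
  have \<nu>\<sigma>: "\<nu> h \<le> \<sigma>" for h unfolding \<sigma>_def by (rule cSUP_upper[OF UNIV_I bdd])
  have \<sigma>0: "\<sigma> \<ge> 0" using norm_on_compression_nonneg[OF f] \<nu>\<sigma> unfolding \<nu>_def by (rule order_trans)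
  have bl: "bounded_linear (\<lambda>h. mult_op k f h - mult_op k g h)" if "g \<in> ideal E" for g
    by (rule bounded_linear_sub[OF mult_op_bounded_linear[OF f] mult_op_bounded_linear[OF idealD(1)[OF that]]])
  have "\<exists>g\<in>A. (\<forall>z\<in>E. g z = f z) \<and> onorm (mult_op k g) \<le> \<sigma>"
  proof (rule interpolant_exists[OF f E \<sigma>0])
    fix h and e :: real assume e: "e > 0"
    have "norm (mult_op k f h - orth_proj (cyclic_subspace k (ideal E) h) (mult_op k f h)) \<le> \<nu> h * norm h"
      unfolding \<nu>_def by (rule residual_le[OF f])
    also have "\<dots> \<le> \<sigma> * norm h" using \<nu>\<sigma> by (simp add: mult_right_mono)
    finally show "\<exists>g\<in>A. (\<forall>z\<in>E. g z = f z) \<and> (norm (mult_op k g h))\<^sup>2 < \<sigma>\<^sup>2 * (norm h)\<^sup>2 + e"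
      using congruent_multiplier[OF f e, where h = h and E = E and a = "\<sigma> * norm h"]
      by (simp add: power_mult_distrib)
  qed
  then obtain G where G: "G \<in> A" "\<forall>z\<in>E. G z = f z" "onorm (mult_op k G) \<le> \<sigma>" by blast
  define g where "g x = f x - G x" for x
  have g: "g \<in> ideal E" using G(2) A_diff[OF f G(1)] by (simp add: g_def[abs_def] vanishing_ideal_def)
  have fg: "mult_op k f h - mult_op k g h = mult_op k G h" for h
    unfolding g_def[abs_def] mult_op_diff[OF f G(1)] by simp
  have "mult_dist k f (ideal E) = \<sigma>"
    unfolding mult_dist_def
  proof (rule antisym)
    have "bdd_below ((\<lambda>g. onorm (\<lambda>h. mult_op k f h - mult_op k g h)) ` ideal E)"
      by (rule bdd_belowI2[of _ 0]) (rule onorm_pos_le[OF bl])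
    from cINF_lower[OF this g]
    show "(INF g\<in>ideal E. onorm (\<lambda>h. mult_op k f h - mult_op k g h)) \<le> \<sigma>"
      using G(3) unfolding fg by linarith
    show "\<sigma> \<le> (INF g\<in>ideal E. onorm (\<lambda>h. mult_op k f h - mult_op k g h))"
    proof (rule cINF_greatest)
      show "ideal E \<noteq> {}" using ideal_zero by blast
      show "\<sigma> \<le> onorm (\<lambda>h. mult_op k f h - mult_op k g h)" if "g \<in> ideal E" for g
        unfolding \<sigma>_def by (rule cSUP_least) (simp_all add: le[OF that])
    qed
  qed
  then show ?thesis unfolding rhs .
qed

text \<open>
  The closed ideal orbit of \<open>h\<close> depends on \<open>h\<close> only through its cyclic subspace, so the required
  vectors can be chosen for each subspace.
\<close>

lemma cyclic_kernels_exist: "\<exists>K. cyclic_kernels k A K"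
proof -
  define C where "C h x v \<longleftrightarrow> (if orth_proj (cyc h) (k x) \<noteq> 0 then v = orth_proj (cyc h) (k x)
      else if cyclic_subspace k (ideal {x}) h \<noteq> cyc h
        then v \<in> orth_diff (cyc h) (cyclic_subspace k (ideal {x}) h) \<and> norm v = 1 else v = 0)" for h x v
  have sub: "cyclic_subspace k (ideal E) h \<subseteq> cyclic_subspace k (ideal E) h'" if "cyc h = cyc h'" for E h h'
  proof -
    have "h \<in> cyc h'" using in_cyc[of h] that by simp
    then have "(\<lambda>g. mult_op k g h) ` ideal E \<subseteq> cyclic_subspace k (ideal E) h'"
      using mult_op_ideal_cyc by blast
    then show ?thesis
      unfolding cyclic_subspace_def[of k "ideal E" h] by (rule closure_minimal[OF _ cyclic_closed])
  qed
  have ex: "\<exists>v. C h x v" for h x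
  proof (cases "cyclic_subspace k (ideal {x}) h = cyc h")
    case True
    then show ?thesis by (auto simp: C_def)
  next
    case False
    let ?M = "cyclic_subspace k (ideal {x}) h"
    obtain y where y: "y \<in> cyc h" "y \<notin> ?M" using False cyclic_ideal_subset by blast
    define d where "d = y - orth_proj ?M y"
    have M: "complex_subspace ?M" "closed ?M" by (rule cyclic_ideal_subspace, rule cyclic_closed)
    have "d \<noteq> 0" using y(2) orth_proj_in[OF M, of y] by (auto simp: d_def)
    have d: "d \<in> cyc h" "\<And>p. p \<in> ?M \<Longrightarrow> cinner d p = 0"
      using residual_in_quotient[where x = y and h = h and E = "{x}", OF y(1), folded d_def] unfolding quotient_space_iff by blast+
    define v where "v = (1 / norm d) *\<^sub>R d"
    have "v \<in> cyc h"
      using cyc_subspace[of h] d(1) unfolding v_def complex_subspace_def scaleC_of_real[symmetric] by blast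
    then have "v \<in> orth_diff (cyc h) ?M" "norm v = 1"
      using d(2) \<open>d \<noteq> 0\<close> by (simp_all add: orth_diff_def v_def cinner_scaleR_left)
    then show ?thesis by (auto simp: C_def)
  qed
  have "\<exists>v. \<forall>h. cyc h = L \<longrightarrow> C h x v" for L x
  proof (cases "\<exists>h. cyc h = L")
    case True
    then obtain h0 where h0: "cyc h0 = L" by blast
    obtain v where v: "C h0 x v" using ex by blast
    have "C h x v" if "cyc h = L" for h
    proof -
      have "cyclic_subspace k (ideal {x}) h = cyclic_subspace k (ideal {x}) h0"
        by (rule antisym; rule sub; simp add: that h0)
      then show ?thesis using v unfolding C_def that h0 by simp
    qed
    then show ?thesis by blast
  qed blast
  then obtain K where K: "\<forall>L x h. cyc h = L \<longrightarrow> C h x (K L x)" by metis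
  then have "cyclic_kernels k A K"
    unfolding cyclic_kernels_def Let_def C_def by simp
  then show ?thesis by blast
qed

section \<open>Interpolation\<close>

lemma pick_form:
  assumes L: "complex_subspace L" "closed L"
  shows "herm_form I (\<lambda>i j. (1 - w i * cnj (w j)) * cinner (orth_proj L (k (z j))) (k (z i))) c c
    = of_real ((norm (\<Sum>j\<in>I. c j *\<^sub>C orth_proj L (k (z j))))\<^sup>2
      - (norm (\<Sum>j\<in>I. (c j * cnj (w j)) *\<^sub>C orth_proj L (k (z j))))\<^sup>2)"
proof -
  let ?v = "\<lambda>j. orth_proj L (k (z j))"
  have "cinner (?v j) (k (z i)) = cinner (?v j) (?v i)" for i j
    by (rule cinner_orth_proj(2)[OF L orth_proj_in[OF L], symmetric])
  then have "herm_form I (\<lambda>i j. (1 - w i * cnj (w j)) * cinner (?v j) (k (z i))) c c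
      = herm_form I (\<lambda>i j. cinner (?v j) (?v i)) c c
        - herm_form I (\<lambda>i j. cinner (cnj (w j) *\<^sub>C ?v j) (cnj (w i) *\<^sub>C ?v i)) c c"
    unfolding herm_form_diff_matrix[symmetric]
    by (intro herm_form_cong) (simp add: cinner_scaleC_left cinner_scaleC_right algebra_simps)
  then show ?thesis unfolding herm_form_gram cinner_self scaleC_scaleC by simp
qed

text \<open>
  Projected kernel functions are eigenvectors of the compressed adjoint of \<open>f\<close>, with eigenvalues
  \<open>cnj (w i)\<close>.  So the Pick form at \<open>c\<close> is \<open>\<parallel>x\<parallel>\<^sup>2 - \<parallel>y\<parallel>\<^sup>2\<close>, where \<open>y\<close> is the image of \<open>x\<close>.
\<close>

lemma interpolation_necessary:
  assumes f: "f \<in> A" "onorm (mult_op k f) \<le> 1" and w: "\<And>i. i \<in> I \<Longrightarrow> f (z i) = w i"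
  shows "psd_on I (\<lambda>i j. (1 - w i * cnj (w j)) * cinner (orth_proj (cyc h) (k (z j))) (k (z i)))"
proof (rule psd_onI[OF pick_form[OF cyc_subspace cyclic_closed]])
  fix c
  let ?v = "\<lambda>j. orth_proj (cyc h) (k (z j))"
  define x where "x = (\<Sum>j\<in>I. c j *\<^sub>C ?v j)"
  define y where "y = (\<Sum>j\<in>I. (c j * cnj (w j)) *\<^sub>C ?v j)"
  have L: "complex_subspace (cyc h)" "closed (cyc h)" by (rule cyc_subspace, rule cyclic_closed)
  have "y \<in> cyc h"
  proof -
    have "(\<Sum>j\<in>J. (c j * cnj (w j)) *\<^sub>C ?v j) \<in> cyc h" for J
      using L(1) orth_proj_in[OF L] unfolding complex_subspace_def
      by (induction J rule: infinite_finite_induct) auto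
    then show ?thesis by (simp add: y_def)
  qed
  have pair: "cinner u (?v j) = cinner u (k (z j))" if "u \<in> cyc h" for u j
    by (rule cinner_orth_proj(2)[OF L that])
  have "cinner (mult_op k f y) x = (\<Sum>j\<in>I. cnj (c j) * cinner (mult_op k f y) (k (z j)))"
    by (simp add: x_def cinner_sum_right cinner_scaleC_right pair[OF mult_op_cyc[OF f(1) \<open>y \<in> cyc h\<close>]])
  also have "\<dots> = (\<Sum>j\<in>I. cnj (c j * cnj (w j)) * cinner y (?v j))"
    unfolding A_value[OF f(1)] pair[OF \<open>y \<in> cyc h\<close>] by (intro sum.cong refl) (simp add: w)
  also have "\<dots> = cinner y y"
    by (subst (3) y_def) (simp add: cinner_sum_right cinner_scaleC_right)
  finally have "(norm y)\<^sup>2 = cmod (cinner (mult_op k f y) x)" by (simp add: cmod_cinner_self)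
  also have "\<dots> \<le> norm (mult_op k f y) * norm x" by (rule cmod_cinner_le)
  also have "\<dots> \<le> norm y * norm x"
    using onorm[OF mult_op_bounded_linear[OF f(1)], of y] mult_right_mono[OF f(2), of "norm y"]
    by (intro mult_right_mono) simp_all
  finally have "(norm y)\<^sup>2 \<le> norm x * norm y" by (simp add: mult.commute)
  then have "norm y \<le> norm x" by (rule le_of_square_le) simp
  then show "0 \<le> (norm (\<Sum>j\<in>I. c j *\<^sub>C ?v j))\<^sup>2 - (norm (\<Sum>j\<in>I. (c j * cnj (w j)) *\<^sub>C ?v j))\<^sup>2"
    by (simp add: x_def y_def power_mono)
qed

lemma lagrange_basis:
  assumes I: "finite I" and inj: "inj_on z I" and sep: "separates A (z ` I)"
  shows "\<exists>e. \<forall>i\<in>I. e i \<in> A \<and> (\<forall>j\<in>I. e i (z j) = (if i = j then 1 else 0))"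
proof -
  have "\<exists>l. l \<in> A \<and> (i \<in> I \<longrightarrow> j \<in> I \<longrightarrow> i \<noteq> j \<longrightarrow> l (z i) = 1 \<and> l (z j) = 0)" for i j
  proof (cases "i \<in> I \<and> j \<in> I \<and> i \<noteq> j")
    case True
    then have "z i \<noteq> z j" using inj by (auto dest: inj_onD)
    then obtain a where a: "a \<in> A" "a (z i) \<noteq> a (z j)" using sep True unfolding separates_def by blast
    define l where "l x = (1 / (a (z i) - a (z j))) * (a x - a (z j) * 1)" for x
    have "l \<in> A" unfolding l_def[abs_def] by (intro A_scale A_diff a A_one)
    moreover have "l (z i) = 1" "l (z j) = 0" using a(2) by (simp_all add: l_def)
    ultimately show ?thesis by blast
  next
    case False
    then show ?thesis using A_one by blast
  qed
  then obtain l where l: "\<And>i j. l i j \<in> A"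
    "\<And>i j. i \<in> I \<Longrightarrow> j \<in> I \<Longrightarrow> i \<noteq> j \<Longrightarrow> l i j (z i) = 1 \<and> l i j (z j) = 0" by metis
  define e where "e i x = (\<Prod>j\<in>I - {i}. l i j x)" for i x
  have "e i \<in> A" for i unfolding e_def[abs_def] by (rule A_prod) (use I l in auto)
  moreover have "e i (z j) = (if i = j then 1 else 0)" if "i \<in> I" "j \<in> I" for i j
  proof (cases "i = j")
    case True
    have "(\<Prod>m\<in>I - {i}. l i m (z j)) = 1"
    proof (rule prod.neutral, intro ballI)
      fix m assume "m \<in> I - {i}"
      then show "l i m (z j) = 1" using l(2)[of i m] that True by auto
    qed
    then show ?thesis using True by (simp add: e_def)
  next
    case False
    have "(\<Prod>m\<in>I - {i}. l i m (z j)) = 0"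
      by (rule prod_zero) (use I False l(2)[OF that False] that in auto)
    then show ?thesis using False by (simp add: e_def)
  qed
  ultimately show ?thesis by blast
qed

text \<open>
  If \<open>h\<close> has no zeros on the interpolation set, the residual \<open>y\<close> of \<open>f h\<close> is a combination of projected
  kernel functions with coefficients \<open>d\<close>: both sides have the same inner products with the orbit of
  \<open>h\<close>, which depend on finitely many values only.  The Pick form at \<open>d\<close> compares \<open>y\<close> with the image \<open>x\<close> of
  \<open>y\<close> under the compressed adjoint of \<open>f\<close>, and \<open>\<langle>y, y\<rangle> = \<langle>y, f h\<rangle> = \<langle>x, h\<rangle>\<close>.
\<close>

lemma interpolation_sufficient:
  assumes I: "finite I" and inj: "inj_on z I" and sep: "separates A (z ` I)"
    and pick: "\<And>h. (\<forall>i\<in>I. cinner h (k (z i)) \<noteq> 0) \<Longrightarrow>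
      psd_on I (\<lambda>i j. (1 - w i * cnj (w j)) * cinner (orth_proj (cyc h) (k (z j))) (k (z i)))"
  shows "\<exists>f\<in>A. onorm (mult_op k f) \<le> 1 \<and> (\<forall>i\<in>I. f (z i) = w i)"
proof -
  obtain e where e: "\<And>i. i \<in> I \<Longrightarrow> e i \<in> A"
    and e_val: "\<And>i j. i \<in> I \<Longrightarrow> j \<in> I \<Longrightarrow> e i (z j) = (if i = j then 1 else 0)"
    using lagrange_basis[OF I inj sep] by metis
  have comb_val: "(\<Sum>i\<in>I. a i * e i (z j)) = a j" if "j \<in> I" for a j
  proof -
    have "(\<Sum>i\<in>I. a i * e i (z j)) = (\<Sum>i\<in>I. if i = j then a j else 0)"
      using that by (intro sum.cong refl) (simp add: e_val)
    then show ?thesis using I that by simp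
  qed
  have comb_A: "(\<lambda>x. \<Sum>i\<in>I. a i * e i x) \<in> A" for a by (rule A_sum) (rule A_scale[OF e])
  define f where "f x = (\<Sum>i\<in>I. w i * e i x)" for x
  have f: "f \<in> A" unfolding f_def[abs_def] by (rule comb_A)
  have f_val: "f (z i) = w i" if "i \<in> I" for i unfolding f_def by (rule comb_val[OF that])
  have "\<exists>g\<in>A. (\<forall>x\<in>z ` I. g x = f x) \<and> onorm (mult_op k g) \<le> 1"
  proof (rule interpolant_exists[OF f])
    fix h and \<epsilon> :: real assume \<epsilon>: "\<epsilon> > 0" and "\<forall>x\<in>z ` I. cinner h (k x) \<noteq> 0"
    then have nz: "\<forall>i\<in>I. cinner h (k (z i)) \<noteq> 0" by simp
    let ?M = "cyclic_subspace k (ideal (z ` I)) h" and ?v = "\<lambda>j. orth_proj (cyc h) (k (z j))"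
    have L: "complex_subspace (cyc h)" "closed (cyc h)" by (rule cyc_subspace, rule cyclic_closed)
    define y where "y = mult_op k f h - orth_proj ?M (mult_op k f h)"
    note y = residual_in_quotient[where x = "mult_op k f h" and h = h and E = "z ` I",
        OF mult_op_cyc[OF f in_cyc], folded y_def]
    have yL: "y \<in> cyc h" using y(1) by (simp add: quotient_space_iff)
    define d where "d i = cinner y (mult_op k (e i) h) / cnj (cinner h (k (z i)))" for i
    have v_pair: "cinner (?v i) (mult_op k u h) = cnj (u (z i) * cinner h (k (z i)))" if "u \<in> A" for u i
    proof -
      have "cinner (?v i) (mult_op k u h) = cinner (k (z i)) (mult_op k u h)"
        by (rule cinner_orth_proj(1)[OF L cyclic_generator[OF that]])
      also have "\<dots> = cnj (cinner (mult_op k u h) (k (z i)))" by (rule cinner_commute)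
      finally show ?thesis by (simp add: A_value[OF that])
    qed
    have y_pair: "cinner y (mult_op k u h) = (\<Sum>i\<in>I. d i * cnj (u (z i) * cinner h (k (z i))))" if u: "u \<in> A" for u
    proof -
      define u' where "u' x = u x - (\<Sum>i\<in>I. u (z i) * e i x)" for x
      have "u' \<in> ideal (z ` I)"
        using A_diff[OF u comb_A[of "\<lambda>i. u (z i)"]] comb_val[of _ "\<lambda>i. u (z i)"]
        by (auto simp: vanishing_ideal_def u'_def[abs_def])
      from y(3)[OF cyclic_generator[OF this]]
      have "cinner y (mult_op k u h) = cinner y (mult_op k (\<lambda>x. \<Sum>i\<in>I. u (z i) * e i x) h)"
        unfolding u'_def[abs_def] mult_op_diff[OF u comb_A] by (simp add: cinner_diff_right)
      also have "mult_op k (\<lambda>x. \<Sum>i\<in>I. u (z i) * e i x) h = (\<Sum>i\<in>I. u (z i) *\<^sub>C mult_op k (e i) h)"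
        by (rule kernel_ext)
           (simp only: A_value[OF comb_A] cinner_sum_left cinner_scaleC_left sum_distrib_right,
            intro sum.cong refl, simp add: A_value[OF e])
      also have "cinner y \<dots> = (\<Sum>i\<in>I. cnj (u (z i)) * cinner y (mult_op k (e i) h))"
        by (simp add: cinner_sum_right cinner_scaleC_right)
      also have "\<dots> = (\<Sum>i\<in>I. d i * cnj (u (z i) * cinner h (k (z i))))"
        using nz by (intro sum.cong refl) (simp add: d_def)
      finally show ?thesis .
    qed
    have comb_L: "(\<Sum>i\<in>J. a i *\<^sub>C ?v i) \<in> cyc h" for J a
      using L(1) orth_proj_in[OF L] unfolding complex_subspace_def
      by (induction J rule: infinite_finite_induct) auto
    define y' where "y' = y - (\<Sum>i\<in>I. d i *\<^sub>C ?v i)"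
    have "y' \<in> cyc h" unfolding y'_def by (rule complex_subspace_diff[OF L(1) yL comb_L])
    moreover have "cyc h \<subseteq> {x. cinner y' x = 0}"
      unfolding cyclic_subspace_def
    proof (rule closure_minimal)
      show "closed {x. cinner y' x = 0}" by (intro closed_Collect_eq continuous_intros)
      show "(\<lambda>u. mult_op k u h) ` A \<subseteq> {x. cinner y' x = 0}"
        by (auto simp: y'_def cinner_diff_left cinner_sum_left cinner_scaleC_left y_pair v_pair)
    qed
    ultimately have "cinner y' y' = 0" by blast
    then have y_eq: "y = (\<Sum>i\<in>I. d i *\<^sub>C ?v i)" by (simp add: y'_def cinner_self)
    define x where "x = (\<Sum>i\<in>I. (d i * cnj (w i)) *\<^sub>C ?v i)"
    have "norm x \<le> norm y"
    proof -
      have "0 \<le> Re (herm_form I (\<lambda>i j. (1 - w i * cnj (w j)) * cinner (?v j) (k (z i))) d d)"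
        by (rule psd_form_real(2)[OF pick[OF nz]])
      then have "(norm x)\<^sup>2 \<le> (norm y)\<^sup>2" unfolding pick_form[OF L] x_def y_eq by simp
      then show ?thesis by (rule power2_le_imp_le) simp
    qed
    have "cinner y y = cinner x h"
    proof -
      have "cinner y y = (\<Sum>i\<in>I. d i * cnj (f (z i) * cinner h (k (z i))))"
        unfolding y(4) by (rule y_pair[OF f])
      also have "\<dots> = (\<Sum>i\<in>I. (d i * cnj (w i)) * cinner (?v i) (mult_op k (\<lambda>x. 1) h))"
        unfolding v_pair[OF A_one] by (intro sum.cong refl) (simp add: f_val)
      finally show ?thesis by (simp add: x_def mult_op_one cinner_sum_left cinner_scaleC_left)
    qed
    then have "(norm y)\<^sup>2 \<le> norm x * norm h" using cmod_cinner_le[of x h] cmod_cinner_self[of y] by simp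
    also have "\<dots> \<le> norm h * norm y" using \<open>norm x \<le> norm y\<close> by (simp add: mult.commute mult_left_mono)
    finally have "norm y \<le> norm h" by (rule le_of_square_le) simp
    then show "\<exists>g\<in>A. (\<forall>x\<in>z ` I. g x = f x) \<and> (norm (mult_op k g h))\<^sup>2 < 1\<^sup>2 * (norm h)\<^sup>2 + \<epsilon>"
      using congruent_multiplier[OF f \<epsilon>, where h = h and E = "z ` I" and a = "norm h"] by (simp add: y_def)
  qed (use I in auto)
  then show ?thesis using f_val by auto
qed

end

theorem theorem5p5:
  fixes k :: "'x \<Rightarrow> 'h::chilbert_space"
    and A :: "('x \<Rightarrow> complex) set"
  assumes "reproducing_kernels k"
    and "irreducible_kernel k"
    and "complete_nevanlinna_pick k"
    and "dual_subalgebra k A"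
  shows "(\<exists>K. nevanlinna_pick_family k A K) \<and>
    (\<forall>K. cyclic_kernels k A K \<longrightarrow> nevanlinna_pick_family k A K) \<and>
    (\<forall>(n::nat) (z :: nat \<Rightarrow> 'x) (w :: nat \<Rightarrow> complex).
       inj_on z {1..n} \<longrightarrow> separates A (z ` {1..n}) \<longrightarrow>
       ((\<exists>f\<in>A. onorm (mult_op k f) \<le> 1 \<and> (\<forall>i\<in>{1..n}. f (z i) = w i)) \<longleftrightarrow>
        (\<forall>L\<in>CycLat k A. psd_on {1..n}
           (\<lambda>i j. (1 - w i * cnj (w j)) * cinner (orth_proj L (k (z j))) (k (z i))))) \<and>
       ((\<exists>f\<in>A. onorm (mult_op k f) \<le> 1 \<and> (\<forall>i\<in>{1..n}. f (z i) = w i)) \<longleftrightarrow>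
        (\<forall>h. (\<forall>i\<in>{1..n}. fun_of k h (z i) \<noteq> 0) \<longrightarrow> psd_on {1..n}
           (\<lambda>i j. (1 - w i * cnj (w j)) *
              cinner (orth_proj (cyclic_subspace k A h) (k (z j))) (k (z i))))))"
proof -
  interpret dual_algebra k A
    using assms by unfold_locales
  have family: "nevanlinna_pick_family k A K" if "cyclic_kernels k A K" for K
    unfolding nevanlinna_pick_family_def using that distance_formula by simp
  have interpolation: "((\<exists>f\<in>A. onorm (mult_op k f) \<le> 1 \<and> (\<forall>i\<in>{1..n}. f (z i) = w i)) \<longleftrightarrow>
        (\<forall>L\<in>CycLat k A. psd_on {1..n}
           (\<lambda>i j. (1 - w i * cnj (w j)) * cinner (orth_proj L (k (z j))) (k (z i))))) \<and>
       ((\<exists>f\<in>A. onorm (mult_op k f) \<le> 1 \<and> (\<forall>i\<in>{1..n}. f (z i) = w i)) \<longleftrightarrow>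
        (\<forall>h. (\<forall>i\<in>{1..n}. fun_of k h (z i) \<noteq> 0) \<longrightarrow> psd_on {1..n}
           (\<lambda>i j. (1 - w i * cnj (w j)) *
              cinner (orth_proj (cyclic_subspace k A h) (k (z j))) (k (z i)))))"
    if inj: "inj_on z {1..n}" and sep: "separates A (z ` {1..n})"
    for n :: nat and z :: "nat \<Rightarrow> 'x" and w :: "nat \<Rightarrow> complex"
  proof -
    let ?interp = "\<exists>f\<in>A. onorm (mult_op k f) \<le> 1 \<and> (\<forall>i\<in>{1..n}. f (z i) = w i)"
    let ?pick = "\<lambda>L. psd_on {1..n} (\<lambda>i j. (1 - w i * cnj (w j)) * cinner (orth_proj L (k (z j))) (k (z i)))"
    have nec: "?pick (cyc h)" if ?interp for h
      using that interpolation_necessary[where I = "{1..n}" and z = z and w = w and h = h] by blast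
    have suf: ?interp if "\<And>h. (\<forall>i\<in>{1..n}. cinner h (k (z i)) \<noteq> 0) \<Longrightarrow> ?pick (cyc h)"
      by (rule interpolation_sufficient[OF _ inj sep that]) auto
    have "?interp \<longleftrightarrow> (\<forall>L\<in>CycLat k A. ?pick L)"
      using nec suf unfolding CycLat_def by blast
    moreover have "?interp \<longleftrightarrow> (\<forall>h. (\<forall>i\<in>{1..n}. fun_of k h (z i) \<noteq> 0) \<longrightarrow> ?pick (cyc h))"
      using nec suf unfolding fun_of_def by blast
    ultimately show ?thesis by (rule conjI)
  qed
  show ?thesis
    using cyclic_kernels_exist family interpolation by blast
qed

end
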